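(* Assume the learning-rate assumption and the smoothness assumption stated in the context. Let $(\rho_t)_{t\ge0}$ be a weak solution of $\partial_t\rho_t=2\zeta(t)\nabla_\omega\cdot\big(\rho_t\nabla_\omega\Phi(\omega;\rho_t)\big)$ and suppose that the trajectory $\{\rho_t:t\ge0\}$ is precompact in $W_1$. Then: 1. The limit $\mathcal E_\infty=\lim_{t\to\infty}\mathcal E(\rho_t)$ exists. 2. $\mathcal I(\rho_t)\to0$ as $t\to\infty$, where $\mathcal I(\rho)=\int\|\nabla_\omega\Phi(\omega;\rho)\|^2\,\rho(d\omega)$. 3. Every $W_1$-limit point of $\rho_t$ as $t\to\infty$ is a stationary solution of the PDE. 4. The omega-limit set $\Omega(\rho_0)=\{\bar\rho:\exists\,t_n\to\infty\text{ such that }W_1(\rho_{t_n},\bar\rho)\to0\}$ is nonempty, compact, connected, and contained in the set of stationary solutions. 5. If the set of stationary solutions intersected with $\Omega(\rho_0)$ is totally disconnected (in particular if it is finite), then $\rho_t$ converges in $W_1$ to a single stationary solution as $t\to\infty$.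
   Context: Model. Fix positive integers $L,d_x,d_k,d_v$ and a fixed matrix $W_{\mathrm{out}}\in\mathbb R^{d_x\times d_v}$. A head parameter is $\omega=(W_Q,W_K,W_V,W_O)\in\mathbb R^{d_x\times d_k}\times\mathbb R^{d_x\times d_k}\times\mathbb R^{d_x\times d_k}\times\mathbb R^{d_k\times d_x}$, identified with a vector in $\mathbb R^{d_\omega}$. For an input $X\in\mathbb R^{L\times d_x}$ (rows are tokens), the causally masked attention matrix $A_\omega(X)\in\mathbb R^{L\times L}$ has entries $$A_\omega(X)_{rs}=\frac{\exp\big((XW_QW_K^\top X^\top)_{rs}/\sqrt{d_k}\big)}{\sum_{s'\le r}\exp\big((XW_QW_K^\top X^\top)_{rs'}/\sqrt{d_k}\big)}\ (s\le r),\qquad A_\omega(X)_{rs}=0\ (s>r).$$ $\psi_l(X;\omega)\in\mathbb R^{d_v}$ is the $l$-th row of $A_\omega(X)XW_VW_OW_{\mathrm{out}}$, $l=1,\dots,L$. Data and risk. $X$ is a random input and $Y_l(X)\in\mathbb R^{d_v}$ is a one-hot label for each $l$; $\mathbb E_X$ is expectation over $X$. $\mathrm{softmax}_j(z)=e^{z_j}/\sum_m e^{z_m}$. For a probability measure $\rho$ on $\mathbb R^{d_\omega}$, $z_l^\rho(X)=\int\psi_l(X;\omega)\,\rho(d\omega)$. The cross-entropy loss is $\ell(y,z)=\log\big(\sum_{j=1}^{d_v}e^{z_j}\big)-y^\top z$, the risk is $\mathcal E(\rho)=\mathbb E_X\big[\frac1L\sum_{l=1}^L\ell(Y_l(X),z_l^\rho(X))\big]$,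 and its first variation is $$\Phi(\omega;\rho)=\mathbb E_X\Big[\frac1L\sum_{l=1}^L\big\langle\mathrm{softmax}(z_l^\rho(X))-Y_l(X),\psi_l(X;\omega)\big\rangle\Big].$$ Weak and stationary solutions. A weak solution of the PDE is a narrowly continuous curve $t\mapsto\rho_t\in\mathcal P(K)$ such that for every $f\in C^1(K)$, $\frac{d}{dt}\int f\,d\rho_t=-2\zeta(t)\int\langle\nabla f(\omega),\nabla_\omega\Phi(\omega;\rho_t)\rangle\,\rho_t(d\omega)$ in the sense of distributions in time. $\bar\rho\in\mathcal P(K)$ is a stationary solution if the constant curve $\rho_t\equiv\bar\rho$ is a weak solution. $W_1$ is the 1-Wasserstein distance. Learning-rate assumption. $\zeta:[0,\infty)\to[0,\infty)$ is bounded and Lipschitz, and $\int_0^\infty\zeta(t)\,dt=\infty$. Smoothness assumption. $K\subset\mathbb R^{d_\omega}$ and $K_x\subset\mathbb R^{d_x}$ are compact, all measures considered are supported in $K$, all input tokens lie in $K_x$ (so $X\in K_x^L$), the maps $\omega\mapsto\psi_l(X;\omega)$ are $C^3$ on $K$ for all $l$ and almost every $X$, and there is $B_\psi<\infty$ with $$\sup_{X\in K_x^L,\,1\le l\le L,\,\omega\in K}\big(\|\psi_l(X;\omega)\|+\|\nabla_\omega\psi_l(X;\omega)\|+\|\nabla^2_\omega\psi_l(X;\omega)\|+\|\nabla^3_\omega\psi_l(X;\omega)\|\big)\le B_\psi.$$ *)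

theory Defs
  imports "HOL-Probability.Probability"
begin

section \<open>The attention head\<close>

text \<open>
  A matrix in \<open>\<real>\<^bsup>m \<times> n\<^esup>\<close> is an element of \<open>real ^ 'n ^ 'm\<close>.  The index types
  \<open>'l\<close>, \<open>'x\<close>, \<open>'k\<close>, \<open>'v\<close> have cardinalities \<open>L\<close>, \<open>d\<^sub>x\<close>, \<open>d\<^sub>k\<close>, \<open>d\<^sub>v\<close>; the positions \<open>'l\<close> are
  linearly ordered for the causal mask.  The norm and inner product of the product type
  \<open>('x, 'k) head\<close> are the Euclidean ones of the concatenated vector of all entries.
\<close>

type_synonym ('l, 'x) tokens = "real ^ 'x ^ 'l"

type_synonym ('x, 'k) head =
  "(real ^ 'k ^ 'x) \<times> (real ^ 'k ^ 'x) \<times> (real ^ 'k ^ 'x) \<times> (real ^ 'x ^ 'k)"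

definition attention ::
  "('x::finite, 'k::finite) head \<Rightarrow> ('l::{finite,linorder}, 'x) tokens
    \<Rightarrow> real ^ 'l::{finite,linorder} ^ 'l::{finite,linorder}" where
  "attention \<omega> X = (case \<omega> of (W\<^sub>Q, W\<^sub>K, W\<^sub>V, W\<^sub>O) \<Rightarrow>
     let S = X ** W\<^sub>Q ** transpose W\<^sub>K ** transpose X;
         e = (\<lambda>r s. exp (S $ r $ s / sqrt (real CARD('k))))
     in \<chi> r s. if s \<le> r then e r s / (\<Sum>s' | s' \<le> r. e r s') else 0)"

definition head_output ::
  "real ^ 'v::finite ^ 'x \<Rightarrow> 'l \<Rightarrow> ('l::{finite,linorder}, 'x) tokens
    \<Rightarrow> ('x::finite, 'k::finite) head \<Rightarrow> real ^ 'v" where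
  "head_output Wout l X \<omega> = (case \<omega> of (W\<^sub>Q, W\<^sub>K, W\<^sub>V, W\<^sub>O) \<Rightarrow>
     (attention \<omega> X ** X ** W\<^sub>V ** W\<^sub>O ** Wout) $ l)"

section \<open>Risk and first variation\<close>

definition softmax :: "real ^ 'v::finite \<Rightarrow> real ^ 'v" where
  "softmax z = (\<chi> j. exp (z $ j) / (\<Sum>m\<in>UNIV. exp (z $ m)))"

definition cross_entropy :: "real ^ 'v::finite \<Rightarrow> real ^ 'v \<Rightarrow> real" where
  "cross_entropy y z = ln (\<Sum>j\<in>UNIV. exp (z $ j)) - y \<bullet> z"

definition one_hot :: "real ^ 'v::finite \<Rightarrow> bool" where
  "one_hot y \<longleftrightarrow> (\<exists>j. y = axis j 1)"

definition mean_logits ::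
  "real ^ 'v::finite ^ 'x \<Rightarrow> ('x::finite, 'k::finite) head measure
    \<Rightarrow> 'l \<Rightarrow> ('l::{finite,linorder}, 'x) tokens \<Rightarrow> real ^ 'v" where
  "mean_logits Wout \<rho> l X = (\<integral>\<omega>. head_output Wout l X \<omega> \<partial>\<rho>)"

text \<open>Here \<open>P\<close> is the law of the random input \<open>X\<close>, and \<open>Y X l\<close> is the label \<open>Y\<^sub>l(X)\<close>.\<close>

definition risk ::
  "real ^ 'v::finite ^ 'x \<Rightarrow> ('l::{finite,linorder}, 'x) tokens measure
    \<Rightarrow> (('l, 'x) tokens \<Rightarrow> 'l \<Rightarrow> real ^ 'v) \<Rightarrow> ('x::finite, 'k::finite) head measure \<Rightarrow> real" where
  "risk Wout P Y \<rho> =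
     (\<integral>X. (1 / real CARD('l)) * (\<Sum>l\<in>UNIV. cross_entropy (Y X l) (mean_logits Wout \<rho> l X)) \<partial>P)"

definition first_variation ::
  "real ^ 'v::finite ^ 'x \<Rightarrow> ('l::{finite,linorder}, 'x) tokens measure
    \<Rightarrow> (('l, 'x) tokens \<Rightarrow> 'l \<Rightarrow> real ^ 'v)
    \<Rightarrow> ('x::finite, 'k::finite) head measure \<Rightarrow> ('x, 'k) head \<Rightarrow> real" where
  "first_variation Wout P Y \<rho> \<omega> =
     (\<integral>X. (1 / real CARD('l)) *
        (\<Sum>l\<in>UNIV. (softmax (mean_logits Wout \<rho> l X) - Y X l) \<bullet> head_output Wout l X \<omega>) \<partial>P)"

section \<open>Derivatives\<close>

definition gradient :: "('a::euclidean_space \<Rightarrow> real) \<Rightarrow> 'a \<Rightarrow> 'a" where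
  "gradient f x = (THE D. GDERIV f x :> D)"

text \<open>Unlike the bare Frechet derivative, this can be iterated; \<open>norm\<close> is then the operator norm.\<close>

definition fderiv :: "('a::euclidean_space \<Rightarrow> 'b::real_normed_vector) \<Rightarrow> 'a \<Rightarrow> 'a \<Rightarrow>\<^sub>L 'b" where
  "fderiv f x = Blinfun (frechet_derivative f (at x))"

definition C1_on :: "'a set \<Rightarrow> ('a::euclidean_space \<Rightarrow> 'b::real_normed_vector) \<Rightarrow> bool" where
  "C1_on U f \<longleftrightarrow> (\<forall>x\<in>U. f differentiable at x) \<and> continuous_on U (fderiv f)"

text \<open>
  \<open>K\<close> need not have interior points, so smoothness on \<open>K\<close> means smoothness on an open
  neighbourhood of \<open>K\<close>, and derivatives at points of \<open>K\<close> are taken in the ambient space.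
\<close>

definition C3_near :: "'a set \<Rightarrow> ('a::euclidean_space \<Rightarrow> 'b::real_normed_vector) \<Rightarrow> bool" where
  "C3_near K f \<longleftrightarrow>
     (\<exists>U. open U \<and> K \<subseteq> U \<and> C1_on U f \<and> C1_on U (fderiv f) \<and> C1_on U (fderiv (fderiv f)))"

section \<open>Probability measures on \<open>K\<close> and the 1-Wasserstein distance\<close>

definition prob_on :: "'a::euclidean_space set \<Rightarrow> 'a measure set" where
  "prob_on K = {\<mu>. prob_space \<mu> \<and> sets \<mu> = sets borel \<and> emeasure \<mu> K = 1}"

definition couplings :: "'a::euclidean_space measure \<Rightarrow> 'a measure \<Rightarrow> ('a \<times> 'a) measure set" where
  "couplings \<mu> \<nu> =
     {\<gamma>. sets \<gamma> = sets borel \<and> distr \<gamma> borel fst = \<mu> \<and> distr \<gamma> borel snd = \<nu>}"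

text \<open>The infimum is finite whenever \<open>\<mu>\<close>, \<open>\<nu>\<close> are supported in a common compact set.\<close>

definition wasserstein1 :: "'a::euclidean_space measure \<Rightarrow> 'a measure \<Rightarrow> real" where
  "wasserstein1 \<mu> \<nu> =
     enn2real (INF \<gamma>\<in>couplings \<mu> \<nu>. \<integral>\<^sup>+p. ennreal (dist (fst p) (snd p)) \<partial>\<gamma>)"

definition W1_topology :: "'a::euclidean_space set \<Rightarrow> 'a measure topology" where
  "W1_topology K = Metric_space.mtopology (prob_on K) wasserstein1"

definition totally_disconnectedin :: "'a topology \<Rightarrow> 'a set \<Rightarrow> bool" where
  "totally_disconnectedin T S \<longleftrightarrow>
     S \<subseteq> topspace T \<and> (\<forall>C\<subseteq>S. connectedin T C \<longrightarrow> (\<forall>x\<in>C. \<forall>y\<in>C. x = y))"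

section \<open>The gradient flow\<close>

definition narrowly_continuous :: "(real \<Rightarrow> 'a::euclidean_space measure) \<Rightarrow> bool" where
  "narrowly_continuous \<rho> \<longleftrightarrow>
     (\<forall>g :: 'a \<Rightarrow> real. continuous_on UNIV g \<and> bounded (range g) \<longrightarrow>
        continuous_on {0..} (\<lambda>t. \<integral>\<omega>. g \<omega> \<partial>\<rho> t))"

definition time_test :: "(real \<Rightarrow> real) \<Rightarrow> bool" where
  "time_test \<eta> \<longleftrightarrow> (\<forall>n t. (deriv ^^ n) \<eta> differentiable at t) \<and>
     (\<exists>a b. 0 < a \<and> a < b \<and> (\<forall>t. t \<notin> {a..b} \<longrightarrow> \<eta> t = 0))"

text \<open>
  The curve \<open>\<rho>\<close> matters only on \<open>[0, \<infinity>)\<close>.  Elements of \<open>C\<^sup>1(K)\<close> are represented by \<open>C\<^sup>1\<close> functions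
  on the whole space (every \<open>C\<^sup>1\<close> function near the compact set \<open>K\<close> agrees near \<open>K\<close> with such a
  function), with the gradient of the representative.
\<close>

definition weak_solution ::
  "'a::euclidean_space set \<Rightarrow> (real \<Rightarrow> real) \<Rightarrow> ('a measure \<Rightarrow> 'a \<Rightarrow> real) \<Rightarrow> (real \<Rightarrow> 'a measure) \<Rightarrow> bool"
  where
  "weak_solution K \<zeta> \<Phi> \<rho> \<longleftrightarrow>
     (\<forall>t\<ge>0. \<rho> t \<in> prob_on K) \<and> narrowly_continuous \<rho> \<and>
     (\<forall>f \<eta>. C1_on UNIV f \<and> time_test \<eta> \<longrightarrow>
        - (LINT t:{0<..}|lborel. deriv \<eta> t * (\<integral>\<omega>. f \<omega> \<partial>\<rho> t)) =
        (LINT t:{0<..}|lborel. \<eta> t *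
           (- 2 * \<zeta> t * (\<integral>\<omega>. gradient f \<omega> \<bullet> gradient (\<Phi> (\<rho> t)) \<omega> \<partial>\<rho> t))))"

definition stationary_solutions ::
  "'a::euclidean_space set \<Rightarrow> (real \<Rightarrow> real) \<Rightarrow> ('a measure \<Rightarrow> 'a \<Rightarrow> real) \<Rightarrow> 'a measure set" where
  "stationary_solutions K \<zeta> \<Phi> = {\<mu>\<in>prob_on K. weak_solution K \<zeta> \<Phi> (\<lambda>_. \<mu>)}"

definition dissipation :: "('a::euclidean_space measure \<Rightarrow> 'a \<Rightarrow> real) \<Rightarrow> 'a measure \<Rightarrow> real" where
  "dissipation \<Phi> \<rho> = (\<integral>\<omega>. (norm (gradient (\<Phi> \<rho>) \<omega>))\<^sup>2 \<partial>\<rho>)"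

definition omega_limit_set :: "'a::euclidean_space set \<Rightarrow> (real \<Rightarrow> 'a measure) \<Rightarrow> 'a measure set" where
  "omega_limit_set K \<rho> =
     {\<mu>\<in>prob_on K. \<exists>t :: nat \<Rightarrow> real. (\<forall>n. 0 \<le> t n) \<and> filterlim t at_top sequentially \<and>
        (\<lambda>n. wasserstein1 (\<rho> (t n)) \<mu>) \<longlonglongrightarrow> 0}"

section \<open>Standing assumptions\<close>

definition learning_rate :: "(real \<Rightarrow> real) \<Rightarrow> bool" where
  "learning_rate \<zeta> \<longleftrightarrow>
     (\<forall>t\<ge>0. 0 \<le> \<zeta> t) \<and> bounded (\<zeta> ` {0..}) \<and> (\<exists>C. C-lipschitz_on {0..} \<zeta>) \<and>
     (\<integral>\<^sup>+t\<in>{0..}. ennreal (\<zeta> t) \<partial>lborel) = \<infinity>"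

definition inputs :: "(real ^ 'x) set \<Rightarrow> ('l::finite, 'x) tokens set" where
  "inputs K\<^sub>x = {X. \<forall>l. X $ l \<in> K\<^sub>x}"

definition smoothness ::
  "real ^ 'v::finite ^ 'x \<Rightarrow> ('l::{finite,linorder}, 'x) tokens measure
    \<Rightarrow> ('x::finite, 'k::finite) head set \<Rightarrow> (real ^ 'x) set \<Rightarrow> bool" where
  "smoothness Wout P K K\<^sub>x \<longleftrightarrow>
     compact K \<and> compact K\<^sub>x \<and> (AE X in P. X \<in> inputs K\<^sub>x) \<and>
     (\<forall>l. AE X in P. C3_near K (head_output Wout l X)) \<and>
     (\<exists>B. \<forall>X \<in> (inputs K\<^sub>x :: ('l, 'x) tokens set). \<forall>l. \<forall>\<omega>\<in>K.
        (let \<psi> = head_output Wout l X in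
         norm (\<psi> \<omega>) + norm (fderiv \<psi> \<omega>) + norm (fderiv (fderiv \<psi>) \<omega>) +
         norm (fderiv (fderiv (fderiv \<psi>)) \<omega>)) \<le> B)"

end

theory Submission
  imports Defs
begin

text \<open>
  The loss is convex in the logits, so the increment of the risk between two times lies between the
  increments of the potential \<open>\<Phi>\<close> frozen at either end. Both agree with \<open>- 2 \<integral> \<zeta> \<I>\<close> up to an error of
  second order in \<open>\<integral> \<zeta>\<close>, whence \<open>\<E>(\<rho>\<^sub>t) + 2 \<integral>\<^sub>0\<^sup>t \<zeta> \<I> = \<E>(\<rho>\<^sub>0)\<close> and \<open>\<E>\<close> decreases to a limit. As \<open>\<I>\<close> is
  Lipschitz in the clock \<open>\<integral> \<zeta>\<close>, which is unbounded, integrability of \<open>\<zeta> \<I>\<close> forces \<open>\<I> \<rightarrow> 0\<close>.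
  Since \<open>\<I>\<close> is \<open>W\<^sub>1\<close>-continuous, it vanishes at every limit point, whose potential then has zero gradient
  almost everywhere, which makes the limit point stationary. The trajectory is a \<open>W\<^sub>1\<close>-continuous path
  because it is narrowly continuous and precompact, and the topology of the omega-limit set is that of any
  precompact path in a metric space. The triangle inequality for \<open>W\<^sub>1\<close> comes from glueing couplings along a
  countable partition into small cells, without disintegration. The head depends smoothly on the
  parameters on the whole space, so all bounds on derivatives follow from the compactness of \<open>K\<close> and \<open>K\<^sub>x\<close>.
\<close>

section \<open>Wasserstein distance on a compact set\<close>

text \<open>A circularity fixes the order of the estimates. The distributional equation can be
  integrated only once its right-hand side is continuous in time; that side contains the potential
  of the moving measure, so \<open>W\<^sub>1\<close>-continuity of the path has to come before any
  dynamical estimate. Afterwards the equation bounds increments of integrals of test functions and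
  produces no couplings. The predicate \<open>close\<close> records exactly such bounds; a small
  \<open>W\<^sub>1\<close> distance implies it too, and logits, potential and dissipation are all
  controlled by it. Gradient bounds are taken on a ball around the origin that contains
  \<open>K\<close>, because the mean value inequality runs along segments and \<open>K\<close> may
  fail to be convex. Convexity of the loss, used at both ends of a time interval, replaces
  differentiation of the energy along a curve of measures. The rate may vanish for long stretches;
  since motion and energy loss carry the same factor \<open>\<zeta>\<close>, both are compared in
  the clock, where this factor disappears.\<close>

abbreviation transport_cost :: "('a::metric_space \<times> 'a) measure \<Rightarrow> ennreal" where
  "transport_cost \<gamma> \<equiv> \<integral>\<^sup>+p. ennreal (dist (fst p) (snd p)) \<partial>\<gamma>"

section \<open>Couplings, their marginals, and finiteness of the transport cost\<close>

lemma couplings_sets: "\<gamma> \<in> couplings \<mu> \<nu> \<Longrightarrow> sets \<gamma> = sets borel"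
  by (simp add: couplings_def)

lemma couplings_sets_pair:
  assumes "\<gamma> \<in> couplings \<mu> \<nu>"
  shows "sets \<gamma> = sets (borel \<Otimes>\<^sub>M borel)"
  unfolding borel_prod by (rule couplings_sets[OF assms])

lemma couplings_nn_integral:
  assumes "\<gamma> \<in> couplings \<mu> \<nu>" and [measurable]: "g \<in> borel_measurable borel"
  shows "(\<integral>\<^sup>+p. g (fst p) \<partial>\<gamma>) = (\<integral>\<^sup>+x. g x \<partial>\<mu>)" "(\<integral>\<^sup>+p. g (snd p) \<partial>\<gamma>) = (\<integral>\<^sup>+x. g x \<partial>\<nu>)"
proof -
  have [measurable_cong]: "sets \<gamma> = sets (borel \<Otimes>\<^sub>M borel)"
    by (rule couplings_sets_pair[OF assms(1)])
  have *: "\<mu> = distr \<gamma> borel fst" "\<nu> = distr \<gamma> borel snd"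
    using assms(1) by (auto simp: couplings_def)
  show "(\<integral>\<^sup>+p. g (fst p) \<partial>\<gamma>) = (\<integral>\<^sup>+x. g x \<partial>\<mu>)"
    unfolding * by (subst nn_integral_distr) simp_all
  show "(\<integral>\<^sup>+p. g (snd p) \<partial>\<gamma>) = (\<integral>\<^sup>+x. g x \<partial>\<nu>)"
    unfolding * by (subst nn_integral_distr) simp_all
qed

lemma couplings_integral:
  fixes g :: "'a::euclidean_space \<Rightarrow> real"
  assumes "\<gamma> \<in> couplings \<mu> \<nu>" and [measurable]: "g \<in> borel_measurable borel"
  shows "(\<integral>p. g (fst p) \<partial>\<gamma>) = (\<integral>x. g x \<partial>\<mu>)" "(\<integral>p. g (snd p) \<partial>\<gamma>) = (\<integral>x. g x \<partial>\<nu>)"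
    and "integrable \<mu> g \<Longrightarrow> integrable \<gamma> (\<lambda>p. g (fst p))"
    and "integrable \<nu> g \<Longrightarrow> integrable \<gamma> (\<lambda>p. g (snd p))"
proof -
  have [measurable_cong]: "sets \<gamma> = sets (borel \<Otimes>\<^sub>M borel)"
    by (rule couplings_sets_pair[OF assms(1)])
  have *: "\<mu> = distr \<gamma> borel fst" "\<nu> = distr \<gamma> borel snd"
    using assms(1) by (auto simp: couplings_def)
  show "(\<integral>p. g (fst p) \<partial>\<gamma>) = (\<integral>x. g x \<partial>\<mu>)" "(\<integral>p. g (snd p) \<partial>\<gamma>) = (\<integral>x. g x \<partial>\<nu>)"
    unfolding * by (subst integral_distr; simp)+
  show "integrable \<mu> g \<Longrightarrow> integrable \<gamma> (\<lambda>p. g (fst p))"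
    unfolding * by (subst (asm) integrable_distr_eq) simp_all
  show "integrable \<nu> g \<Longrightarrow> integrable \<gamma> (\<lambda>p. g (snd p))"
    unfolding * by (subst (asm) integrable_distr_eq) simp_all
qed

lemma couplings_prob_space:
  assumes "\<gamma> \<in> couplings \<mu> \<nu>" "prob_space \<mu>"
  shows "prob_space \<gamma>"
proof -
  have "emeasure \<gamma> (space \<gamma>) = emeasure \<mu> (space \<mu>)"
    using couplings_nn_integral(1)[OF assms(1), of "\<lambda>_. 1"] by simp
  then show ?thesis
    using assms(2) by (intro prob_spaceI) (simp add: prob_space.emeasure_space_1)
qed

lemma couplings_swap:
  fixes \<gamma> :: "('a::euclidean_space \<times> 'a) measure"
  assumes "\<gamma> \<in> couplings \<mu> \<nu>"
  shows "distr \<gamma> borel prod.swap \<in> couplings \<nu> \<mu>"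
    and "transport_cost (distr \<gamma> borel prod.swap)
      = transport_cost \<gamma>"
proof -
  have [measurable_cong]: "sets \<gamma> = sets (borel \<Otimes>\<^sub>M borel)"
    by (rule couplings_sets_pair[OF assms])
  have [measurable]: "(prod.swap :: 'a \<times> 'a \<Rightarrow> _) \<in> borel \<Otimes>\<^sub>M borel \<rightarrow>\<^sub>M borel"
    unfolding borel_prod prod.swap_def by (intro borel_measurable_continuous_onI continuous_intros)
  have [measurable]: "prod.swap \<in> \<gamma> \<rightarrow>\<^sub>M borel" by simp
  have [measurable]: "(fst :: 'a \<times> 'a \<Rightarrow> 'a) \<in> borel_measurable borel"
      "(snd :: 'a \<times> 'a \<Rightarrow> 'a) \<in> borel_measurable borel"
    by (intro borel_measurable_continuous_onI continuous_intros)+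
  show "distr \<gamma> borel prod.swap \<in> couplings \<nu> \<mu>"
    using assms by (simp add: couplings_def distr_distr o_def)
  show "transport_cost (distr \<gamma> borel prod.swap)
      = transport_cost \<gamma>"
    by (subst nn_integral_distr) (simp_all add: dist_commute)
qed

text \<open>Swapping coordinates maps couplings to couplings at equal cost, so the two infima agree
  already in \<open>ennreal\<close>, before \<open>enn2real\<close> is applied.\<close>

lemma wasserstein1_commute: "wasserstein1 \<mu> \<nu> = wasserstein1 \<nu> \<mu>"
proof -
  have le: "(INF \<gamma>\<in>couplings \<nu> \<mu>. transport_cost \<gamma>)
      \<le> (INF \<gamma>\<in>couplings \<mu> \<nu>. transport_cost \<gamma>)" for \<mu> \<nu> :: "'a measure"
  proof (rule INF_greatest)
    fix \<gamma> :: "('a \<times> 'a) measure" assume g: "\<gamma> \<in> couplings \<mu> \<nu>"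
    show "(INF \<gamma>\<in>couplings \<nu> \<mu>. transport_cost \<gamma>)
        \<le> transport_cost \<gamma>"
      unfolding couplings_swap(2)[OF g, symmetric] by (rule INF_lower[OF couplings_swap(1)[OF g]])
  qed
  show ?thesis
    unfolding wasserstein1_def using le[of \<mu> \<nu>] le[of \<nu> \<mu>] by (simp add: order_antisym)
qed

lemma wasserstein1_nonneg: "0 \<le> wasserstein1 \<mu> \<nu>"
  by (simp add: wasserstein1_def)

lemma prob_onD:
  assumes "\<mu> \<in> prob_on K"
  shows "prob_space \<mu>" "sets \<mu> = sets borel" "space \<mu> = UNIV" "emeasure \<mu> K = 1"
  using assms sets_eq_imp_space_eq[of \<mu> borel] by (auto simp: prob_on_def)

lemma prob_on_AE:
  assumes "\<mu> \<in> prob_on K" "compact K"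
  shows "AE x in \<mu>. x \<in> K"
proof -
  interpret prob_space \<mu> using prob_onD[OF assms(1)] by simp
  have "K \<in> sets \<mu>"
    using prob_onD(2)[OF assms(1)] borel_compact[OF assms(2)] by simp
  moreover have "prob K = 1" using prob_onD[OF assms(1)] by (simp add: measure_def)
  ultimately show ?thesis using AE_prob_1[of K] by simp
qed

text \<open>Junk values do not occur: on a compact set the infimum is finite.\<close>

lemma wasserstein1_ennreal:
  assumes "compact K" "\<mu> \<in> prob_on K" "\<nu> \<in> prob_on K"
  shows "ennreal (wasserstein1 \<mu> \<nu>)
    = (INF \<gamma>\<in>couplings \<mu> \<nu>. transport_cost \<gamma>)"
proof -
  note m = prob_onD[OF assms(2)] and n = prob_onD[OF assms(3)]
  interpret M: prob_space \<mu> by (rule m)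
  interpret N: prob_space \<nu> by (rule n)
  interpret MN: pair_prob_space \<mu> \<nu> ..
  have [measurable_cong]: "sets \<mu> = sets borel" "sets \<nu> = sets borel" using m n by auto
  have s: "sets (\<mu> \<Otimes>\<^sub>M \<nu>) = sets borel"
    unfolding borel_prod[symmetric] using m n by (intro sets_pair_measure_cong) auto
  have "distr (\<mu> \<Otimes>\<^sub>M \<nu>) borel fst = distr (\<mu> \<Otimes>\<^sub>M \<nu>) \<mu> fst"
    using m by (intro distr_cong) auto
  moreover have "distr (\<mu> \<Otimes>\<^sub>M \<nu>) \<mu> fst = \<mu>" by (rule N.distr_pair_fst)
  moreover have "distr (\<mu> \<Otimes>\<^sub>M \<nu>) borel snd = distr (\<mu> \<Otimes>\<^sub>M \<nu>) \<nu> snd"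
    using n by (intro distr_cong) auto
  moreover have "distr (\<mu> \<Otimes>\<^sub>M \<nu>) \<nu> snd = \<nu>"
  proof (rule measure_eqI)
    fix A assume "A \<in> sets (distr (\<mu> \<Otimes>\<^sub>M \<nu>) \<nu> snd)"
    then have A: "A \<in> sets \<nu>" by simp
    have "snd -` A \<inter> space (\<mu> \<Otimes>\<^sub>M \<nu>) = space \<mu> \<times> A"
      using m n by (auto simp: space_pair_measure)
    then show "emeasure (distr (\<mu> \<Otimes>\<^sub>M \<nu>) \<nu> snd) A = emeasure \<nu> A"
      using A by (simp add: emeasure_distr N.emeasure_pair_measure_Times M.emeasure_space_1)
  qed simp
  ultimately have c: "\<mu> \<Otimes>\<^sub>M \<nu> \<in> couplings \<mu> \<nu>"
    using s by (simp add: couplings_def)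
  \<comment> \<open>The product coupling witnesses finiteness: almost all its pairs lie in
    \<open>K \<times> K\<close>, where distances are at most twice a radius of
    \<open>K\<close>.\<close>
  obtain a where a: "\<And>x. x \<in> K \<Longrightarrow> norm x \<le> a"
    using assms(1) compact_imp_bounded bounded_iff by metis
  have fin: "transport_cost (\<mu> \<Otimes>\<^sub>M \<nu>) < \<infinity>"
  proof -
    have "AE x in \<mu>. AE y in \<nu>. x \<in> K \<and> y \<in> K"
      using prob_on_AE[OF assms(2,1)] prob_on_AE[OF assms(3,1)] by auto
    moreover have [measurable]: "K \<in> sets borel" using assms(1) by (simp add: borel_compact)
    moreover have "{p \<in> space (\<mu> \<Otimes>\<^sub>M \<nu>). fst p \<in> K \<and> snd p \<in> K} \<in> sets (\<mu> \<Otimes>\<^sub>M \<nu>)"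
      by measurable
    ultimately have "AE p in \<mu> \<Otimes>\<^sub>M \<nu>. fst p \<in> K \<and> snd p \<in> K"
      by (intro MN.AE_pair_measure) simp_all
    then have "transport_cost (\<mu> \<Otimes>\<^sub>M \<nu>) \<le> (\<integral>\<^sup>+p. ennreal (a + a) \<partial>(\<mu> \<Otimes>\<^sub>M \<nu>))"
      by (intro nn_integral_mono_AE, eventually_elim)
        (metis a add_mono dist_norm ennreal_leI norm_triangle_le_diff)
    also have "\<dots> < \<infinity>" by (simp add: MN.emeasure_space_1)
    finally show ?thesis .
  qed
  have "(INF \<gamma>\<in>couplings \<mu> \<nu>. transport_cost \<gamma>) < \<infinity>"
    using INF_lower[OF c] fin by (meson le_less_trans)
  then show ?thesis unfolding wasserstein1_def by simp
qed

section \<open>Glueing of couplings and the triangle inequality\<close>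

lemma ennreal_inverse_self_mult:
  fixes a :: ennreal
  assumes "a \<noteq> 0" "a \<noteq> \<infinity>"
  shows "inverse a * a = 1"
  using assms ennreal_divide_self[of a] by (simp add: divide_ennreal_def mult.commute less_top)

text \<open>The product of the two couplings is reweighted by a density that forces both middle
  points into the same cell and divides by the \<open>\<nu>\<close>-mass of that cell. This leaves
  both couplings intact as marginals. The two middle points need not coincide, but they are at most
  \<open>e\<close> apart, which is the extra cost.\<close>

lemma couplings_glue:
  fixes \<gamma>\<^sub>1 :: "('a::euclidean_space \<times> 'a) measure"
  assumes g1: "\<gamma>\<^sub>1 \<in> couplings \<mu> \<nu>" and g2: "\<gamma>\<^sub>2 \<in> couplings \<nu> \<eta>"
    and "prob_space \<mu>" "prob_space \<nu>" and s: "sets \<nu> = sets borel" and "0 < e"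
  obtains \<gamma> where "\<gamma> \<in> couplings \<mu> \<eta>"
    "transport_cost \<gamma> \<le>
       transport_cost \<gamma>\<^sub>1 + transport_cost \<gamma>\<^sub>2 + ennreal e"
proof -
  interpret G1: prob_space \<gamma>\<^sub>1 using couplings_prob_space[OF g1] assms by simp
  interpret G2: prob_space \<gamma>\<^sub>2 using couplings_prob_space[OF g2] assms by simp
  interpret N: prob_space \<nu> by fact
  interpret G: pair_prob_space \<gamma>\<^sub>1 \<gamma>\<^sub>2 ..
  have [measurable_cong]: "sets \<gamma>\<^sub>1 = sets (borel \<Otimes>\<^sub>M borel)" "sets \<gamma>\<^sub>2 = sets (borel \<Otimes>\<^sub>M borel)"
    "sets \<nu> = sets borel"
    using couplings_sets_pair[OF g1] couplings_sets_pair[OF g2] s by simp_all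
  obtain D :: "'a set" where D: "countable D" "\<And>X. open X \<Longrightarrow> X \<noteq> {} \<Longrightarrow> \<exists>d\<in>D. d \<in> X"
    using countable_dense_setE by blast
  then have "D \<noteq> {}" by (metis empty_iff open_UNIV UNIV_not_empty)
  \<comment> \<open>\<open>q\<close> numbers the cells of a countable Borel partition into sets of diameter less than \<open>e\<close>.\<close>
  define q where "q x = (LEAST i. dist (from_nat_into D i) x < e / 2)" for x
  have [measurable]: "q \<in> borel \<rightarrow>\<^sub>M count_space UNIV"
    unfolding q_def by measurable
  have qd: "dist (from_nat_into D (q x)) x < e / 2" for x
  proof -
    obtain d where "d \<in> D" "d \<in> ball x (e / 2)"
      using D(2)[of "ball x (e / 2)"] \<open>0 < e\<close> by auto
    then have "dist (from_nat_into D (to_nat_on D d)) x < e / 2"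
      using D(1) by (simp add: dist_commute)
    then show ?thesis unfolding q_def by (rule LeastI)
  qed
  have qe: "dist x y \<le> e" if "q x = q y" for x y
    using dist_triangle2[of x y "from_nat_into D (q x)"] qd[of x] qd[of y] that
    by (simp add: dist_commute)
  define c where "c i = emeasure \<nu> {y. q y = i}" for i
  have c_fin: "c i \<noteq> \<infinity>" for i unfolding c_def by simp
  have cell_sets: "{y. q y = i} \<in> sets borel" for i
  proof -
    have "{y \<in> space borel. q y = i} \<in> sets borel" by measurable
    then show ?thesis by simp
  qed
  \<comment> \<open>On a cell of mass zero \<open>inverse (c i)\<close> is infinite. There are only
    countably many cells, so almost every point avoids these.\<close>
  have c_pos: "AE y in \<nu>. c (q y) \<noteq> 0"
  proof -
    have "AE y in \<nu>. c i = 0 \<longrightarrow> q y \<noteq> i" for i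
    proof (cases "c i = 0")
      case True
      then have "{y. q y = i} \<in> null_sets \<nu>" by (simp add: c_def null_sets_def)
      then show ?thesis using AE_not_in by force
    qed simp
    then have "AE y in \<nu>. \<forall>i. c i = 0 \<longrightarrow> q y \<noteq> i" by (simp add: AE_all_countable)
    then show ?thesis by eventually_elim auto
  qed
  have [measurable]: "c \<in> borel_measurable (count_space UNIV)" by simp
  have [measurable]: "(\<lambda>i. inverse (c i)) \<in> borel_measurable (count_space UNIV)" by simp
  \<comment> \<open>Equality of two cell numbers is a countable union over their common
    value.\<close>
  have [measurable]: "Measurable.pred ((borel \<Otimes>\<^sub>M borel) \<Otimes>\<^sub>M (borel \<Otimes>\<^sub>M borel))
      (\<lambda>p. q (snd (fst p)) = q (fst (snd p)))"
  proof -
    have "Measurable.pred ((borel \<Otimes>\<^sub>M borel) \<Otimes>\<^sub>M (borel \<Otimes>\<^sub>M borel))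
      (\<lambda>p. \<exists>i. q (snd (fst p)) = i \<and> q (fst (snd p)) = i)" by measurable
    then show ?thesis by (simp add: eq_commute)
  qed
  define h where "h p = (if q (snd (fst p)) = q (fst (snd p)) then inverse (c (q (snd (fst p)))) else 0)"
    for p :: "('a \<times> 'a) \<times> ('a \<times> 'a)"
  have h1: "h (a, b) = (if q (snd a) = q (fst b) then inverse (c (q (snd a))) else 0)" for a b
    by (simp add: h_def cong: if_cong)
  have h2: "h (a, b) = (if q (fst b) = q (snd a) then inverse (c (q (fst b))) else 0)" for a b
    by (cases "q (fst b) = q (snd a)") (simp_all add: h1)
  have [measurable]: "h \<in> borel_measurable (\<gamma>\<^sub>1 \<Otimes>\<^sub>M \<gamma>\<^sub>2)"
    unfolding h_def by measurable
  define \<pi> where "\<pi> = density (\<gamma>\<^sub>1 \<Otimes>\<^sub>M \<gamma>\<^sub>2) h"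
  \<comment> \<open>With one middle point fixed in cell \<open>i\<close>, the density integrates to
    one over the other: both middle points have law \<open>\<nu>\<close>.\<close>
  have mass: "(\<integral>\<^sup>+y. (if i = q y then inverse (c i) else 0) \<partial>\<nu>) = 1" if "c i \<noteq> 0" for i
  proof -
    have "(\<integral>\<^sup>+y. (if i = q y then inverse (c i) else 0) \<partial>\<nu>) = (\<integral>\<^sup>+y. inverse (c i) * indicator {y. q y = i} y \<partial>\<nu>)"
      by (rule nn_integral_cong) (simp add: indicator_def)
    also have "\<dots> = inverse (c i) * c i"
      unfolding c_def by (rule nn_integral_cmult_indicator) (use cell_sets s in simp)
    finally show ?thesis using ennreal_inverse_self_mult[OF that c_fin] by simp
  qed
  have AE1: "AE p in \<gamma>\<^sub>1. c (q (snd p)) \<noteq> 0"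
  proof -
    have c\<nu>: "distr \<gamma>\<^sub>1 borel snd = \<nu>" using g1 by (simp add: couplings_def)
    have "AE y in distr \<gamma>\<^sub>1 borel snd. c (q y) \<noteq> 0" unfolding c\<nu> by (rule c_pos)
    then show ?thesis by (simp add: AE_distr_iff)
  qed
  have AE2: "AE p in \<gamma>\<^sub>2. c (q (fst p)) \<noteq> 0"
  proof -
    have c\<nu>: "distr \<gamma>\<^sub>2 borel fst = \<nu>" using g2 by (simp add: couplings_def)
    have "AE y in distr \<gamma>\<^sub>2 borel fst. c (q y) \<noteq> 0" unfolding c\<nu> by (rule c_pos)
    then show ?thesis by (simp add: AE_distr_iff)
  qed
  \<comment> \<open>Here and in \<open>I2\<close> the test function sees a whole pair, so that the
    outer marginals and the two costs can all be read off from the same identity.\<close>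
  have I1: "(\<integral>\<^sup>+p. g (fst p) \<partial>\<pi>) = (\<integral>\<^sup>+p. g p \<partial>\<gamma>\<^sub>1)" if [measurable]: "g \<in> borel_measurable (borel \<Otimes>\<^sub>M borel)" for g
  proof -
    have "(\<integral>\<^sup>+p. g (fst p) \<partial>\<pi>) = (\<integral>\<^sup>+p. h p * g (fst p) \<partial>(\<gamma>\<^sub>1 \<Otimes>\<^sub>M \<gamma>\<^sub>2))"
      unfolding \<pi>_def by (rule nn_integral_density) measurable
    also have "\<dots> = (\<integral>\<^sup>+a. \<integral>\<^sup>+b. h (a, b) * g a \<partial>\<gamma>\<^sub>2 \<partial>\<gamma>\<^sub>1)"
    proof -
      have "(\<lambda>p. h p * g (fst p)) \<in> borel_measurable (\<gamma>\<^sub>1 \<Otimes>\<^sub>M \<gamma>\<^sub>2)" by measurable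
      from G2.nn_integral_fst[OF this] show ?thesis by simp
    qed
    also have "\<dots> = (\<integral>\<^sup>+a. (\<integral>\<^sup>+b. h (a, b) \<partial>\<gamma>\<^sub>2) * g a \<partial>\<gamma>\<^sub>1)"
      by (intro nn_integral_cong nn_integral_multc) measurable
    also have "\<dots> = (\<integral>\<^sup>+a. g a \<partial>\<gamma>\<^sub>1)"
    proof (rule nn_integral_cong_AE)
      show "AE a in \<gamma>\<^sub>1. (\<integral>\<^sup>+b. h (a, b) \<partial>\<gamma>\<^sub>2) * g a = g a"
        using AE1
      proof eventually_elim
        case (elim a)
        have "(\<integral>\<^sup>+b. h (a, b) \<partial>\<gamma>\<^sub>2) = (\<integral>\<^sup>+y. (if q (snd a) = q y then inverse (c (q (snd a))) else 0) \<partial>\<nu>)"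
          unfolding h1 using couplings_nn_integral(1)[OF g2, of "\<lambda>y. if q (snd a) = q y then inverse (c (q (snd a))) else 0"]
          by simp
        then show ?case using mass[OF elim] by simp
      qed
    qed
    finally show ?thesis .
  qed
  have I2: "(\<integral>\<^sup>+p. g (snd p) \<partial>\<pi>) = (\<integral>\<^sup>+p. g p \<partial>\<gamma>\<^sub>2)" if [measurable]: "g \<in> borel_measurable (borel \<Otimes>\<^sub>M borel)" for g
  proof -
    have "(\<integral>\<^sup>+p. g (snd p) \<partial>\<pi>) = (\<integral>\<^sup>+p. h p * g (snd p) \<partial>(\<gamma>\<^sub>1 \<Otimes>\<^sub>M \<gamma>\<^sub>2))"
      unfolding \<pi>_def by (rule nn_integral_density) measurable
    also have "\<dots> = (\<integral>\<^sup>+b. \<integral>\<^sup>+a. h (a, b) * g b \<partial>\<gamma>\<^sub>1 \<partial>\<gamma>\<^sub>2)"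
    proof -
      have "(\<lambda>p. h p * g (snd p)) \<in> borel_measurable (\<gamma>\<^sub>1 \<Otimes>\<^sub>M \<gamma>\<^sub>2)" by measurable
      from G.nn_integral_snd[OF this] show ?thesis by simp
    qed
    also have "\<dots> = (\<integral>\<^sup>+b. (\<integral>\<^sup>+a. h (a, b) \<partial>\<gamma>\<^sub>1) * g b \<partial>\<gamma>\<^sub>2)"
      by (intro nn_integral_cong nn_integral_multc) measurable
    also have "\<dots> = (\<integral>\<^sup>+b. g b \<partial>\<gamma>\<^sub>2)"
    proof (rule nn_integral_cong_AE)
      show "AE b in \<gamma>\<^sub>2. (\<integral>\<^sup>+a. h (a, b) \<partial>\<gamma>\<^sub>1) * g b = g b"
        using AE2
      proof eventually_elim
        case (elim b)
        have "(\<integral>\<^sup>+a. h (a, b) \<partial>\<gamma>\<^sub>1) = (\<integral>\<^sup>+a. (if q (fst b) = q (snd a) then inverse (c (q (fst b))) else 0) \<partial>\<gamma>\<^sub>1)"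
          unfolding h2 ..
        also have "\<dots> = (\<integral>\<^sup>+y. (if q (fst b) = q y then inverse (c (q (fst b))) else 0) \<partial>\<nu>)"
          using couplings_nn_integral(2)[OF g1, of "\<lambda>y. if q (fst b) = q y then inverse (c (q (fst b))) else 0"]
          by simp
        finally show ?case using mass[OF elim] by simp
      qed
    qed
    finally show ?thesis .
  qed
  have [measurable_cong]: "sets \<pi> = sets ((borel \<Otimes>\<^sub>M borel) \<Otimes>\<^sub>M (borel \<Otimes>\<^sub>M borel))"
    unfolding \<pi>_def sets_density
    by (intro sets_pair_measure_cong couplings_sets_pair[OF g1] couplings_sets_pair[OF g2])
  define k where "k = (\<lambda>p :: ('a \<times> 'a) \<times> ('a \<times> 'a). (fst (fst p), snd (snd p)))"
  have [measurable]: "k \<in> \<pi> \<rightarrow>\<^sub>M borel" unfolding k_def borel_prod[symmetric] by measurable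
  have [measurable]: "(fst :: 'a \<times> 'a \<Rightarrow> 'a) \<in> borel_measurable borel"
      "(snd :: 'a \<times> 'a \<Rightarrow> 'a) \<in> borel_measurable borel"
    by (intro borel_measurable_continuous_onI continuous_intros)+
  have m1: "sets \<mu> = sets borel" "sets \<eta> = sets borel"
    using g1 g2 by (auto simp: couplings_def)
  have P1: "emeasure \<pi> (space \<pi>) = 1"
    using I1[of "\<lambda>_. 1"] by (simp add: G1.emeasure_space_1)
  show ?thesis
  proof
    have "distr (distr \<pi> borel k) borel fst = \<mu>"
    proof (rule measure_eqI)
      fix A assume "A \<in> sets (distr (distr \<pi> borel k) borel fst)"
      then have [measurable]: "A \<in> sets borel" by simp
      have "emeasure (distr (distr \<pi> borel k) borel fst) A = (\<integral>\<^sup>+p. indicator A (fst (fst p)) \<partial>\<pi>)"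
        by (simp flip: nn_integral_indicator add: nn_integral_distr k_def)
      also have "\<dots> = (\<integral>\<^sup>+p. indicator A (fst p) \<partial>\<gamma>\<^sub>1)"
        by (rule I1[of "\<lambda>p. indicator A (fst p)"]) measurable
      also have "\<dots> = emeasure \<mu> A"
        using couplings_nn_integral(1)[OF g1, of "indicator A"] m1 by simp
      finally show "emeasure (distr (distr \<pi> borel k) borel fst) A = emeasure \<mu> A" .
    qed (use m1 in simp)
    moreover have "distr (distr \<pi> borel k) borel snd = \<eta>"
    proof (rule measure_eqI)
      fix A assume "A \<in> sets (distr (distr \<pi> borel k) borel snd)"
      then have [measurable]: "A \<in> sets borel" by simp
      have "emeasure (distr (distr \<pi> borel k) borel snd) A = (\<integral>\<^sup>+p. indicator A (snd (snd p)) \<partial>\<pi>)"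
        by (simp flip: nn_integral_indicator add: nn_integral_distr k_def)
      also have "\<dots> = (\<integral>\<^sup>+p. indicator A (snd p) \<partial>\<gamma>\<^sub>2)"
        by (rule I2[of "\<lambda>p. indicator A (snd p)"]) measurable
      also have "\<dots> = emeasure \<eta> A"
        using couplings_nn_integral(2)[OF g2, of "indicator A"] m1 by simp
      finally show "emeasure (distr (distr \<pi> borel k) borel snd) A = emeasure \<eta> A" .
    qed (use m1 in simp)
    ultimately show "distr \<pi> borel k \<in> couplings \<mu> \<eta>" by (simp add: couplings_def)
    \<comment> \<open>The density vanishes when the middle points lie in different cells, so
      \<open>qe\<close> bounds their distance almost everywhere.\<close>
    have cell: "AE p in \<pi>. q (snd (fst p)) = q (fst (snd p))"
      unfolding \<pi>_def by (subst AE_density) (simp_all add: h_def)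
    have "transport_cost (distr \<pi> borel k)
        = (\<integral>\<^sup>+p. ennreal (dist (fst (fst p)) (snd (snd p))) \<partial>\<pi>)"
      by (subst nn_integral_distr) (simp_all add: k_def)
    also have "\<dots> \<le> (\<integral>\<^sup>+p. ennreal (dist (fst (fst p)) (snd (fst p))) + ennreal (dist (fst (snd p)) (snd (snd p))) + ennreal e \<partial>\<pi>)"
      using cell
    proof (intro nn_integral_mono_AE, eventually_elim)
      case (elim p)
      have "dist (fst (fst p)) (snd (snd p)) \<le> dist (fst (fst p)) (snd (fst p)) + dist (fst (snd p)) (snd (snd p)) + e"
        using qe[OF elim(2)] dist_triangle[of "fst (fst p)" "snd (snd p)" "snd (fst p)"]
          dist_triangle[of "snd (fst p)" "snd (snd p)" "fst (snd p)"] by linarith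
      then show ?case using \<open>0 < e\<close> by (simp flip: ennreal_plus)
    qed
    also have "\<dots> = (\<integral>\<^sup>+p. ennreal (dist (fst (fst p)) (snd (fst p))) \<partial>\<pi>)
        + (\<integral>\<^sup>+p. ennreal (dist (fst (snd p)) (snd (snd p))) \<partial>\<pi>) + ennreal e"
      by (simp add: nn_integral_add P1)
    also have "\<dots> = transport_cost \<gamma>\<^sub>1 + transport_cost \<gamma>\<^sub>2 + ennreal e"
      using I1[of "\<lambda>p. ennreal (dist (fst p) (snd p))"] I2[of "\<lambda>p. ennreal (dist (fst p) (snd p))"] by simp
    finally show "transport_cost (distr \<pi> borel k) \<le>
       transport_cost \<gamma>\<^sub>1 + transport_cost \<gamma>\<^sub>2 + ennreal e" .
  qed
qed

lemma wasserstein1_obtain_coupling: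
  assumes "compact K" "\<mu> \<in> prob_on K" "\<nu> \<in> prob_on K" "0 < e"
  obtains \<gamma> where "\<gamma> \<in> couplings \<mu> \<nu>"
    "transport_cost \<gamma> \<le> ennreal (wasserstein1 \<mu> \<nu> + e)"
proof -
  have "(INF \<gamma>\<in>couplings \<mu> \<nu>. transport_cost \<gamma>) < ennreal (wasserstein1 \<mu> \<nu> + e)"
    unfolding wasserstein1_ennreal[OF assms(1-3), symmetric]
    using \<open>0 < e\<close> by (simp add: ennreal_lessI wasserstein1_nonneg add_nonneg_pos)
  then show ?thesis using that by (auto simp: INF_less_iff intro: less_imp_le)
qed

lemma wasserstein1_le_coupling:
  assumes "compact K" "\<mu> \<in> prob_on K" "\<nu> \<in> prob_on K" "\<gamma> \<in> couplings \<mu> \<nu>" "0 \<le> a"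
    "transport_cost \<gamma> \<le> ennreal a"
  shows "wasserstein1 \<mu> \<nu> \<le> a"
proof -
  have "ennreal (wasserstein1 \<mu> \<nu>) \<le> ennreal a"
    unfolding wasserstein1_ennreal[OF assms(1-3)] using INF_lower[OF assms(4)] assms(6) by (rule order_trans)
  then show ?thesis using assms(5) by simp
qed

lemma wasserstein1_triangle:
  assumes "compact K" "\<mu> \<in> prob_on K" "\<nu> \<in> prob_on K" "\<eta> \<in> prob_on K"
  shows "wasserstein1 \<mu> \<eta> \<le> wasserstein1 \<mu> \<nu> + wasserstein1 \<nu> \<eta>"
proof (rule field_le_epsilon)
  fix e :: real assume "0 < e"
  \<comment> \<open>One third of the error for each nearly optimal coupling and one for the
    glueing.\<close>
  then have e: "0 < e / 3" by simp
  obtain \<gamma>\<^sub>1 where 1: "\<gamma>\<^sub>1 \<in> couplings \<mu> \<nu>"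
    "transport_cost \<gamma>\<^sub>1 \<le> ennreal (wasserstein1 \<mu> \<nu> + e / 3)"
    by (rule wasserstein1_obtain_coupling[OF assms(1-3) e])
  obtain \<gamma>\<^sub>2 where 2: "\<gamma>\<^sub>2 \<in> couplings \<nu> \<eta>"
    "transport_cost \<gamma>\<^sub>2 \<le> ennreal (wasserstein1 \<nu> \<eta> + e / 3)"
    by (rule wasserstein1_obtain_coupling[OF assms(1,3,4) e])
  obtain \<gamma> where 3: "\<gamma> \<in> couplings \<mu> \<eta>"
    "transport_cost \<gamma> \<le>
       transport_cost \<gamma>\<^sub>1 + transport_cost \<gamma>\<^sub>2 + ennreal (e / 3)"
    using couplings_glue[OF 1(1) 2(1) _ _ _ e] prob_onD[OF assms(2)] prob_onD[OF assms(3)] by blast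
  note 3(2)
  also have "\<dots> \<le> ennreal (wasserstein1 \<mu> \<nu> + e / 3) + ennreal (wasserstein1 \<nu> \<eta> + e / 3) + ennreal (e / 3)"
    using 1(2) 2(2) by (intro add_mono) auto
  also have "\<dots> = ennreal (wasserstein1 \<mu> \<nu> + wasserstein1 \<nu> \<eta> + e)"
    using wasserstein1_nonneg[of \<mu> \<nu>] wasserstein1_nonneg[of \<nu> \<eta>] \<open>0 < e\<close>
    by (simp flip: ennreal_plus)
  finally show "wasserstein1 \<mu> \<eta> \<le> wasserstein1 \<mu> \<nu> + wasserstein1 \<nu> \<eta> + e"
    using wasserstein1_nonneg[of \<mu> \<nu>] wasserstein1_nonneg[of \<nu> \<eta>] \<open>0 < e\<close>
    by (intro wasserstein1_le_coupling[OF assms(1,2,4) 3(1)]) auto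
qed

lemma wasserstein1_self:
  fixes \<mu> :: "'a::euclidean_space measure"
  assumes "compact K" "\<mu> \<in> prob_on K"
  shows "wasserstein1 \<mu> \<mu> = 0"
proof -
  note m = prob_onD[OF assms(2)]
  have [measurable_cong]: "sets \<mu> = sets borel" by (rule m)
  have [measurable]: "(\<lambda>x. (x, x)) \<in> \<mu> \<rightarrow>\<^sub>M borel" unfolding borel_prod[symmetric] by measurable
  have [measurable]: "(fst :: 'a \<times> 'a \<Rightarrow> 'a) \<in> borel_measurable borel"
      "(snd :: 'a \<times> 'a \<Rightarrow> 'a) \<in> borel_measurable borel"
    by (intro borel_measurable_continuous_onI continuous_intros)+
  have id: "distr \<mu> borel (\<lambda>x. x) = \<mu>"
    using m by (intro measure_eqI) (auto simp: emeasure_distr)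
  have "distr \<mu> borel (\<lambda>x. (x, x)) \<in> couplings \<mu> \<mu>"
    using id by (simp add: couplings_def distr_distr o_def)
  moreover have "transport_cost (distr \<mu> borel (\<lambda>x. (x, x))) = 0"
    by (subst nn_integral_distr) simp_all
  ultimately have "wasserstein1 \<mu> \<mu> \<le> 0"
    by (intro wasserstein1_le_coupling[OF assms(1,2,2)]) auto
  then show ?thesis using wasserstein1_nonneg[of \<mu> \<mu>] by simp
qed

section \<open>Lipschitz test functions and the metric axioms\<close>

lemma prob_on_integrable:
  fixes h :: "'a::euclidean_space \<Rightarrow> real"
  assumes "compact K" "\<mu> \<in> prob_on K" "h \<in> borel_measurable borel" "\<And>x. x \<in> K \<Longrightarrow> \<bar>h x\<bar> \<le> B"
  shows "integrable \<mu> h"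
proof -
  note m = prob_onD[OF assms(2)]
  interpret prob_space \<mu> by (rule m)
  show ?thesis
  proof (rule integrable_const_bound[of _ B])
    show "AE x in \<mu>. norm (h x) \<le> B"
      using prob_on_AE[OF assms(2,1)] by eventually_elim (use assms(4) in auto)
    show "h \<in> borel_measurable \<mu>" using assms(3) m measurable_cong_sets by blast
  qed
qed

text \<open>The easy half of Kantorovich duality: the Lipschitz bound is integrated against a nearly
  optimal coupling. Both marginals are carried by \<open>K\<close>, so almost every pair lies in
  \<open>K \<times> K\<close>, where the bound is available.\<close>

lemma wasserstein1_lipschitz:
  fixes h :: "'a::euclidean_space \<Rightarrow> real"
  assumes "compact K" "\<mu> \<in> prob_on K" "\<nu> \<in> prob_on K"
    and h[measurable]: "h \<in> borel_measurable borel" and L: "L-lipschitz_on K h"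
  shows "\<bar>(\<integral>x. h x \<partial>\<mu>) - (\<integral>x. h x \<partial>\<nu>)\<bar> \<le> L * wasserstein1 \<mu> \<nu>"
proof -
  have "0 \<le> L" using L lipschitz_on_nonneg by blast
  have "continuous_on K h" using L lipschitz_on_continuous_on by blast
  then have "bounded (h ` K)" using assms(1) compact_continuous_image compact_imp_bounded by blast
  then obtain B where B: "\<And>x. x \<in> K \<Longrightarrow> \<bar>h x\<bar> \<le> B" by (auto simp: bounded_iff)
  have "\<bar>(\<integral>x. h x \<partial>\<mu>) - (\<integral>x. h x \<partial>\<nu>)\<bar> \<le> L * (wasserstein1 \<mu> \<nu> + e)" if e: "0 < e" for e
  proof -
    obtain \<gamma> where g: "\<gamma> \<in> couplings \<mu> \<nu>"
      "transport_cost \<gamma> \<le> ennreal (wasserstein1 \<mu> \<nu> + e)"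
      by (rule wasserstein1_obtain_coupling[OF assms(1-3) e])
    have [measurable_cong]: "sets \<gamma> = sets (borel \<Otimes>\<^sub>M borel)"
      by (rule couplings_sets_pair[OF g(1)])
    have di: "integrable \<gamma> (\<lambda>p. dist (fst p) (snd p))"
      using g(2) by (intro integrableI_bounded) (auto simp: less_top[symmetric] top_unique)
    have c: "distr \<gamma> borel fst = \<mu>" "distr \<gamma> borel snd = \<nu>"
      using g(1) by (auto simp: couplings_def)
    have "AE x in distr \<gamma> borel fst. x \<in> K" "AE x in distr \<gamma> borel snd. x \<in> K"
      unfolding c by (rule prob_on_AE[OF assms(2,1)] prob_on_AE[OF assms(3,1)])+
    moreover have "K \<in> sets borel" using assms(1) by (simp add: borel_compact)
    ultimately have AE: "AE p in \<gamma>. fst p \<in> K" "AE p in \<gamma>. snd p \<in> K"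
      by (simp_all add: AE_distr_iff)
    have i: "integrable \<gamma> (\<lambda>p. h (fst p))" "integrable \<gamma> (\<lambda>p. h (snd p))"
      using couplings_integral(3,4)[OF g(1) h] prob_on_integrable[OF assms(1,2) h B]
        prob_on_integrable[OF assms(1,3) h B] by auto
    have "\<bar>(\<integral>x. h x \<partial>\<mu>) - (\<integral>x. h x \<partial>\<nu>)\<bar> = \<bar>\<integral>p. h (fst p) - h (snd p) \<partial>\<gamma>\<bar>"
      using i by (simp add: couplings_integral(1,2)[OF g(1) h])
    also have "\<dots> \<le> (\<integral>p. \<bar>h (fst p) - h (snd p)\<bar> \<partial>\<gamma>)" by (rule integral_abs_bound)
    also have "\<dots> \<le> (\<integral>p. L * dist (fst p) (snd p) \<partial>\<gamma>)"
    proof (intro integral_mono_AE)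
      show "AE p in \<gamma>. \<bar>h (fst p) - h (snd p)\<bar> \<le> L * dist (fst p) (snd p)"
        using AE by eventually_elim (metis L lipschitz_onD dist_real_def)
    qed (use i di in auto)
    also have "\<dots> = L * (\<integral>p. dist (fst p) (snd p) \<partial>\<gamma>)" by simp
    also have "\<dots> \<le> L * (wasserstein1 \<mu> \<nu> + e)"
    proof (rule mult_left_mono[OF _ \<open>0 \<le> L\<close>])
      have "ennreal (\<integral>p. dist (fst p) (snd p) \<partial>\<gamma>) \<le> ennreal (wasserstein1 \<mu> \<nu> + e)"
        using g(2) nn_integral_eq_integral[OF di] by simp
      then show "(\<integral>p. dist (fst p) (snd p) \<partial>\<gamma>) \<le> wasserstein1 \<mu> \<nu> + e"
        using e wasserstein1_nonneg[of \<mu> \<nu>] by (simp del: ennreal_plus)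
    qed
    finally show ?thesis .
  qed
  note key = this
  show ?thesis
  proof (rule field_le_epsilon)
    fix e :: real assume "0 < e"
    \<comment> \<open>The divisor is \<open>L + 1\<close> because \<open>L\<close> may be
      zero.\<close>
    have "L * (e / (L + 1)) \<le> e" using \<open>0 \<le> L\<close> \<open>0 < e\<close> by (simp add: field_simps)
    then show "\<bar>(\<integral>x. h x \<partial>\<mu>) - (\<integral>x. h x \<partial>\<nu>)\<bar> \<le> L * wasserstein1 \<mu> \<nu> + e"
      using key[of "e / (L + 1)"] \<open>0 \<le> L\<close> \<open>0 < e\<close> by (simp add: distrib_left)
  qed
qed

text \<open>Closed sets generate the Borel sets and are stable under intersection, and the indicator
  of a closed set is the pointwise limit of the Lipschitz functions
  \<open>max 0 (1 - real n * infdist x F)\<close>, which take values in the unit interval.\<close>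

lemma measure_eqI_lipschitz:
  fixes \<mu> \<nu> :: "'a::euclidean_space measure"
  assumes "prob_space \<mu>" "prob_space \<nu>" "sets \<mu> = sets borel" "sets \<nu> = sets borel"
    and eq: "\<And>h :: 'a \<Rightarrow> real. \<lbrakk>\<And>x. 0 \<le> h x; \<And>x. h x \<le> 1; \<exists>L. L-lipschitz_on UNIV h\<rbrakk>
      \<Longrightarrow> (\<integral>x. h x \<partial>\<mu>) = (\<integral>x. h x \<partial>\<nu>)"
  shows "\<mu> = \<nu>"
proof (rule measure_eqI_generator_eq[where E = "Collect closed" and \<Omega> = UNIV and A = "\<lambda>_. UNIV"])
  interpret M: prob_space \<mu> by fact
  interpret N: prob_space \<nu> by fact
  show "Int_stable (Collect closed)" by (auto simp: Int_stable_def)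
  show "sets \<mu> = sigma_sets UNIV (Collect closed)" "sets \<nu> = sigma_sets UNIV (Collect closed)"
    using assms(3,4) by (simp_all add: borel_eq_closed)
  fix F :: "'a set" assume "F \<in> Collect closed"
  then have F: "closed F" by simp
  show "emeasure \<mu> F = emeasure \<nu> F"
  \<comment> \<open>By convention \<open>infdist x {}\<close> is zero, so for the empty set the
    approximating functions would be constantly one.\<close>
  proof (cases "F = {}")
    case False
    define h where "h n x = max 0 (1 - real n * infdist x F)" for n x
    have hc: "continuous_on UNIV (h n)" for n
      unfolding h_def by (intro continuous_intros)
    have hm: "h n \<in> borel_measurable borel" for n
      using hc by (rule borel_measurable_continuous_onI)
    have h01: "0 \<le> h n x" "h n x \<le> 1" for n x
      by (simp_all add: h_def infdist_nonneg)
    have "(real n)-lipschitz_on UNIV (h n)" for n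
    proof (rule lipschitz_onI)
      fix x y
      have "\<bar>h n x - h n y\<bar> \<le> \<bar>real n * infdist x F - real n * infdist y F\<bar>"
        unfolding h_def by linarith
      also have "\<dots> = real n * \<bar>infdist x F - infdist y F\<bar>"
        by (simp flip: right_diff_distrib add: abs_mult)
      also have "\<dots> \<le> real n * dist x y"
        by (intro mult_left_mono infdist_triangle_abs) simp
      finally show "dist (h n x) (h n y) \<le> real n * dist x y" by (simp add: dist_real_def)
    qed simp
    then have hi: "(\<integral>x. h n x \<partial>\<mu>) = (\<integral>x. h n x \<partial>\<nu>)" for n
      using h01 by (intro eq) auto
    have lim: "(\<lambda>n. h n x) \<longlonglongrightarrow> indicat_real F x" for x
    proof (cases "x \<in> F")
      case True
      then show ?thesis by (simp add: h_def)
    next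
      case notF: False
      have pos: "0 < infdist x F" using infdist_pos_not_in_closed[OF F False notF] .
      obtain N :: nat where N: "1 / infdist x F < real N" using reals_Archimedean2 by blast
      have "h n x = 0" if "N \<le> n" for n
      proof -
        have "1 / infdist x F < real n" using N that by linarith
        then show ?thesis using pos by (simp add: h_def field_simps)
      qed
      then show ?thesis using notF by (intro tendsto_eventually) (auto simp: eventually_sequentially)
    qed
    have "(\<lambda>n. \<integral>x. h n x \<partial>\<mu>) \<longlonglongrightarrow> (\<integral>x. indicat_real F x \<partial>\<mu>)"
      by (rule integral_dominated_convergence[where w = "\<lambda>_. 1"])
        (use lim h01 hm F assms(3) in \<open>auto cong: measurable_cong_sets\<close>)
    moreover have "(\<lambda>n. \<integral>x. h n x \<partial>\<nu>) \<longlonglongrightarrow> (\<integral>x. indicat_real F x \<partial>\<nu>)"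
      by (rule integral_dominated_convergence[where w = "\<lambda>_. 1"])
        (use lim h01 hm F assms(4) in \<open>auto cong: measurable_cong_sets\<close>)
    ultimately have "(\<integral>x. indicat_real F x \<partial>\<mu>) = (\<integral>x. indicat_real F x \<partial>\<nu>)"
      unfolding hi using LIMSEQ_unique by blast
    then show ?thesis
      using F assms(3,4) by (simp add: M.emeasure_eq_measure N.emeasure_eq_measure sets_eq_imp_space_eq[of _ borel])
  qed simp
qed (use assms(1) in \<open>auto simp: prob_space.emeasure_space_1 finite_measure.emeasure_finite prob_space.finite_measure\<close>)

text \<open>Separation is the axiom that takes an argument: at distance zero all Lipschitz functions
  have equal integrals, and these determine the measure.\<close>

lemma Metric_space_wasserstein1:
  assumes "compact K"
  shows "Metric_space (prob_on K) wasserstein1"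
proof
  fix \<mu> \<nu> :: "'a measure" assume mn: "\<mu> \<in> prob_on K" "\<nu> \<in> prob_on K"
  show "wasserstein1 \<mu> \<nu> = 0 \<longleftrightarrow> \<mu> = \<nu>"
  proof
    assume 0: "wasserstein1 \<mu> \<nu> = 0"
    show "\<mu> = \<nu>"
    proof (rule measure_eqI_lipschitz)
      fix h :: "'a \<Rightarrow> real" assume "\<exists>L. L-lipschitz_on UNIV h"
      then obtain L where L: "L-lipschitz_on UNIV h" by blast
      then have "h \<in> borel_measurable borel"
        using lipschitz_on_continuous_on borel_measurable_continuous_onI by blast
      then show "(\<integral>x. h x \<partial>\<mu>) = (\<integral>x. h x \<partial>\<nu>)"
        using wasserstein1_lipschitz[OF assms mn _ lipschitz_on_subset[OF L]] 0 by auto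
    qed (use mn[THEN prob_onD(1)] mn[THEN prob_onD(2)] in auto)
  qed (use wasserstein1_self[OF assms] mn in simp)
qed (use wasserstein1_nonneg wasserstein1_commute wasserstein1_triangle[OF assms] in auto)

section \<open>Smoothness of the attention head\<close>

abbreviation jointly_continuous :: "('p::topological_space \<Rightarrow> 'a::topological_space \<Rightarrow> 'b::topological_space) \<Rightarrow> bool" where
  "jointly_continuous f \<equiv> continuous_on UNIV (\<lambda>(p, x). f p x)"

text \<open>
  Smoothness in the second argument, jointly continuous in both. Derivatives are kept as families of
  components along \<open>Basis\<close>, so that differentiating does not change the type of the values.
\<close>

fun Cn_param :: "nat \<Rightarrow> ('p::topological_space \<Rightarrow> 'a::euclidean_space \<Rightarrow> 'b::real_normed_vector) \<Rightarrow> bool" where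
  "Cn_param 0 f \<longleftrightarrow> jointly_continuous f"
| "Cn_param (Suc n) f \<longleftrightarrow> jointly_continuous f \<and>
     (\<exists>D. (\<forall>b\<in>Basis. Cn_param n (D b)) \<and>
       (\<forall>p x. (f p has_derivative (\<lambda>h. \<Sum>b\<in>Basis. (h \<bullet> b) *\<^sub>R D b p x)) (at x)))"

lemma Cn_param_continuous: "Cn_param n f \<Longrightarrow> jointly_continuous f"
  by (cases n) auto

lemma Cn_param_SucI:
  assumes "jointly_continuous f" "\<And>b. b \<in> Basis \<Longrightarrow> Cn_param n (D b)"
    "\<And>p x. (f p has_derivative (\<lambda>h. \<Sum>b\<in>Basis. (h \<bullet> b) *\<^sub>R D b p x)) (at x)"
  shows "Cn_param (Suc n) f"
  using assms by auto

lemma Cn_param_SucE: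
  assumes "Cn_param (Suc n) f"
  obtains D where "\<And>b. b \<in> Basis \<Longrightarrow> Cn_param n (D b)"
    "\<And>p x. (f p has_derivative (\<lambda>h. \<Sum>b\<in>Basis. (h \<bullet> b) *\<^sub>R D b p x)) (at x)"
  using assms by auto

lemma Cn_param_Suc_imp: "Cn_param (Suc n) f \<Longrightarrow> Cn_param n f"
proof (induction n arbitrary: f)
  case (Suc n)
  obtain D where D: "\<And>b. b \<in> Basis \<Longrightarrow> Cn_param (Suc n) (D b)"
    "\<And>p x. (f p has_derivative (\<lambda>h. \<Sum>b\<in>Basis. (h \<bullet> b) *\<^sub>R D b p x)) (at x)"
    using Suc.prems by (rule Cn_param_SucE) (rule that)
  show ?case
    by (rule Cn_param_SucI[OF Cn_param_continuous[OF Suc.prems] Suc.IH[OF D(1)] D(2)])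
qed simp

lemma continuous_on_pair_fst:
  "continuous_on UNIV g \<Longrightarrow> continuous_on UNIV (\<lambda>(p, x). g p)"
  unfolding case_prod_beta by (rule continuous_on_compose2[of UNIV g]) (auto intro: continuous_intros)

lemma continuous_on_pair_snd:
  "continuous_on UNIV g \<Longrightarrow> continuous_on UNIV (\<lambda>(p, x). g x)"
  unfolding case_prod_beta by (rule continuous_on_compose2[of UNIV g]) (auto intro: continuous_intros)

lemma Cn_param_const_snd:
  assumes "continuous_on UNIV g"
  shows "Cn_param n (\<lambda>p x. g p)"
  using assms
proof (induction n arbitrary: g)
  case (Suc n)
  show ?case
    by (rule Cn_param_SucI[where D = "\<lambda>b p x. 0"])
      (use Suc.IH[of "\<lambda>_. 0"] Suc.prems in \<open>auto intro: continuous_on_pair_fst\<close>)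
qed (simp add: continuous_on_pair_fst)

lemma Cn_param_linear:
  assumes "bounded_linear g"
  shows "Cn_param n (\<lambda>p x. g x)"
proof -
  interpret bounded_linear g by fact
  have c: "continuous_on UNIV (\<lambda>(p, x). g x)"
    by (intro continuous_on_pair_snd linear_continuous_on assms)
  show ?thesis
  proof (cases n)
    case (Suc m)
    have "(\<Sum>b\<in>Basis. (h \<bullet> b) *\<^sub>R g b) = g (\<Sum>b\<in>Basis. (h \<bullet> b) *\<^sub>R b)" for h
      by (simp only: sum scaleR)
    then have "(\<lambda>h. \<Sum>b\<in>Basis. (h \<bullet> b) *\<^sub>R g b) = g"
      by (simp add: euclidean_representation)
    then have "(g has_derivative (\<lambda>h. \<Sum>b\<in>Basis. (h \<bullet> b) *\<^sub>R g b)) (at x)" for x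
      using bounded_linear_imp_has_derivative[OF assms, of "at x"] by simp
    then show ?thesis unfolding Suc
      by (intro Cn_param_SucI[where D = "\<lambda>b p x. g b"] c Cn_param_const_snd) auto
  qed (use c in simp)
qed

section \<open>Closure of smooth families under algebraic operations\<close>

lemma Cn_param_add:
  assumes "Cn_param n f" "Cn_param n g"
  shows "Cn_param n (\<lambda>p x. f p x + g p x)"
  using assms
proof (induction n arbitrary: f g)
  case 0
  then show ?case by (auto simp: case_prod_beta intro: continuous_intros)
next
  case (Suc n)
  obtain D where D: "\<And>b. b \<in> Basis \<Longrightarrow> Cn_param n (D b)"
    "\<And>p x. (f p has_derivative (\<lambda>h. \<Sum>b\<in>Basis. (h \<bullet> b) *\<^sub>R D b p x)) (at x)"
    using Suc.prems(1) by (rule Cn_param_SucE) (rule that)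
  obtain E where E: "\<And>b. b \<in> Basis \<Longrightarrow> Cn_param n (E b)"
    "\<And>p x. (g p has_derivative (\<lambda>h. \<Sum>b\<in>Basis. (h \<bullet> b) *\<^sub>R E b p x)) (at x)"
    using Suc.prems(2) by (rule Cn_param_SucE) (rule that)
  show ?case
  proof (rule Cn_param_SucI[where D = "\<lambda>b p x. D b p x + E b p x"])
    show "continuous_on UNIV (\<lambda>(p, x). f p x + g p x)"
      using Suc.prems[THEN Cn_param_continuous] by (auto simp: case_prod_beta intro: continuous_intros)
    show "((\<lambda>x. f p x + g p x) has_derivative (\<lambda>h. \<Sum>b\<in>Basis. (h \<bullet> b) *\<^sub>R (D b p x + E b p x))) (at x)" for p x
      using has_derivative_add[OF D(2) E(2)] by (simp add: scaleR_add_right sum.distrib)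
  qed (use D E Suc.IH in auto)
qed

lemma Cn_param_sum:
  assumes "\<And>i. i \<in> I \<Longrightarrow> Cn_param n (f i)"
  shows "Cn_param n (\<lambda>p x. \<Sum>i\<in>I. f i p x)"
  using assms
proof (induction I rule: infinite_finite_induct)
  case (insert i I)
  then show ?case using Cn_param_add[of n "f i"] by simp
qed (use Cn_param_const_snd[of "\<lambda>_. 0"] in auto)

text \<open>By the Leibniz rule each derivative component is a sum of products of a factor with a
  derivative component of the other. All these have order \<open>n\<close>, so the induction
  hypothesis applies to them.\<close>

lemma Cn_param_scaleR:
  assumes "Cn_param n f" "Cn_param n g"
  shows "Cn_param n (\<lambda>p x. f p x *\<^sub>R g p x)"
  using assms
proof (induction n arbitrary: f g)
  case 0
  then show ?case by (auto simp: case_prod_beta intro: continuous_intros)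
next
  case (Suc n)
  obtain D where D: "\<And>b. b \<in> Basis \<Longrightarrow> Cn_param n (D b)"
    "\<And>p x. (f p has_derivative (\<lambda>h. \<Sum>b\<in>Basis. (h \<bullet> b) *\<^sub>R D b p x)) (at x)"
    using Suc.prems(1) by (rule Cn_param_SucE) (rule that)
  obtain E where E: "\<And>b. b \<in> Basis \<Longrightarrow> Cn_param n (E b)"
    "\<And>p x. (g p has_derivative (\<lambda>h. \<Sum>b\<in>Basis. (h \<bullet> b) *\<^sub>R E b p x)) (at x)"
    using Suc.prems(2) by (rule Cn_param_SucE) (rule that)
  show ?case
  proof (rule Cn_param_SucI[where D = "\<lambda>b p x. f p x *\<^sub>R E b p x + D b p x *\<^sub>R g p x"])
    show "continuous_on UNIV (\<lambda>(p, x). f p x *\<^sub>R g p x)"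
      using Suc.prems[THEN Cn_param_continuous] by (auto simp: case_prod_beta intro: continuous_intros)
    show "((\<lambda>x. f p x *\<^sub>R g p x) has_derivative
        (\<lambda>h. \<Sum>b\<in>Basis. (h \<bullet> b) *\<^sub>R (f p x *\<^sub>R E b p x + D b p x *\<^sub>R g p x))) (at x)" for p x
      using has_derivative_scaleR[OF D(2) E(2)]
      by (simp add: scaleR_add_right sum.distrib scaleR_sum_right scaleR_sum_left mult.commute)
    show "Cn_param n (\<lambda>p x. f p x *\<^sub>R E b p x + D b p x *\<^sub>R g p x)" if "b \<in> Basis" for b
      using D(1)[OF that] E(1)[OF that] Suc.prems[THEN Cn_param_Suc_imp] Suc.IH
      by (intro Cn_param_add) auto
  qed
qed

lemma Cn_param_mult:
  fixes f g :: "'p::topological_space \<Rightarrow> 'a::euclidean_space \<Rightarrow> real"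
  assumes "Cn_param n f" "Cn_param n g"
  shows "Cn_param n (\<lambda>p x. f p x * g p x)"
  using Cn_param_scaleR[OF assms] by simp

text \<open>The derivative components are the exponential itself times those of \<open>f\<close>.
  The induction hypothesis covers the exponential at one order lower, and products are already
  treated.\<close>

lemma Cn_param_exp:
  fixes f :: "'p::topological_space \<Rightarrow> 'a::euclidean_space \<Rightarrow> real"
  assumes "Cn_param n f"
  shows "Cn_param n (\<lambda>p x. exp (f p x))"
  using assms
proof (induction n arbitrary: f)
  case 0
  then show ?case by (auto simp: case_prod_beta intro: continuous_intros)
next
  case (Suc n)
  obtain D where D: "\<And>b. b \<in> Basis \<Longrightarrow> Cn_param n (D b)"
    "\<And>p x. (f p has_derivative (\<lambda>h. \<Sum>b\<in>Basis. (h \<bullet> b) *\<^sub>R D b p x)) (at x)"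
    using Suc.prems by (rule Cn_param_SucE) (rule that)
  show ?case
  proof (rule Cn_param_SucI[where D = "\<lambda>b p x. exp (f p x) * D b p x"])
    show "continuous_on UNIV (\<lambda>(p, x). exp (f p x))"
      using Suc.prems[THEN Cn_param_continuous] by (auto simp: case_prod_beta intro: continuous_intros)
    show "((\<lambda>x. exp (f p x)) has_derivative
        (\<lambda>h. \<Sum>b\<in>Basis. (h \<bullet> b) *\<^sub>R (exp (f p x) * D b p x))) (at x)" for p x
      using has_derivative_exp[OF D(2)[of p x]] by (simp add: sum_distrib_left mult_ac)
  qed (use D Suc.IH[OF Suc.prems[THEN Cn_param_Suc_imp]] in \<open>auto intro: Cn_param_mult\<close>)
qed

text \<open>As for the exponential, the derivative is a product containing the inverse itself, to
  which the induction hypothesis applies at one order lower.\<close>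

lemma Cn_param_inverse:
  fixes f :: "'p::topological_space \<Rightarrow> 'a::euclidean_space \<Rightarrow> real"
  assumes "Cn_param n f" "\<And>p x. f p x \<noteq> 0"
  shows "Cn_param n (\<lambda>p x. inverse (f p x))"
  using assms
proof (induction n arbitrary: f)
  case 0
  then show ?case by (auto simp: case_prod_beta intro: continuous_intros)
next
  case (Suc n)
  obtain D where D: "\<And>b. b \<in> Basis \<Longrightarrow> Cn_param n (D b)"
    "\<And>p x. (f p has_derivative (\<lambda>h. \<Sum>b\<in>Basis. (h \<bullet> b) *\<^sub>R D b p x)) (at x)"
    using Suc.prems(1) by (rule Cn_param_SucE) (rule that)
  have inv: "Cn_param n (\<lambda>p x. inverse (f p x))"
    using Suc.IH[OF Suc.prems(1)[THEN Cn_param_Suc_imp] Suc.prems(2)] .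
  show ?case
  proof (rule Cn_param_SucI[where D = "\<lambda>b p x. (- 1) * (inverse (f p x) * (inverse (f p x) * D b p x))"])
    show "continuous_on UNIV (\<lambda>(p, x). inverse (f p x))"
      using Cn_param_continuous[OF Suc.prems(1)] Suc.prems(2) by (auto simp: case_prod_beta intro: continuous_intros)
    show "((\<lambda>x. inverse (f p x)) has_derivative
        (\<lambda>h. \<Sum>b\<in>Basis. (h \<bullet> b) *\<^sub>R ((- 1) * (inverse (f p x) * (inverse (f p x) * D b p x))))) (at x)" for p x
      using Deriv.has_derivative_inverse[OF Suc.prems(2)[of p x] D(2)[of p x]]
      by (simp add: sum_distrib_left sum_negf mult_ac)
  qed (intro Cn_param_mult inv D Cn_param_const_snd continuous_intros)
qed

text \<open>A vector is the sum of the axis embeddings of its entries, and composition with a fixed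
  linear map commutes with differentiation.\<close>

lemma Cn_param_vec:
  fixes f :: "'i::finite \<Rightarrow> 'p::topological_space \<Rightarrow> 'a::euclidean_space \<Rightarrow> 'b::euclidean_space"
  assumes "\<And>i. Cn_param n (f i)"
  shows "Cn_param n (\<lambda>p x. \<chi> i. f i p x)"
proof -
  have *: "bounded_linear (\<lambda>y::'b. axis i y :: 'b ^ 'i)" for i
    by (intro linear_conv_bounded_linear[THEN iffD1] linearI) (simp_all add: vec_eq_iff axis_def)
  have lin: "Cn_param n (\<lambda>p x. L (f p x))" if "Cn_param n f" "bounded_linear L"
    for L :: "'b \<Rightarrow> 'b ^ 'i" and f :: "'p \<Rightarrow> 'a \<Rightarrow> 'b" and n
    using that(1)
  proof (induction n arbitrary: f)
    case 0
    then show ?case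
      by (auto simp: case_prod_beta intro!: bounded_linear.continuous_on[OF that(2)])
  next
    case (Suc n)
    interpret L: bounded_linear L by (rule that(2))
    obtain D where D: "\<And>b. b \<in> Basis \<Longrightarrow> Cn_param n (D b)"
      "\<And>p x. (f p has_derivative (\<lambda>h. \<Sum>b\<in>Basis. (h \<bullet> b) *\<^sub>R D b p x)) (at x)"
      using Suc.prems(1) by (rule Cn_param_SucE) (rule that)
    show ?case
    proof (rule Cn_param_SucI[where D = "\<lambda>b p x. L (D b p x)"])
      show "continuous_on UNIV (\<lambda>(p, x). L (f p x))"
        using Cn_param_continuous[OF Suc.prems(1)]
        by (auto simp: case_prod_beta intro!: bounded_linear.continuous_on[OF that(2)])
      show "((\<lambda>x. L (f p x)) has_derivative (\<lambda>h. \<Sum>b\<in>Basis. (h \<bullet> b) *\<^sub>R L (D b p x))) (at x)" for p x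
        using bounded_linear.has_derivative[OF that(2) D(2)] by (simp add: L.sum L.scaleR)
    qed (use D Suc.IH in auto)
  qed
  have "Cn_param n (\<lambda>p x. \<Sum>i\<in>UNIV. axis i (f i p x))"
    using assms lin[OF _ *] by (intro Cn_param_sum) auto
  moreover have "(\<Sum>i\<in>UNIV. axis i (f i p x)) = (\<chi> i. f i p x)" for p x
    by (simp add: vec_eq_iff axis_def)
  ultimately show ?thesis by simp
qed

text \<open>Each entry is built from coordinates of input and parameters by sums, products,
  exponentials and inverses of positive sums. All positions are packed into one vector, so that the
  loss later becomes a function of a single argument.\<close>

lemma Cn_param_head_output:
  fixes Wout :: "real ^ 'v ^ 'x"
  shows "Cn_param n (\<lambda>(X :: ('l::{finite,linorder}, 'x) tokens) (\<omega> :: ('x, 'k::finite) head).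
    \<chi> l. head_output Wout l X \<omega>)"
proof -
  have X: "Cn_param n (\<lambda>(X :: ('l, 'x) tokens) (\<omega> :: ('x, 'k) head). X $ r $ i)" for r i
    by (intro Cn_param_const_snd continuous_intros)
  have c: "Cn_param n (\<lambda>(X :: ('l, 'x) tokens) (\<omega> :: ('x, 'k) head). c)" for c :: real
    by (intro Cn_param_const_snd continuous_intros)
  have W: "Cn_param n (\<lambda>(X :: ('l, 'x) tokens) (\<omega> :: ('x, 'k) head). fst \<omega> $ i $ j)"
    "Cn_param n (\<lambda>(X :: ('l, 'x) tokens) (\<omega> :: ('x, 'k) head). fst (snd \<omega>) $ i $ j)"
    "Cn_param n (\<lambda>(X :: ('l, 'x) tokens) (\<omega> :: ('x, 'k) head). fst (snd (snd \<omega>)) $ i $ j)"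
    "Cn_param n (\<lambda>(X :: ('l, 'x) tokens) (\<omega> :: ('x, 'k) head). snd (snd (snd \<omega>)) $ j $ i)" for i j
    by (intro Cn_param_linear bounded_linear_compose[OF bounded_linear_vec_nth]
      bounded_linear_compose[OF bounded_linear_fst] bounded_linear_compose[OF bounded_linear_snd]
      bounded_linear_fst bounded_linear_snd)+
  define e :: "'l \<Rightarrow> 'l \<Rightarrow> ('l, 'x) tokens \<Rightarrow> ('x, 'k) head \<Rightarrow> real" where
    "e r s X \<omega> = exp ((X ** fst \<omega> ** transpose (fst (snd \<omega>)) ** transpose X) $ r $ s * inverse (sqrt (real CARD('k))))"
    for r s X \<omega>
  have e: "Cn_param n (e r s)" for r s
    unfolding e_def matrix_matrix_mult_def transpose_def
    by (simp, intro Cn_param_exp Cn_param_mult Cn_param_sum X W c)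
  \<comment> \<open>The causal mask keeps the diagonal, so the normalising sum always contains the
    term \<open>s' = r\<close>.\<close>
  have "0 < (\<Sum>s' | s' \<le> r. e r s' X \<omega>)" for r X \<omega>
    by (rule sum_pos) (auto simp: e_def)
  then have pos: "(\<Sum>s' | s' \<le> r. e r s' X \<omega>) \<noteq> 0" for r X \<omega>
    by (metis less_irrefl)
  have att: "attention \<omega> X $ r $ s = (if s \<le> r then e r s X \<omega> * inverse (\<Sum>s' | s' \<le> r. e r s' X \<omega>) else 0)"
    for r s X \<omega>
    by (simp add: attention_def e_def Let_def case_prod_beta divide_inverse)
  have "Cn_param n (\<lambda>X \<omega>. e r s X \<omega> * inverse (\<Sum>s' | s' \<le> r. e r s' X \<omega>))" for r s
    by (intro Cn_param_mult Cn_param_inverse Cn_param_sum e pos)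
  then have A: "Cn_param n (\<lambda>(X :: ('l, 'x) tokens) (\<omega> :: ('x, 'k) head). attention \<omega> X $ r $ s)" for r s
    unfolding att using c[of 0] by (cases "s \<le> r") simp_all
  have "Cn_param n (\<lambda>(X :: ('l, 'x) tokens) (\<omega> :: ('x, 'k) head). head_output Wout l X \<omega> $ j)" for l j
    unfolding head_output_def case_prod_beta matrix_matrix_mult_def
    by (simp, intro Cn_param_mult Cn_param_sum X W A c)
  then have "Cn_param n (\<lambda>(X :: ('l, 'x) tokens) (\<omega> :: ('x, 'k) head). \<chi> l. \<chi> j. head_output Wout l X \<omega> $ j)"
    by (intro Cn_param_vec)
  then show ?thesis by simp
qed

section \<open>Integrals against bounded weights\<close>

lemma gradientI:
  assumes "(f has_derivative (\<lambda>h. h \<bullet> v)) (at x)"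
  shows "gradient f x = v"
proof -
  have g: "GDERIV f x :> v" unfolding gderiv_def using assms by (simp add: inner_commute)
  show ?thesis unfolding gradient_def
  proof (rule the_equality[where P = "\<lambda>D. GDERIV f x :> D", OF g])
    fix w assume "GDERIV f x :> w"
    then have "(\<lambda>h. h \<bullet> w) = (\<lambda>h. h \<bullet> v)"
      using assms unfolding gderiv_def by (rule has_derivative_unique)
    \<comment> \<open>Both representations of the derivative are evaluated at the difference of the
      two candidates.\<close>
    then have "(w - v) \<bullet> w = (w - v) \<bullet> v" by metis
    then have "(w - v) \<bullet> (w - v) = 0" by (simp add: inner_diff_right)
    then show "w = v" by simp
  qed
qed

lemma gradient_basisI:
  fixes f :: "'a::euclidean_space \<Rightarrow> real"
  assumes "(f has_derivative (\<lambda>h. \<Sum>b\<in>Basis. (h \<bullet> b) * D b)) (at x)"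
  shows "gradient f x = (\<Sum>b\<in>Basis. D b *\<^sub>R b)"
  by (rule gradientI) (use assms in \<open>simp add: inner_sum_right mult.commute\<close>)

text \<open>In coordinates \<open>fderiv f x\<close> is a finite combination of fixed functionals
  with the coefficients \<open>D b x\<close>, so continuity in operator norm follows from continuity
  of the components.\<close>

lemma C1_onI:
  fixes f :: "'a::euclidean_space \<Rightarrow> real"
  assumes "\<And>x. (f has_derivative (\<lambda>h. \<Sum>b\<in>Basis. (h \<bullet> b) * D b x)) (at x)"
    and "\<And>b. b \<in> Basis \<Longrightarrow> continuous_on UNIV (D b)"
  shows "C1_on UNIV f"
proof -
  have "fderiv f x = (\<Sum>b\<in>Basis. D b x *\<^sub>R blinfun_inner_left b)" for x
  proof -
    have "frechet_derivative f (at x) = (\<lambda>h. \<Sum>b\<in>Basis. (h \<bullet> b) * D b x)"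
      using frechet_derivative_at[OF assms(1)] by simp
    also have "\<dots> = blinfun_apply (\<Sum>b\<in>Basis. D b x *\<^sub>R blinfun_inner_left b)"
      by (auto simp: blinfun.sum_left blinfun.scaleR_left mult.commute inner_commute)
    finally show ?thesis by (simp add: fderiv_def blinfun_apply_inverse)
  qed
  then have "continuous_on UNIV (fderiv f)"
    using assms(2) by (auto intro!: continuous_intros)
  then show ?thesis
    unfolding C1_on_def using assms(1) differentiableI by blast
qed

text \<open>Riesz representation in coordinates: the gradient collects the values of the derivative
  on \<open>Basis\<close> and therefore depends linearly and continuously on
  \<open>fderiv f x\<close>.\<close>

lemma C1_on_gradient:
  fixes f :: "'a::euclidean_space \<Rightarrow> real"
  assumes "C1_on UNIV f"
  shows "(f has_derivative (\<lambda>h. h \<bullet> gradient f x)) (at x)" "continuous_on UNIV (gradient f)"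
proof -
  have d: "(f has_derivative frechet_derivative f (at x)) (at x)" for x
    using assms frechet_derivative_works unfolding C1_on_def by blast
  define v where "v x = (\<Sum>b\<in>Basis. frechet_derivative f (at x) b *\<^sub>R b)" for x
  have "(f has_derivative (\<lambda>h. h \<bullet> v x)) (at x)" for x
  proof -
    interpret bounded_linear "frechet_derivative f (at x)"
      using d has_derivative_bounded_linear by blast
    have "frechet_derivative f (at x) h = h \<bullet> v x" for h
    proof -
      have "frechet_derivative f (at x) (\<Sum>b\<in>Basis. (h \<bullet> b) *\<^sub>R b) = h \<bullet> v x"
        unfolding sum v_def by (simp add: scaleR inner_sum_right mult.commute)
      then show ?thesis by (simp add: euclidean_representation)
    qed
    then have "frechet_derivative f (at x) = (\<lambda>h. h \<bullet> v x)" by blast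
    then show ?thesis using d[of x] by simp
  qed
  note v = this
  have gv: "gradient f x = v x" for x using gradientI[OF v] .
  then show "(f has_derivative (\<lambda>h. h \<bullet> gradient f x)) (at x)" using v by simp
  have "frechet_derivative f (at x) h = fderiv f x h" for x h
    using d has_derivative_bounded_linear by (metis bounded_linear_Blinfun_apply fderiv_def)
  then have "gradient f = (\<lambda>x. \<Sum>b\<in>Basis. fderiv f x b *\<^sub>R b)"
    using gv by (auto simp: v_def)
  moreover have "continuous_on UNIV (fderiv f)" using assms by (simp add: C1_on_def)
  ultimately show "continuous_on UNIV (gradient f)"
    by (auto intro!: continuous_intros)
qed

lemma C1_on_continuous:
  assumes "C1_on UNIV f"
  shows "continuous_on UNIV f"
  using assms differentiable_imp_continuous_within continuous_at_imp_continuous_on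
  unfolding C1_on_def by blast

lemma continuous_on_param_bounded:
  fixes f :: "'p::metric_space \<Rightarrow> 'a::metric_space \<Rightarrow> 'b::real_normed_vector"
  assumes "jointly_continuous f" "compact C" "compact S"
  obtains B where "0 \<le> B" "\<And>p x. p \<in> C \<Longrightarrow> x \<in> S \<Longrightarrow> norm (f p x) \<le> B"
proof -
  have "compact ((\<lambda>(p, x). f p x) ` (C \<times> S))"
    using assms by (intro compact_continuous_image compact_Times) (auto intro: continuous_on_subset)
  then obtain B where "\<forall>y\<in>(\<lambda>(p, x). f p x) ` (C \<times> S). norm y \<le> B"
    using compact_imp_bounded bounded_iff by blast
  then have "\<And>p x. p \<in> C \<Longrightarrow> x \<in> S \<Longrightarrow> norm (f p x) \<le> max 0 B"
    by (force simp: le_max_iff_disj)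
  then show ?thesis using that[of "max 0 B"] by auto
qed

text \<open>Heine-Cantor on the compact set \<open>C \<times> cball x 1\<close> makes the modulus of
  continuity at \<open>x\<close> uniform in the parameter. Radius one merely selects a compact
  neighbourhood of \<open>x\<close>.\<close>

lemma continuous_on_param_uniform:
  fixes f :: "'p::metric_space \<Rightarrow> 'a::euclidean_space \<Rightarrow> 'b::real_normed_vector"
  assumes "jointly_continuous f" "compact C" "0 < e"
  obtains d where "0 < d" "\<And>p y. p \<in> C \<Longrightarrow> dist y x < d \<Longrightarrow> norm (f p y - f p x) < e"
proof -
  have "uniformly_continuous_on (C \<times> cball x 1) (\<lambda>(p, x). f p x)"
    using assms by (intro compact_uniformly_continuous compact_Times) (auto intro: continuous_on_subset)
  then obtain d where d: "0 < d" "\<And>q q'. q \<in> C \<times> cball x 1 \<Longrightarrow> q' \<in> C \<times> cball x 1 \<Longrightarrow>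
      dist q' q < d \<Longrightarrow> dist ((\<lambda>(p, x). f p x) q') ((\<lambda>(p, x). f p x) q) < e"
    using \<open>0 < e\<close> unfolding uniformly_continuous_on_def by metis
  show ?thesis
  proof
    show "0 < min d 1" using d by simp
    fix p y assume "p \<in> C" "dist y x < min d 1"
    then show "norm (f p y - f p x) < e"
      using d(2)[of "(p, x)" "(p, y)"] by (simp add: dist_Pair_Pair dist_norm norm_minus_commute)
  qed
qed

lemma norm_basis_sum_le:
  fixes D :: "'a::euclidean_space \<Rightarrow> 'b::real_normed_vector"
  shows "norm (\<Sum>b\<in>Basis. (h \<bullet> b) *\<^sub>R D b) \<le> norm h * (\<Sum>b\<in>Basis. norm (D b))"
proof -
  have "norm (\<Sum>b\<in>Basis. (h \<bullet> b) *\<^sub>R D b) \<le> (\<Sum>b\<in>Basis. norm h * norm (D b))"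
    by (rule sum_norm_le) (auto simp: Basis_le_norm mult_right_mono)
  then show ?thesis by (simp add: sum_distrib_left)
qed

locale input_law = prob_space P for P :: "'p::euclidean_space measure" +
  fixes C :: "'p set"
  assumes sets_P: "sets P = sets borel" and compact_C: "compact C" and AE_C: "AE X in P. X \<in> C"
begin

text \<open>All functions of the form \<open>weighted w f\<close> with \<open>w\<close> bounded inherit the smoothness of \<open>f\<close> with
  constants depending only on the bound for \<open>w\<close>.\<close>

definition weighted :: "('p \<Rightarrow> 'e::euclidean_space) \<Rightarrow> ('p \<Rightarrow> 'a::euclidean_space \<Rightarrow> 'e) \<Rightarrow> 'a \<Rightarrow> real" where
  "weighted w f x = (\<integral>X. w X \<bullet> f X x \<partial>P)"

definition weight :: "real \<Rightarrow> ('p \<Rightarrow> 'e::euclidean_space) \<Rightarrow> bool" where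
  "weight M w \<longleftrightarrow> w \<in> borel_measurable borel \<and> (\<forall>X\<in>C. norm (w X) \<le> M)"

lemma measurable_P: "f \<in> borel_measurable borel \<Longrightarrow> f \<in> borel_measurable P"
  using sets_P measurable_cong_sets by blast

lemma integrable_P:
  fixes f :: "'p \<Rightarrow> 'b::euclidean_space"
  assumes "f \<in> borel_measurable borel" "\<And>X. X \<in> C \<Longrightarrow> norm (f X) \<le> M"
  shows "integrable P f"
proof (rule integrable_const_bound[of _ M])
  show "AE X in P. norm (f X) \<le> M"
    using AE_C by eventually_elim (use assms(2) in auto)
qed (use assms(1) measurable_P in blast)

lemma norm_integral_P_le:
  fixes f :: "'p \<Rightarrow> 'b::euclidean_space"
  assumes "f \<in> borel_measurable borel" "\<And>X. X \<in> C \<Longrightarrow> norm (f X) \<le> M"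
  shows "norm (\<integral>X. f X \<partial>P) \<le> M"
proof -
  have "norm (\<integral>X. f X \<partial>P) \<le> (\<integral>X. norm (f X) \<partial>P)" by (rule integral_norm_bound)
  also have "\<dots> \<le> (\<integral>X. M \<partial>P)"
  proof (rule integral_mono_AE)
    show "AE X in P. norm (f X) \<le> M"
      using AE_C by eventually_elim (use assms(2) in auto)
  qed (use integrable_P[OF assms] in auto)
  finally show ?thesis by (simp add: prob_space)
qed

lemma continuous_on_param_measurable:
  fixes f :: "'p \<Rightarrow> 'a::euclidean_space \<Rightarrow> 'b::euclidean_space"
  assumes "jointly_continuous f"
  shows "(\<lambda>X. f X x) \<in> borel_measurable borel"
proof (rule borel_measurable_continuous_onI)
  show "continuous_on UNIV (\<lambda>X. f X x)"
    using continuous_on_compose2[OF assms, of UNIV "\<lambda>X. (X, x)"] by (simp add: continuous_on_Pair)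
qed

context
  fixes w :: "'p \<Rightarrow> 'e::euclidean_space" and M :: real
  assumes w: "weight M w"
begin

lemma weight_measurable: "w \<in> borel_measurable borel"
  using w by (simp add: weight_def)

lemma weight_bound: "X \<in> C \<Longrightarrow> norm (w X) \<le> M"
  using w by (simp add: weight_def)

text \<open>A set that carries a probability measure has a point, and there the norm bound forces
  \<open>M\<close> to be nonnegative.\<close>

lemma weight_nonneg: "0 \<le> M"
proof -
  have "C \<noteq> {}"
  proof
    assume "C = {}"
    then have "AE X in P. False" using AE_C by simp
    then show False by simp
  qed
  then show ?thesis using weight_bound norm_ge_zero by (meson all_not_in_conv order_trans)
qed

lemma weighted_integrable:
  fixes f :: "'p \<Rightarrow> 'a::euclidean_space \<Rightarrow> 'e"
  assumes f: "jointly_continuous f"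
  shows "integrable P (\<lambda>X. w X \<bullet> f X x)"
proof -
  obtain B where B: "0 \<le> B" "\<And>p y. p \<in> C \<Longrightarrow> y \<in> {x} \<Longrightarrow> norm (f p y) \<le> B"
    using continuous_on_param_bounded[OF f compact_C, of "{x}"] by (metis compact_sing)
  note weight_measurable[measurable] continuous_on_param_measurable[OF f, measurable]
  show ?thesis
  proof (rule integrable_P)
    fix X assume "X \<in> C"
    then show "norm (w X \<bullet> f X x) \<le> M * B"
      using Cauchy_Schwarz_ineq2[of "w X" "f X x"] mult_mono[OF weight_bound[of X] B(2)[of X x]] weight_nonneg
      by simp
  qed measurable
qed

lemma weighted_bound:
  fixes f :: "'p \<Rightarrow> 'a::euclidean_space \<Rightarrow> 'e"
  assumes f: "jointly_continuous f" and B: "\<And>X. X \<in> C \<Longrightarrow> norm (f X x) \<le> B"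
  shows "\<bar>weighted w f x\<bar> \<le> M * B"
proof -
  note weight_measurable[measurable] continuous_on_param_measurable[OF f, measurable]
  have "norm (weighted w f x) \<le> M * B"
    unfolding weighted_def
  proof (rule norm_integral_P_le)
    fix X assume "X \<in> C"
    then show "norm (w X \<bullet> f X x) \<le> M * B"
      using Cauchy_Schwarz_ineq2[of "w X" "f X x"] mult_mono[OF weight_bound[of X] B[of X]] weight_nonneg
      by simp
  qed measurable
  then show ?thesis by simp
qed

lemma weighted_continuous:
  fixes f :: "'p \<Rightarrow> 'a::euclidean_space \<Rightarrow> 'e"
  assumes f: "jointly_continuous f"
  shows "continuous_on UNIV (weighted w f)"
  unfolding continuous_on_iff
proof (intro ballI allI impI)
  fix x :: 'a and e :: real assume "0 < e"
  \<comment> \<open>The divisor is \<open>M + 1\<close> because \<open>M\<close> may be zero; it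
    also makes the final inequality strict.\<close>
  define e' where "e' = e / (M + 1)"
  have e': "0 < e'" using \<open>0 < e\<close> weight_nonneg by (simp add: e'_def)
  obtain d where d: "0 < d" "\<And>p y. p \<in> C \<Longrightarrow> dist y x < d \<Longrightarrow> norm (f p y - f p x) < e'"
    using continuous_on_param_uniform[OF f compact_C e'] by blast
  show "\<exists>d>0. \<forall>y\<in>UNIV. dist y x < d \<longrightarrow> dist (weighted w f y) (weighted w f x) < e"
  proof (intro exI[of _ d] conjI ballI impI d(1))
    fix y assume "dist y x < d"
    have "weighted w f y - weighted w f x = (\<integral>X. w X \<bullet> (f X y - f X x) \<partial>P)"
      using weighted_integrable[OF f] by (simp add: weighted_def inner_diff_right)
    also have "norm \<dots> \<le> M * e'"
    proof (rule norm_integral_P_le)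
      note weight_measurable[measurable] continuous_on_param_measurable[OF f, measurable]
      show "(\<lambda>X. w X \<bullet> (f X y - f X x)) \<in> borel_measurable borel" by measurable
      fix X assume X: "X \<in> C"
      show "norm (w X \<bullet> (f X y - f X x)) \<le> M * e'"
        using Cauchy_Schwarz_ineq2[of "w X" "f X y - f X x"] weight_nonneg
          mult_mono[OF weight_bound[OF X] less_imp_le[OF d(2)[OF X \<open>dist y x < d\<close>]]]
        by simp
    qed
    also have "M * e' < e"
      using \<open>0 < e\<close> weight_nonneg by (simp add: e'_def field_simps)
    finally show "dist (weighted w f y) (weighted w f x) < e" by (simp add: dist_norm)
  qed
qed

text \<open>Differentiation under the integral sign. The first-order remainder of \<open>f X\<close>
  is at most \<open>norm (y - x)\<close> times the oscillation of its partial derivatives near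
  \<open>x\<close>; by compactness of \<open>C\<close> this is small uniformly in \<open>X\<close>,
  and the weight is bounded.\<close>

lemma weighted_has_derivative:
  fixes f :: "'p \<Rightarrow> 'a::euclidean_space \<Rightarrow> 'e"
  assumes f: "jointly_continuous f"
    and D: "\<And>b. b \<in> Basis \<Longrightarrow> jointly_continuous (D b)"
    and der: "\<And>p x. (f p has_derivative (\<lambda>h. \<Sum>b\<in>Basis. (h \<bullet> b) *\<^sub>R D b p x)) (at x)"
  shows "(weighted w f has_derivative (\<lambda>h. \<Sum>b\<in>Basis. (h \<bullet> b) * weighted w (D b) x)) (at x)"
  unfolding has_derivative_within_alt
proof (intro conjI allI impI)
  show "bounded_linear (\<lambda>h. \<Sum>b\<in>Basis. (h \<bullet> b) * weighted w (D b) x)"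
    by (intro bounded_linear_sum bounded_linear_mult_const bounded_linear_inner_left)
  fix e :: real assume "0 < e"
  define N where "N = real DIM('a)"
  have N: "0 < N" by (simp add: N_def)
  \<comment> \<open>Each of the \<open>N\<close> partial derivatives may oscillate by
    \<open>e'\<close>, and the weight multiplies the total by at most \<open>M\<close>.\<close>
  define e' where "e' = e / ((M + 1) * N)"
  have e': "0 < e'" using \<open>0 < e\<close> weight_nonneg N by (simp add: e'_def)
  have "\<exists>d>0. \<forall>p y. p \<in> C \<longrightarrow> dist y x < d \<longrightarrow> norm (D b p y - D b p x) < e'" if "b \<in> Basis" for b
    using continuous_on_param_uniform[OF D[OF that] compact_C e'] by metis
  then obtain \<delta> where \<delta>: "\<And>b. b \<in> Basis \<Longrightarrow> 0 < \<delta> b"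
    "\<And>b p y. b \<in> Basis \<Longrightarrow> p \<in> C \<Longrightarrow> dist y x < \<delta> b \<Longrightarrow> norm (D b p y - D b p x) < e'" by metis
  define d where "d = Min (\<delta> ` Basis)"
  have d: "0 < d" using \<delta>(1) by (simp add: d_def)
  have dD: "norm (D b p y - D b p x) < e'" if "b \<in> Basis" "p \<in> C" "dist y x < d" for b p y
    using \<delta>(2)[of b p y] that by (simp add: d_def)
  \<comment> \<open>The mean value inequality for \<open>f X\<close> minus its linearisation at
    \<open>x\<close>, on a ball and hence on a convex set.\<close>
  have lin: "norm (f X y - f X x - (\<Sum>b\<in>Basis. ((y - x) \<bullet> b) *\<^sub>R D b X x)) \<le> norm (y - x) * (N * e')"
    if X: "X \<in> C" and y: "norm (y - x) < d" for X y
  proof (rule differentiable_bound_linearization[where S = "ball x d"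
        and f' = "\<lambda>z h. \<Sum>b\<in>Basis. (h \<bullet> b) *\<^sub>R D b X z"])
    show "x + t *\<^sub>R (y - x) \<in> ball x d" if "t \<in> {0..1}" for t
    proof -
      have "\<bar>t\<bar> * norm (y - x) \<le> norm (y - x)" using that by (intro mult_left_le_one_le) auto
      then show ?thesis using y by (simp add: dist_norm)
    qed
    show "(f X has_derivative (\<lambda>h. \<Sum>b\<in>Basis. (h \<bullet> b) *\<^sub>R D b X z)) (at z within ball x d)" for z
      using der has_derivative_at_withinI by blast
    show "onorm ((\<lambda>h. \<Sum>b\<in>Basis. (h \<bullet> b) *\<^sub>R D b X z) - (\<lambda>h. \<Sum>b\<in>Basis. (h \<bullet> b) *\<^sub>R D b X x)) \<le> N * e'"
      if "z \<in> ball x d" for z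
    proof (rule onorm_le)
      fix h
      have "norm (\<Sum>b\<in>Basis. (h \<bullet> b) *\<^sub>R (D b X z - D b X x)) \<le> norm h * (\<Sum>b\<in>Basis. norm (D b X z - D b X x))"
        by (rule norm_basis_sum_le)
      also have "\<dots> \<le> norm h * (\<Sum>b\<in>(Basis :: 'a set). e')"
        using that dD[OF _ X, of _ z]
        by (intro mult_left_mono sum_mono less_imp_le norm_ge_zero) (auto simp: dist_commute)
      also have "\<dots> = N * e' * norm h" by (simp add: N_def)
      finally show "norm (((\<lambda>h. \<Sum>b\<in>Basis. (h \<bullet> b) *\<^sub>R D b X z) - (\<lambda>h. \<Sum>b\<in>Basis. (h \<bullet> b) *\<^sub>R D b X x)) h)
          \<le> N * e' * norm h"
        by (simp add: scaleR_diff_right sum_subtractf)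
    qed
  qed (use d in auto)
  show "\<exists>d>0. \<forall>y\<in>UNIV. norm (y - x) < d \<longrightarrow>
      norm (weighted w f y - weighted w f x - (\<Sum>b\<in>Basis. ((y - x) \<bullet> b) * weighted w (D b) x)) \<le> e * norm (y - x)"
  proof (intro exI[of _ d] conjI ballI impI d)
    fix y assume y: "norm (y - x) < d"
    have "weighted w f y - weighted w f x - (\<Sum>b\<in>Basis. ((y - x) \<bullet> b) * weighted w (D b) x)
        = (\<integral>X. w X \<bullet> (f X y - f X x - (\<Sum>b\<in>Basis. ((y - x) \<bullet> b) *\<^sub>R D b X x)) \<partial>P)"
      using weighted_integrable[OF f] weighted_integrable[OF D]
      by (simp add: weighted_def inner_diff_right inner_sum_right)
    also have "norm \<dots> \<le> M * (norm (y - x) * (N * e'))"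
    proof (rule norm_integral_P_le)
      note weight_measurable[measurable] continuous_on_param_measurable[OF f, measurable]
      have "(\<lambda>X. D b X x) \<in> borel_measurable borel" if "b \<in> Basis" for b
        using continuous_on_param_measurable[OF D[OF that]] .
      then have [measurable]: "(\<lambda>X. \<Sum>b\<in>Basis. ((y - x) \<bullet> b) *\<^sub>R D b X x) \<in> borel_measurable borel"
        by (intro borel_measurable_sum borel_measurable_scaleR) auto
      show "(\<lambda>X. w X \<bullet> (f X y - f X x - (\<Sum>b\<in>Basis. ((y - x) \<bullet> b) *\<^sub>R D b X x))) \<in> borel_measurable borel"
        by measurable
      fix X assume X: "X \<in> C"
      show "norm (w X \<bullet> (f X y - f X x - (\<Sum>b\<in>Basis. ((y - x) \<bullet> b) *\<^sub>R D b X x))) \<le> M * (norm (y - x) * (N * e'))"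
        unfolding real_norm_def
        by (rule order_trans[OF Cauchy_Schwarz_ineq2 mult_mono[OF weight_bound[OF X] lin[OF X y]]])
          (use weight_nonneg in auto)
    qed
    also have "\<dots> \<le> e * norm (y - x)"
    proof -
      have "M * (N * e') = M / (M + 1) * e" using N weight_nonneg by (simp add: e'_def)
      also have "\<dots> \<le> 1 * e" using weight_nonneg \<open>0 < e\<close> by (intro mult_right_mono) auto
      finally have "M * (N * e') \<le> e" by simp
      then show ?thesis using mult_left_mono[of "M * (N * e')" e "norm (y - x)"] by (simp add: mult_ac)
    qed
    finally show "norm (weighted w f y - weighted w f x - (\<Sum>b\<in>Basis. ((y - x) \<bullet> b) * weighted w (D b) x))
      \<le> e * norm (y - x)" by simp
  qed
qed

end

end

section \<open>The fundamental lemma of the calculus of variations\<close>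

text \<open>The classical flat function at zero, with a power of \<open>inverse t\<close> carried
  along because each differentiation produces such powers.\<close>

definition flat_exp :: "nat \<Rightarrow> real \<Rightarrow> real" where
  "flat_exp k t = (if 0 < t then inverse t ^ k * exp (- inverse t) else 0)"

lemma flat_exp_tendsto_0: "(flat_exp k \<longlongrightarrow> 0) (at_right 0)"
proof -
  have "((\<lambda>t. inverse t ^ k / exp (inverse t)) \<longlongrightarrow> 0) (at_right (0::real))"
    using filterlim_compose[OF tendsto_power_div_exp_0 filterlim_inverse_at_top_right] .
  moreover have "eventually (\<lambda>t. inverse t ^ k / exp (inverse t) = flat_exp k t) (at_right 0)"
    by (auto simp: eventually_at_filter flat_exp_def exp_minus divide_inverse)
  ultimately show ?thesis by (rule Lim_transform_eventually)
qed

text \<open>One formula for all \<open>t\<close>, the origin included: the derivative is again a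
  combination of flat functions, which yields smoothness of every order by iteration.\<close>

lemma flat_exp_has_derivative:
  "(flat_exp k has_real_derivative flat_exp (k + 2) t - real k * flat_exp (k + 1) t) (at t)"
proof (cases t "0 :: real" rule: linorder_cases)
  case less
  have "(flat_exp k has_real_derivative 0) (at t)"
  proof (rule has_field_derivative_transform_within_open[where S = "{..<0}"])
    show "((\<lambda>_. 0) has_real_derivative 0) (at t)" by simp
  qed (use less in \<open>auto simp: flat_exp_def\<close>)
  then show ?thesis using less by (simp add: flat_exp_def)
next
  case equal
  \<comment> \<open>The right difference quotient at the origin is the flat function of the next
    exponent, which tends to zero.\<close>
  have "((\<lambda>h. flat_exp k h / h) \<longlongrightarrow> 0) (at_right 0)"
  proof (rule Lim_transform_eventually[OF flat_exp_tendsto_0[of "Suc k"]])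
    show "eventually (\<lambda>h. flat_exp (Suc k) h = flat_exp k h / h) (at_right 0)"
      by (auto simp: eventually_at_filter flat_exp_def divide_inverse)
  qed
  moreover have "((\<lambda>h. flat_exp k h / h) \<longlongrightarrow> 0) (at_left 0)"
    by (rule tendsto_eventually) (auto simp: eventually_at_filter flat_exp_def)
  ultimately have "((\<lambda>h. flat_exp k h / h) \<longlongrightarrow> 0) (at 0)"
    by (rule filterlim_split_at[rotated])
  then show ?thesis using equal by (simp add: DERIV_def flat_exp_def)
next
  case greater
  have "((\<lambda>t. inverse t ^ k * exp (- inverse t)) has_real_derivative
      flat_exp (k + 2) t - real k * flat_exp (k + 1) t) (at t)"
  proof -
    have i: "(inverse has_real_derivative - (inverse t * inverse t)) (at t)"
      using DERIV_inverse[of t UNIV] greater by (simp add: power2_eq_square)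
    have "((\<lambda>t. inverse t ^ k) has_real_derivative real k * (inverse t ^ (k - 1) * - (inverse t * inverse t))) (at t)"
      using DERIV_power[OF i, of k] by (simp add: mult_ac)
    moreover have "((\<lambda>t. exp (- inverse t)) has_real_derivative exp (- inverse t) * (inverse t * inverse t)) (at t)"
      using DERIV_fun_exp[OF DERIV_minus[OF i]] by simp
    ultimately have "((\<lambda>t. inverse t ^ k * exp (- inverse t)) has_real_derivative
        real k * (inverse t ^ (k - 1) * - (inverse t * inverse t)) * exp (- inverse t)
        + exp (- inverse t) * (inverse t * inverse t) * inverse t ^ k) (at t)"
      by (rule DERIV_mult)
    moreover have "real k * (inverse t ^ (k - 1) * - (inverse t * inverse t)) * exp (- inverse t)
        + exp (- inverse t) * (inverse t * inverse t) * inverse t ^ k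
        = flat_exp (k + 2) t - real k * flat_exp (k + 1) t"
      using greater by (cases k) (simp_all add: flat_exp_def algebra_simps)
    ultimately show ?thesis by simp
  qed
  then show ?thesis
    by (rule has_field_derivative_transform_within_open[where S = "{0<..}"])
      (use greater in \<open>auto simp: flat_exp_def\<close>)
qed

text \<open>Closed under differentiation, hence consisting of smooth functions.\<close>

inductive_set flat_bumps :: "real \<Rightarrow> real \<Rightarrow> (real \<Rightarrow> real) set" for a c where
  base: "(\<lambda>t. C * (flat_exp k (t - a) * flat_exp m (c - t))) \<in> flat_bumps a c"
| add: "f \<in> flat_bumps a c \<Longrightarrow> g \<in> flat_bumps a c \<Longrightarrow> (\<lambda>t. f t + g t) \<in> flat_bumps a c"

lemma flat_bumps_derivative:
  assumes "f \<in> flat_bumps a c"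
  shows "\<exists>g\<in>flat_bumps a c. \<forall>t. (f has_real_derivative g t) (at t)"
  using assms
proof induction
  case (base C k m)
  let ?\<phi> = "\<lambda>C k m t. C * (flat_exp k (t - a) * flat_exp m (c - t))"
  let ?g = "\<lambda>t. (?\<phi> C (k + 2) m t + ?\<phi> (- C * real k) (k + 1) m t)
    + (?\<phi> (- C) k (m + 2) t + ?\<phi> (C * real m) k (m + 1) t)"
  have "?g \<in> flat_bumps a c" by (intro flat_bumps.intros)
  moreover have "(?\<phi> C k m has_real_derivative ?g t) (at t)" for t
  proof -
    have "((\<lambda>t. flat_exp k (t - a)) has_real_derivative
        (flat_exp (k + 2) (t - a) - real k * flat_exp (k + 1) (t - a)) * 1) (at t)"
      by (rule DERIV_chain2[OF flat_exp_has_derivative]) (auto intro!: derivative_eq_intros)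
    moreover have "((\<lambda>t. flat_exp m (c - t)) has_real_derivative
        (flat_exp (m + 2) (c - t) - real m * flat_exp (m + 1) (c - t)) * (- 1)) (at t)"
      by (rule DERIV_chain2[OF flat_exp_has_derivative]) (auto intro!: derivative_eq_intros)
    ultimately show ?thesis
      by (auto intro!: derivative_eq_intros simp: algebra_simps)
  qed
  ultimately show ?case by (intro bexI[of _ ?g]) auto
next
  case (add f g)
  then obtain f' g' where "f' \<in> flat_bumps a c" "g' \<in> flat_bumps a c"
    "\<forall>t. (f has_real_derivative f' t) (at t)" "\<forall>t. (g has_real_derivative g' t) (at t)" by blast
  then show ?case
    by (intro bexI[of _ "\<lambda>t. f' t + g' t"] allI DERIV_add flat_bumps.add) auto
qed

definition bump :: "real \<Rightarrow> real \<Rightarrow> real \<Rightarrow> real" where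
  "bump a c t = flat_exp 0 (t - a) * flat_exp 0 (c - t)"

lemma bump_props:
  "0 \<le> bump a c t" "a < t \<Longrightarrow> t < c \<Longrightarrow> 0 < bump a c t" "t \<notin> {a<..<c} \<Longrightarrow> bump a c t = 0"
  by (auto simp: bump_def flat_exp_def)

text \<open>Stated for a combination of two bumps because the derivative of the test function in the
  fundamental lemma is such a difference. The set \<open>S\<close> of sums of two flat families is
  closed under differentiation.\<close>

lemma bump_smooth: "(deriv ^^ n) (\<lambda>t. x * bump a c t - y * bump b d t) differentiable (at t)"
proof -
  define S where "S = {h. \<exists>f\<in>flat_bumps a c. \<exists>g\<in>flat_bumps b d. h = (\<lambda>t. f t + g t)}"
  have S: "\<exists>h'\<in>S. \<forall>t. (h has_real_derivative h' t) (at t)" if "h \<in> S" for h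
  proof -
    from that obtain f g where fg: "f \<in> flat_bumps a c" "g \<in> flat_bumps b d" "h = (\<lambda>t. f t + g t)"
      unfolding S_def by blast
    obtain f' g' where "f' \<in> flat_bumps a c" "\<forall>t. (f has_real_derivative f' t) (at t)"
      "g' \<in> flat_bumps b d" "\<forall>t. (g has_real_derivative g' t) (at t)"
      using fg flat_bumps_derivative by metis
    then show ?thesis unfolding fg(3)
      by (intro bexI[of _ "\<lambda>t. f' t + g' t"] allI DERIV_add) (auto simp: S_def)
  qed
  have "(\<lambda>t. x * bump a c t - y * bump b d t) \<in> S"
    unfolding S_def bump_def
    using flat_bumps.base[of x 0 a 0 c] flat_bumps.base[of "- y" 0 b 0 d]
    by (auto intro!: bexI)
  then have *: "(deriv ^^ n) (\<lambda>t. x * bump a c t - y * bump b d t) \<in> S" for n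
  proof (induction n)
    case (Suc n)
    then obtain h' where "h' \<in> S" "\<forall>t. ((deriv ^^ n) (\<lambda>t. x * bump a c t - y * bump b d t) has_real_derivative h' t) (at t)"
      using S by blast
    then have "deriv ((deriv ^^ n) (\<lambda>t. x * bump a c t - y * bump b d t)) = h'"
      using DERIV_imp_deriv by blast
    then show ?case using \<open>h' \<in> S\<close> by simp
  qed simp
  show ?thesis using S[OF *[of n]] real_differentiable_def by blast
qed

lemma bump_continuous: "continuous_on A (bump a c)"
proof -
  have "bump a c differentiable (at t)" for t
    using bump_smooth[of 0 1 a c 0 0 0 t] by simp
  then show ?thesis
    using differentiable_imp_continuous_on differentiable_on_subset
    unfolding differentiable_on_def by (meson continuous_at_imp_continuous_on differentiable_imp_continuous_within)
qed

lemma integral_bump_pos: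
  assumes "a < c"
  shows "0 < integral {a..c} (bump a c)"
proof -
  have "0 \<le> integral {a..c} (bump a c)"
    by (intro integral_nonneg integrable_continuous_interval bump_continuous) (simp add: bump_props)
  moreover have "integral {a..c} (bump a c) \<noteq> 0"
  proof
    assume "integral {a..c} (bump a c) = 0"
    then have "\<forall>t\<in>{a..c}. bump a c t = 0"
      using integral_eq_0_iff[OF bump_continuous assms] by (simp add: bump_props)
    then show False using bump_props(2)[of a "(a + c) / 2" c] assms by force
  qed
  ultimately show ?thesis by simp
qed

section \<open>From a distributional equation to an integrated one\<close>

lemma continuous_on_indefinite_integral:
  fixes G :: "real \<Rightarrow> real"
  assumes "continuous_on {0..} G"
  shows "continuous_on {0..} (\<lambda>t. integral {0..t} G)"
  unfolding continuous_on_eq_continuous_within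
proof
  fix x :: real assume x: "x \<in> {0..}"
  have "G integrable_on {0..x + 1}"
    by (intro integrable_continuous_interval continuous_on_subset[OF assms]) auto
  then have "continuous_on {0..x + 1} (\<lambda>t. integral {0..t} G)"
    by (rule indefinite_integral_continuous_1)
  then have "continuous (at x within {0..x + 1}) (\<lambda>t. integral {0..t} G)"
    using x by (simp add: continuous_on_eq_continuous_within)
  moreover have "at x within {0..x + 1} = at x within {0..}"
    by (rule at_within_nhd[where S = "{..<x + 1}"]) auto
  ultimately show "continuous (at x within {0..}) (\<lambda>t. integral {0..t} G)" by simp
qed

text \<open>Links the Lebesgue integral in the weak formulation to the gauge integral used in
  calculus. As \<open>0 < s\<close>, the function vanishes at zero, so it does not matter on which
  side that endpoint falls.\<close>

lemma set_lebesgue_integral_compact_support: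
  fixes f :: "real \<Rightarrow> real"
  assumes "0 < s" "continuous_on {0..T} f" "\<And>t. t \<notin> {s..T} \<Longrightarrow> f t = 0"
  shows "(LINT t:{0<..}|lborel. f t) = integral {0..T} f"
proof -
  have "(LINT t:{0<..}|lborel. f t) = (LINT t:{0..T}|lborel. f t)"
    unfolding set_lebesgue_integral_def
    by (rule Bochner_Integration.integral_cong) (use assms(1,3) in \<open>auto simp: indicator_def\<close>)
  also have "\<dots> = integral {0..T} f"
    by (intro set_borel_integral_eq_integral(2) borel_integrable_atLeastAtMost' assms(2))
  finally show ?thesis .
qed

text \<open>The difference \<open>H\<close> of \<open>F\<close> and the primitive of
  \<open>G\<close> has zero distributional derivative. It is tested with a function whose derivative
  is the difference of two normalised bumps, one just after each of two times: the local means of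
  \<open>H\<close> coincide there, and by continuity so do its values.\<close>

lemma du_Bois_Reymond:
  fixes F G :: "real \<Rightarrow> real"
  assumes F: "continuous_on {0..} F" and G: "continuous_on {0..} G"
    and weak: "\<And>\<eta>. time_test \<eta> \<Longrightarrow>
      - (LINT t:{0<..}|lborel. deriv \<eta> t * F t) = (LINT t:{0<..}|lborel. \<eta> t * G t)"
    and "0 \<le> s" "s \<le> t"
  shows "F t - F s = integral {s..t} G"
proof -
  define \<Gamma> where "\<Gamma> t = integral {0..t} G" for t
  define H where "H t = F t - \<Gamma> t" for t
  have \<Gamma>: "continuous_on {0..} \<Gamma>"
    unfolding \<Gamma>_def[abs_def] by (rule continuous_on_indefinite_integral[OF G])
  have Hc: "continuous_on {0..} H"
    unfolding H_def[abs_def] by (intro continuous_intros F \<Gamma>)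
  have key: "H s = H t" if st: "0 < s" "s < t" for s t
  proof (rule ccontr)
    assume "H s \<noteq> H t"
    \<comment> \<open>A third of the gap: two equal means, each this close to its own value of
      \<open>H\<close>, would leave a gap of at most two thirds of itself.\<close>
    then have "0 < \<bar>H s - H t\<bar> / 3" (is "0 < ?e") by simp
    have ex: "\<exists>d>0. \<forall>y\<in>{0..}. dist y x < d \<longrightarrow> dist (H y) (H x) < ?e" if "0 < x" for x
      using Hc[unfolded continuous_on_iff, rule_format, of x ?e] \<open>0 < ?e\<close> that by auto
    obtain d1 where d1: "0 < d1" "\<And>y. y \<ge> 0 \<Longrightarrow> dist y s < d1 \<Longrightarrow> dist (H y) (H s) < ?e"
      using ex[of s] st by auto
    obtain d2 where d2: "0 < d2" "\<And>y. y \<ge> 0 \<Longrightarrow> dist y t < d2 \<Longrightarrow> dist (H y) (H t) < ?e"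
      using ex[of t] st by auto
    note d = d1 d2
    \<comment> \<open>Half the smaller radius, so that both bumps stay strictly inside the
      neighbourhoods where \<open>H\<close> is almost constant.\<close>
    define \<epsilon> where "\<epsilon> = min d1 d2 / 2"
    have \<epsilon>: "0 < \<epsilon>" "\<epsilon> < d1" "\<epsilon> < d2" using d by (auto simp: \<epsilon>_def min_def)
    define T where "T = t + \<epsilon>"
    have T: "0 < T" "s + \<epsilon> \<le> T" using st \<epsilon> by (auto simp: T_def)
    have near: "\<bar>(integral {0..T} (\<lambda>x. bump u (u + \<epsilon>) x * H x)) / integral {0..T} (bump u (u + \<epsilon>)) - H u\<bar> \<le> ?e
        \<and> 0 < integral {0..T} (bump u (u + \<epsilon>))"
      if u: "0 < u" "u + \<epsilon> \<le> T" and "\<And>y. y \<ge> 0 \<Longrightarrow> dist y u \<le> \<epsilon> \<Longrightarrow> dist (H y) (H u) < ?e" for u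
    proof -
      let ?b = "bump u (u + \<epsilon>)"
      have HT: "continuous_on {0..T} H" using Hc by (rule continuous_on_subset) auto
      have "integral {u..u + \<epsilon>} ?b \<le> integral {0..T} ?b"
        using u by (intro integral_subset_le integrable_continuous_interval bump_continuous) (auto simp: bump_props)
      then have m: "0 < integral {0..T} ?b" using integral_bump_pos[of u "u + \<epsilon>"] \<epsilon> by simp
      have "integral {0..T} (\<lambda>x. ?b x * H x) - H u * integral {0..T} ?b = integral {0..T} (\<lambda>x. ?b x * (H x - H u))"
        by (subst integral_mult_right[symmetric], subst integral_diff[symmetric])
          (auto intro!: integrable_continuous_interval continuous_intros bump_continuous HT
            simp: algebra_simps)
      also have "norm \<dots> \<le> integral {0..T} (\<lambda>x. ?e * ?b x)"
      proof (rule integral_norm_bound_integral)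
        fix x assume "x \<in> {0..T}"
        show "norm (?b x * (H x - H u)) \<le> ?e * ?b x"
        proof (cases "x \<in> {u<..<u + \<epsilon>}")
          case True
          then have "\<bar>H x - H u\<bar> \<le> ?e" using that(3)[of x] u by (simp add: dist_real_def)
          then show ?thesis
            using mult_right_mono[OF _ bump_props(1), of "\<bar>H x - H u\<bar>" ?e u "u + \<epsilon>" x]
            by (simp add: abs_mult bump_props(1) mult.commute)
        qed (simp add: bump_props(3))
      qed (intro integrable_continuous_interval continuous_intros bump_continuous HT)+
      also have "\<dots> = ?e * integral {0..T} ?b" by simp
      finally have "\<bar>integral {0..T} (\<lambda>x. ?b x * H x) - H u * integral {0..T} ?b\<bar> \<le> ?e * integral {0..T} ?b"
        by simp
      moreover have "integral {0..T} (\<lambda>x. ?b x * H x) / integral {0..T} ?b - H u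
          = (integral {0..T} (\<lambda>x. ?b x * H x) - H u * integral {0..T} ?b) / integral {0..T} ?b"
        using m by (simp add: field_simps)
      ultimately have "\<bar>integral {0..T} (\<lambda>x. ?b x * H x) / integral {0..T} ?b - H u\<bar> \<le> ?e"
        using m by (simp only: abs_divide) (simp add: pos_divide_le_eq)
      then show ?thesis using m by simp
    qed
    let ?bs = "bump s (s + \<epsilon>)" and ?bt = "bump t (t + \<epsilon>)"
    define ms where "ms = integral {0..T} ?bs"
    define mt where "mt = integral {0..T} ?bt"
    have ns: "\<bar>(integral {0..T} (\<lambda>x. ?bs x * H x)) / ms - H s\<bar> \<le> ?e" "0 < ms"
      unfolding ms_def using near[of s] st T d \<epsilon> by auto
    have nt: "\<bar>(integral {0..T} (\<lambda>x. ?bt x * H x)) / mt - H t\<bar> \<le> ?e" "0 < mt"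
      unfolding mt_def using near[of t] st d \<epsilon> by (auto simp: T_def)
    \<comment> \<open>Normalisation makes the total integral zero, so the primitive
      \<open>\<eta>\<close> vanishes beyond \<open>T\<close> as well as before \<open>s\<close>, as
      a test function must.\<close>
    define \<beta> where "\<beta> x = (1 / ms) * ?bs x - (1 / mt) * ?bt x" for x
    define \<eta> where "\<eta> x = integral {0..x} \<beta>" for x
    have \<beta>c: "continuous_on A \<beta>" for A
      unfolding \<beta>_def[abs_def] by (intro continuous_intros bump_continuous)
    have \<beta>0: "\<beta> x = 0" if "x \<notin> {s..T}" for x
      using that st \<epsilon> by (auto simp: \<beta>_def T_def bump_props(3))
    have \<eta>s: "\<eta> x = 0" if "x \<le> s" for x
    proof -
      have "\<eta> x = integral {0..x} (\<lambda>_. 0)"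
        unfolding \<eta>_def by (rule integral_spike[where S = "{s}"]) (use that \<beta>0 in auto)
      then show ?thesis by simp
    qed
    have \<eta>T: "\<eta> T = 0"
    proof -
      have "\<eta> T = 1 / ms * ms - 1 / mt * mt"
        unfolding \<eta>_def \<beta>_def[abs_def]
        by (subst integral_diff) (use ns nt in \<open>auto intro!: integrable_continuous_interval
          continuous_intros bump_continuous simp flip: ms_def mt_def\<close>)
      then show ?thesis using ns nt by simp
    qed
    have \<eta>T': "\<eta> x = 0" if "x \<ge> T" for x
    proof -
      have "\<eta> x = \<eta> T + integral {T..x} \<beta>"
        unfolding \<eta>_def using that T
        by (intro Henstock_Kurzweil_Integration.integral_combine[symmetric]
          integrable_continuous_interval \<beta>c) auto
      also have "integral {T..x} \<beta> = integral {T..x} (\<lambda>_. 0)"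
        by (rule integral_spike[where S = "{T}"]) (use \<beta>0 in auto)
      finally show ?thesis using \<eta>T by simp
    qed
    have d\<eta>: "(\<eta> has_real_derivative \<beta> x) (at x)" for x
    proof (cases "x < s")
      case True
      have "(\<eta> has_real_derivative 0) (at x)"
        by (rule has_field_derivative_transform_within_open[where S = "{..<s}" and f = "\<lambda>_. 0"])
          (use True \<eta>s in auto)
      then show ?thesis using \<beta>0[of x] True by simp
    next
      case False
      then have "((\<lambda>x. integral {0..x} \<beta>) has_real_derivative \<beta> x) (at x within {0..x + 1})"
        using st by (intro integral_has_real_derivative \<beta>c) auto
      moreover have "at x within {0..x + 1} = at x"
        using False st by (intro at_within_interior) auto
      ultimately show ?thesis unfolding \<eta>_def[abs_def] by simp
    qed
    have deriv\<eta>: "deriv \<eta> = \<beta>" using d\<eta> DERIV_imp_deriv by blast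
    have "time_test \<eta>"
      unfolding time_test_def
    proof (intro conjI allI exI)
      fix n x
      show "(deriv ^^ n) \<eta> differentiable (at x)"
      proof (cases n)
        case 0
        then show ?thesis using d\<eta> real_differentiable_def by auto
      next
        case (Suc k)
        then have "(deriv ^^ n) \<eta> = (deriv ^^ k) (deriv \<eta>)" by (simp only: funpow_Suc_right o_apply)
        then show ?thesis
          using bump_smooth[of k "1 / ms" s "s + \<epsilon>" "1 / mt" t "t + \<epsilon>" x] unfolding deriv\<eta> \<beta>_def[abs_def] by simp
      qed
    next
      show "0 < s" "s < T" using st \<epsilon> by (auto simp: T_def)
      show "x \<notin> {s..T} \<longrightarrow> \<eta> x = 0" for x using \<eta>s \<eta>T' by (auto simp: not_le less_imp_le)
    qed
    from weak[OF this]
    have w: "- (LINT x:{0<..}|lborel. \<beta> x * F x) = (LINT x:{0<..}|lborel. \<eta> x * G x)"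
      unfolding deriv\<eta> .
    have \<eta>c: "continuous_on A \<eta>" for A
      using d\<eta> DERIV_isCont continuous_at_imp_continuous_on by blast
    have cT: "continuous_on {0..T} F" "continuous_on {0..T} G" "continuous_on {0..T} \<Gamma>" "continuous_on {0..T} H"
      using F G \<Gamma> Hc by (auto elim: continuous_on_subset)
    have "(LINT x:{0<..}|lborel. \<beta> x * F x) = integral {0..T} (\<lambda>x. \<beta> x * F x)"
      using st(1) by (rule set_lebesgue_integral_compact_support) (auto intro!: continuous_intros \<beta>c cT simp: \<beta>0)
    moreover have "(LINT x:{0<..}|lborel. \<eta> x * G x) = integral {0..T} (\<lambda>x. \<eta> x * G x)"
      using st(1) by (rule set_lebesgue_integral_compact_support)
        (use \<eta>s \<eta>T' in \<open>auto intro!: continuous_intros \<eta>c cT simp: not_le less_imp_le\<close>)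
    \<comment> \<open>Integration by parts moves the derivative from \<open>\<Gamma>\<close> to
      \<open>\<eta>\<close>; both boundary terms are zero.\<close>
    moreover have "((\<lambda>x. \<beta> x * \<Gamma> x + \<eta> x * G x) has_integral \<eta> T * \<Gamma> T - \<eta> 0 * \<Gamma> 0) {0..T}"
    proof (rule fundamental_theorem_of_calculus)
      fix x assume x: "x \<in> {0..T}"
      have "(\<Gamma> has_real_derivative G x) (at x within {0..T})"
        unfolding \<Gamma>_def[abs_def] using x by (intro integral_has_real_derivative cT) auto
      moreover have "(\<eta> has_real_derivative \<beta> x) (at x within {0..T})"
        using d\<eta> has_field_derivative_at_within by blast
      ultimately show "((\<lambda>x. \<eta> x * \<Gamma> x) has_vector_derivative \<beta> x * \<Gamma> x + \<eta> x * G x) (at x within {0..T})"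
        unfolding has_real_derivative_iff_has_vector_derivative[symmetric]
        by (auto intro!: derivative_eq_intros)
    qed (use T in simp)
    then have "integral {0..T} (\<lambda>x. \<beta> x * \<Gamma> x + \<eta> x * G x) = 0"
      using \<eta>T \<eta>s[of 0] st by (simp add: integral_unique)
    then have "integral {0..T} (\<lambda>x. \<beta> x * \<Gamma> x) + integral {0..T} (\<lambda>x. \<eta> x * G x) = 0"
      by (subst (asm) integral_add) (auto intro!: integrable_continuous_interval continuous_intros \<beta>c \<eta>c cT)
    ultimately have "integral {0..T} (\<lambda>x. \<beta> x * F x) - integral {0..T} (\<lambda>x. \<beta> x * \<Gamma> x) = 0"
      using w by simp
    then have "integral {0..T} (\<lambda>x. \<beta> x * H x) = 0"
      unfolding H_def right_diff_distrib
      by (subst integral_diff) (auto intro!: integrable_continuous_interval continuous_intros \<beta>c cT)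
    moreover have "integral {0..T} (\<lambda>x. \<beta> x * H x)
        = integral {0..T} (\<lambda>x. ?bs x * H x) / ms - integral {0..T} (\<lambda>x. ?bt x * H x) / mt"
    proof -
      have "integral {0..T} (\<lambda>x. \<beta> x * H x)
          = integral {0..T} (\<lambda>x. (1 / ms) * (?bs x * H x) - (1 / mt) * (?bt x * H x))"
        by (rule integral_cong) (simp add: \<beta>_def algebra_simps)
      also have "\<dots> = (1 / ms) * integral {0..T} (\<lambda>x. ?bs x * H x) - (1 / mt) * integral {0..T} (\<lambda>x. ?bt x * H x)"
        using ns(2) nt(2)
        by (subst integral_diff) (auto intro!: integrable_continuous_interval continuous_intros bump_continuous cT)
      finally show ?thesis by simp
    qed
    ultimately have "integral {0..T} (\<lambda>x. ?bs x * H x) / ms = integral {0..T} (\<lambda>x. ?bt x * H x) / mt"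
      by simp
    moreover have False if "q = q'" "\<bar>q - a\<bar> \<le> \<bar>a - b\<bar> / 3" "\<bar>q' - b\<bar> \<le> \<bar>a - b\<bar> / 3" "0 < \<bar>a - b\<bar> / 3"
      for q q' a b :: real
    proof -
      have "\<bar>a - b\<bar> \<le> \<bar>q - a\<bar> + \<bar>q' - b\<bar>" using that(1) by linarith
      then show False using that(2-4) by (simp add: field_simps)
    qed
    ultimately show False using ns(1) nt(1) \<open>0 < ?e\<close> by metis
  qed
  \<comment> \<open>Test functions are supported in the open half-line, so time zero is reached only
    by continuity.\<close>
  have const: "H x = H 1" if "x \<in> {0..}" for x
  proof (rule continuous_constant_on_closure[where S = "{0<..}" and f = H])
    show "continuous_on (closure {0<..}) H" using Hc by simp
    show "\<And>x. x \<in> {0<..} \<Longrightarrow> H x = H 1"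
      using key by (metis greaterThan_iff linorder_neqE_linordered_idom zero_less_one)
    show "x \<in> closure {0<..}" using that by simp
  qed
  then have "F t - \<Gamma> t = F s - \<Gamma> s"
    using assms(4,5) unfolding H_def by (metis atLeast_iff order_trans)
  moreover have "\<Gamma> s + integral {s..t} G = \<Gamma> t"
    unfolding \<Gamma>_def using assms(4,5)
    by (intro Henstock_Kurzweil_Integration.integral_combine integrable_continuous_interval continuous_on_subset[OF G]) auto
  ultimately show ?thesis by simp
qed

section \<open>Mean-field potentials\<close>

text \<open>The norm is bounded crudely by the sum of the component bounds; this is the origin of
  the factor \<open>real DIM('a)\<close> in the gradient bounds.\<close>

lemma norm_weighted_basis_le:
  fixes g :: "'a::euclidean_space \<Rightarrow> real"
  assumes "\<And>b. b \<in> Basis \<Longrightarrow> \<bar>g b\<bar> \<le> B"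
  shows "norm (\<Sum>b\<in>Basis. g b *\<^sub>R b) \<le> real DIM('a) * B"
proof -
  have "norm (\<Sum>b\<in>Basis. g b *\<^sub>R b) \<le> (\<Sum>b\<in>(Basis :: 'a set). B)"
    by (rule sum_norm_le) (simp add: assms)
  then show ?thesis by simp
qed

lemma norm_square_basis:
  fixes g :: "'a::euclidean_space \<Rightarrow> real"
  shows "(norm (\<Sum>b\<in>Basis. g b *\<^sub>R b))\<^sup>2 = (\<Sum>b\<in>Basis. (g b)\<^sup>2)"
proof -
  have "b \<bullet> (\<Sum>c\<in>Basis. g c *\<^sub>R c) = g b" if "b \<in> Basis" for b
    using that by (simp add: inner_sum_right inner_Basis if_distrib sum.delta cong: if_cong)
  then show ?thesis
    unfolding power2_norm_eq_inner by (simp add: inner_sum_left power2_eq_square)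
qed

text \<open>The mean value inequality on a convex set; it is applied to a ball around
  \<open>K\<close>.\<close>

lemma gradient_bound_lipschitz:
  fixes h :: "'a::euclidean_space \<Rightarrow> real"
  assumes "C1_on UNIV h" "0 \<le> G" "\<And>x. x \<in> S \<Longrightarrow> norm (gradient h x) \<le> G" "convex S"
  shows "G-lipschitz_on S h"
proof (rule lipschitz_onI)
  fix x y assume xy: "x \<in> S" "y \<in> S"
  have "norm (h x - h y) \<le> G * norm (x - y)"
  proof (rule differentiable_bound[OF assms(4) _ _ xy])
    show "(h has_derivative (\<lambda>v. v \<bullet> gradient h z)) (at z within S)" for z
      using C1_on_gradient(1)[OF assms(1)] has_derivative_at_withinI by blast
    show "onorm (\<lambda>v. v \<bullet> gradient h z) \<le> G" if "z \<in> S" for z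
    proof (rule onorm_le)
      fix v
      show "norm (v \<bullet> gradient h z) \<le> G * norm v"
        using Cauchy_Schwarz_ineq2[of v "gradient h z"] mult_right_mono[OF assms(3)[OF that] norm_ge_zero[of v]]
        by (simp add: mult.commute)
    qed
  qed
  then show "dist (h x) (h y) \<le> G * dist x y" by (simp add: dist_norm)
qed (rule assms)

text \<open>\<open>C\<close> carries the law of the inputs, \<open>\<Psi>\<close> is the output at
  all positions, and \<open>D\<close> and \<open>D2\<close> hold its first and second partial
  derivatives. \<open>\<Lambda> X\<close> is the loss as a function of the logits. It enters through
  a subgradient \<open>W X\<close> that is bounded and Lipschitz. The constant \<open>B\<close>
  bounds \<open>\<Psi>\<close> and its derivatives, while \<open>M\<close> bounds both
  \<open>W\<close> and the loss at zero logits.\<close>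

locale mean_field = input_law P C for P :: "'p::euclidean_space measure" and C +
  fixes K :: "'a::euclidean_space set" and \<Psi> :: "'p \<Rightarrow> 'a \<Rightarrow> 'e::euclidean_space"
    and D :: "'a \<Rightarrow> 'p \<Rightarrow> 'a \<Rightarrow> 'e" and D2 :: "'a \<Rightarrow> 'a \<Rightarrow> 'p \<Rightarrow> 'a \<Rightarrow> 'e"
    and W :: "'p \<Rightarrow> 'e \<Rightarrow> 'e" and \<Lambda> :: "'p \<Rightarrow> 'e \<Rightarrow> real" and M L R B :: real
  assumes compact_K: "compact K" and K_R: "K \<subseteq> cball 0 R"
    and \<Psi>: "jointly_continuous \<Psi>"
    and D: "\<And>b. b \<in> Basis \<Longrightarrow> jointly_continuous (D b)"
    and D2: "\<And>b c. b \<in> Basis \<Longrightarrow> c \<in> Basis \<Longrightarrow> jointly_continuous (D2 b c)"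
    and der: "\<And>p x. (\<Psi> p has_derivative (\<lambda>h. \<Sum>b\<in>Basis. (h \<bullet> b) *\<^sub>R D b p x)) (at x)"
    and der2: "\<And>b p x. b \<in> Basis \<Longrightarrow> (D b p has_derivative (\<lambda>h. \<Sum>c\<in>Basis. (h \<bullet> c) *\<^sub>R D2 b c p x)) (at x)"
    and B_nonneg: "0 \<le> B"
    and \<Psi>_bound: "\<And>X x. X \<in> C \<Longrightarrow> x \<in> cball 0 R \<Longrightarrow> norm (\<Psi> X x) \<le> B"
    and D_bound: "\<And>b X x. b \<in> Basis \<Longrightarrow> X \<in> C \<Longrightarrow> x \<in> cball 0 R \<Longrightarrow> norm (D b X x) \<le> B"
    and D2_bound: "\<And>b c X x. b \<in> Basis \<Longrightarrow> c \<in> Basis \<Longrightarrow> X \<in> C \<Longrightarrow> x \<in> cball 0 R \<Longrightarrow> norm (D2 b c X x) \<le> B"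
    and W_measurable: "\<And>Z. Z \<in> borel_measurable borel \<Longrightarrow> (\<lambda>X. W X (Z X)) \<in> borel_measurable borel"
    and \<Lambda>_measurable: "\<And>Z. Z \<in> borel_measurable borel \<Longrightarrow> (\<lambda>X. \<Lambda> X (Z X)) \<in> borel_measurable borel"
    and W_bound: "\<And>X z. X \<in> C \<Longrightarrow> norm (W X z) \<le> M"
    and W_lipschitz: "\<And>X z z'. X \<in> C \<Longrightarrow> norm (W X z - W X z') \<le> L * norm (z - z')" and L_nonneg: "0 \<le> L"
    and \<Lambda>_convex: "\<And>X z z'. X \<in> C \<Longrightarrow> W X z \<bullet> (z' - z) \<le> \<Lambda> X z' - \<Lambda> X z"
    and \<Lambda>_nonneg: "\<And>X z. X \<in> C \<Longrightarrow> 0 \<le> \<Lambda> X z"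
    and \<Lambda>_0: "\<And>X. X \<in> C \<Longrightarrow> \<Lambda> X 0 \<le> M"
begin

definition logits :: "'a measure \<Rightarrow> 'p \<Rightarrow> 'e" where "logits \<mu> X = (\<integral>\<omega>. \<Psi> X \<omega> \<partial>\<mu>)"

definition w :: "'a measure \<Rightarrow> 'p \<Rightarrow> 'e" where "w \<mu> X = W X (logits \<mu> X)"

definition Phi :: "'a measure \<Rightarrow> 'a \<Rightarrow> real" where "Phi \<mu> = weighted (w \<mu>) \<Psi>"

definition energy :: "'a measure \<Rightarrow> real" where "energy \<mu> = (\<integral>X. \<Lambda> X (logits \<mu> X) \<partial>P)"

text \<open>Common consequence of a small Wasserstein distance and of a short time span of the flow.\<close>

definition close :: "'a measure \<Rightarrow> 'a measure \<Rightarrow> real \<Rightarrow> bool" where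
  "close \<mu> \<nu> d \<longleftrightarrow> (\<forall>h G. C1_on UNIV h \<longrightarrow> 0 \<le> G \<longrightarrow> (\<forall>x\<in>cball 0 R. norm (gradient h x) \<le> G)
     \<longrightarrow> \<bar>(\<integral>\<omega>. h \<omega> \<partial>\<mu>) - (\<integral>\<omega>. h \<omega> \<partial>\<nu>)\<bar> \<le> G * d)"

lemma closeD:
  assumes "close \<mu> \<nu> d" "C1_on UNIV h" "0 \<le> G" "\<And>x. x \<in> cball 0 R \<Longrightarrow> norm (gradient h x) \<le> G"
  shows "\<bar>(\<integral>\<omega>. h \<omega> \<partial>\<mu>) - (\<integral>\<omega>. h \<omega> \<partial>\<nu>)\<bar> \<le> G * d"
  using assms unfolding close_def by blast

lemma close_commute: "close \<mu> \<nu> d \<Longrightarrow> close \<nu> \<mu> d"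
  unfolding close_def by (metis abs_minus_commute)

lemma C1_measurable: "C1_on UNIV h \<Longrightarrow> h \<in> borel_measurable borel" for h :: "'a \<Rightarrow> real"
  by (rule borel_measurable_continuous_onI[OF C1_on_continuous])

lemma close_wasserstein1:
  assumes "\<mu> \<in> prob_on K" "\<nu> \<in> prob_on K"
  shows "close \<mu> \<nu> (wasserstein1 \<mu> \<nu>)"
  unfolding close_def
proof (intro allI impI)
  fix h :: "'a \<Rightarrow> real" and G
  assume h: "C1_on UNIV h" "0 \<le> G" "\<forall>x\<in>cball 0 R. norm (gradient h x) \<le> G"
  have "G-lipschitz_on (cball 0 R) h"
    by (rule gradient_bound_lipschitz) (use h in auto)
  then have "G-lipschitz_on K h" using K_R lipschitz_on_subset by blast
  then show "\<bar>(\<integral>\<omega>. h \<omega> \<partial>\<mu>) - (\<integral>\<omega>. h \<omega> \<partial>\<nu>)\<bar> \<le> G * wasserstein1 \<mu> \<nu>"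
    by (rule wasserstein1_lipschitz[OF compact_K assms C1_measurable[OF h(1)]])
qed

lemma continuous_integrable:
  fixes h :: "'a \<Rightarrow> 'b::euclidean_space"
  assumes "\<mu> \<in> prob_on K" "continuous_on UNIV h"
  shows "integrable \<mu> h"
proof -
  note m = prob_onD[OF assms(1)]
  interpret mu: prob_space \<mu> by (rule m)
  have "bounded (h ` K)"
    using compact_continuous_image[OF continuous_on_subset[OF assms(2)] compact_K] compact_imp_bounded by simp
  then obtain c where c: "\<And>x. x \<in> K \<Longrightarrow> norm (h x) \<le> c" by (auto simp: bounded_iff)
  show ?thesis
  proof (rule mu.integrable_const_bound[of _ c])
    show "AE x in \<mu>. norm (h x) \<le> c"
      using prob_on_AE[OF assms(1) compact_K] by eventually_elim (rule c)
    show "h \<in> borel_measurable \<mu>"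
      using borel_measurable_continuous_onI[OF assms(2)] m(2) measurable_cong_sets by blast
  qed
qed

lemma integral_bound_K:
  fixes h :: "'a \<Rightarrow> real"
  assumes "\<mu> \<in> prob_on K" "continuous_on UNIV h" "\<And>x. x \<in> K \<Longrightarrow> \<bar>h x\<bar> \<le> c"
  shows "\<bar>\<integral>\<omega>. h \<omega> \<partial>\<mu>\<bar> \<le> c"
proof -
  interpret mu: prob_space \<mu> by (rule prob_onD[OF assms(1)])
  have "\<bar>\<integral>\<omega>. h \<omega> \<partial>\<mu>\<bar> \<le> (\<integral>\<omega>. \<bar>h \<omega>\<bar> \<partial>\<mu>)" by (rule integral_abs_bound)
  also have "\<dots> \<le> (\<integral>\<omega>. c \<partial>\<mu>)"
  proof (rule integral_mono_AE)
    show "AE x in \<mu>. \<bar>h x\<bar> \<le> c"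
      using prob_on_AE[OF assms(1) compact_K] by eventually_elim (rule assms(3))
  qed (use continuous_integrable[OF assms(1,2)] in auto)
  finally show ?thesis by (simp add: mu.prob_space)
qed

lemma \<Psi>_continuous: "continuous_on UNIV (\<Psi> X)"
  using continuous_on_compose2[OF \<Psi>, of UNIV "\<lambda>x. (X, x)"] by (simp add: continuous_on_Pair)

lemma \<Psi>_inner_C1: "C1_on UNIV (\<lambda>\<omega>. u \<bullet> \<Psi> X \<omega>)"
  and \<Psi>_inner_gradient: "gradient (\<lambda>\<omega>. u \<bullet> \<Psi> X \<omega>) \<omega> = (\<Sum>b\<in>Basis. (u \<bullet> D b X \<omega>) *\<^sub>R b)"
proof -
  have d: "((\<lambda>\<omega>. u \<bullet> \<Psi> X \<omega>) has_derivative (\<lambda>h. \<Sum>b\<in>Basis. (h \<bullet> b) * (u \<bullet> D b X \<omega>))) (at \<omega>)" for \<omega>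
    using has_derivative_inner_right[OF der] by (simp add: inner_sum_right)
  show "C1_on UNIV (\<lambda>\<omega>. u \<bullet> \<Psi> X \<omega>)"
  proof (rule C1_onI[OF d])
    fix b :: 'a assume "b \<in> Basis"
    then have "continuous_on UNIV (D b X)"
      using continuous_on_compose2[OF D, of b UNIV "\<lambda>x. (X, x)"] by (simp add: continuous_on_Pair)
    then show "continuous_on UNIV (\<lambda>\<omega>. u \<bullet> D b X \<omega>)" by (intro continuous_intros)
  qed
  show "gradient (\<lambda>\<omega>. u \<bullet> \<Psi> X \<omega>) \<omega> = (\<Sum>b\<in>Basis. (u \<bullet> D b X \<omega>) *\<^sub>R b)"
    by (rule gradient_basisI[OF d])
qed

text \<open>Duality: \<open>close\<close> is tested with the component of \<open>\<Psi> X\<close> in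
  the direction of the difference \<open>u\<close> itself. This bounds the square of
  \<open>norm u\<close> by a multiple of \<open>norm u\<close>, which is then cancelled.\<close>

lemma logits_diff:
  assumes "\<mu> \<in> prob_on K" "\<nu> \<in> prob_on K" "close \<mu> \<nu> d" "X \<in> C"
  shows "norm (logits \<mu> X - logits \<nu> X) \<le> real DIM('a) * B * d"
proof -
  define u where "u = logits \<mu> X - logits \<nu> X"
  note i = continuous_integrable[OF assms(1) \<Psi>_continuous[of X]] continuous_integrable[OF assms(2) \<Psi>_continuous[of X]]
  have "\<bar>(\<integral>\<omega>. u \<bullet> \<Psi> X \<omega> \<partial>\<mu>) - (\<integral>\<omega>. u \<bullet> \<Psi> X \<omega> \<partial>\<nu>)\<bar> \<le> (real DIM('a) * (norm u * B)) * d"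
  proof (rule closeD[OF assms(3) \<Psi>_inner_C1])
    fix x :: 'a assume x: "x \<in> cball 0 R"
    show "norm (gradient (\<lambda>\<omega>. u \<bullet> \<Psi> X \<omega>) x) \<le> real DIM('a) * (norm u * B)"
      unfolding \<Psi>_inner_gradient
    proof (rule norm_weighted_basis_le)
      fix b :: 'a assume "b \<in> Basis"
      then show "\<bar>u \<bullet> D b X x\<bar> \<le> norm u * B"
        using Cauchy_Schwarz_ineq2[of u "D b X x"] mult_left_mono[OF D_bound[OF _ assms(4) x] norm_ge_zero[of u]]
        by force
    qed
  qed (use B_nonneg in simp)
  moreover have "(\<integral>\<omega>. u \<bullet> \<Psi> X \<omega> \<partial>\<mu>) - (\<integral>\<omega>. u \<bullet> \<Psi> X \<omega> \<partial>\<nu>) = (norm u)\<^sup>2"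
    using i by (simp add: u_def logits_def power2_norm_eq_inner inner_diff_right)
  ultimately have "norm u * norm u \<le> norm u * (real DIM('a) * B * d)"
    by (simp add: power2_eq_square mult_ac)
  \<comment> \<open>For \<open>u = 0\<close> nothing can be cancelled and \<open>0 \<le> d\<close>
    has to be known. It is implicit in \<open>close\<close>: a coordinate function has a gradient of
    norm one.\<close>
  moreover have "0 \<le> real DIM('a) * B * d" if "norm u = 0"
  proof -
    obtain b :: 'a where b: "b \<in> Basis" using nonempty_Basis by blast
    have "((\<lambda>x. x \<bullet> b) has_derivative (\<lambda>h. h \<bullet> b)) (at x)" for x
      by (auto intro!: derivative_eq_intros)
    then have g: "gradient (\<lambda>x. x \<bullet> b) x = b" for x by (rule gradientI)
    have "C1_on UNIV (\<lambda>x. x \<bullet> b)"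
    proof (rule C1_onI[where D = "\<lambda>c x. c \<bullet> b"])
      show "((\<lambda>x. x \<bullet> b) has_derivative (\<lambda>h. \<Sum>c\<in>Basis. (h \<bullet> c) * (c \<bullet> b))) (at x)" for x
      proof -
        have "(\<Sum>c\<in>Basis. (h \<bullet> c) * (c \<bullet> b)) = h \<bullet> b" for h
          using b by (simp add: inner_Basis if_distrib sum.delta cong: if_cong)
        then show ?thesis by (simp add: bounded_linear_imp_has_derivative bounded_linear_inner_left)
      qed
    qed (intro continuous_intros)
    then have "0 \<le> 1 * d"
      using closeD[OF assms(3), of "\<lambda>x. x \<bullet> b" 1] g b by force
    then show ?thesis using B_nonneg by simp
  qed
  ultimately have "norm u \<le> real DIM('a) * B * d"
    by (cases "norm u = 0") (auto simp: mult_le_cancel_left_pos)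
  then show ?thesis by (simp add: u_def)
qed

lemma \<Psi>_measurable: "(\<lambda>(p, x). \<Psi> p x) \<in> borel_measurable (borel \<Otimes>\<^sub>M borel)"
  unfolding borel_prod by (rule borel_measurable_continuous_onI[OF \<Psi>])

lemma logits_measurable:
  assumes "\<mu> \<in> prob_on K"
  shows "logits \<mu> \<in> borel_measurable borel"
proof -
  interpret mu: prob_space \<mu> by (rule prob_onD[OF assms])
  have "sets (borel \<Otimes>\<^sub>M \<mu>) = sets (borel \<Otimes>\<^sub>M borel :: ('p \<times> 'a) measure)"
    by (intro sets_pair_measure_cong prob_onD[OF assms] refl)
  then have "(\<lambda>(p, x). \<Psi> p x) \<in> borel_measurable (borel \<Otimes>\<^sub>M \<mu>)"
    using \<Psi>_measurable measurable_cong_sets by blast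
  then show ?thesis
    unfolding logits_def[abs_def] by (rule mu.borel_measurable_lebesgue_integral)
qed

lemma weight_w: "\<mu> \<in> prob_on K \<Longrightarrow> weight M (w \<mu>)"
  unfolding weight_def w_def[abs_def] using W_measurable[OF logits_measurable] W_bound by blast

lemma M_nonneg: "\<mu> \<in> prob_on K \<Longrightarrow> 0 \<le> M"
  using weight_nonneg[OF weight_w] .

lemma weight_w_diff:
  assumes "\<mu> \<in> prob_on K" "\<nu> \<in> prob_on K" "close \<mu> \<nu> d"
  shows "weight (L * (real DIM('a) * B * d)) (\<lambda>X. w \<mu> X - w \<nu> X)"
  unfolding weight_def
proof (intro conjI ballI)
  show "(\<lambda>X. w \<mu> X - w \<nu> X) \<in> borel_measurable borel"
    using weight_w[OF assms(1)] weight_w[OF assms(2)] unfolding weight_def by (intro borel_measurable_diff) auto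
  fix X assume X: "X \<in> C"
  show "norm (w \<mu> X - w \<nu> X) \<le> L * (real DIM('a) * B * d)"
    unfolding w_def using W_lipschitz[OF X] mult_left_mono[OF logits_diff[OF assms X] L_nonneg] order_trans by blast
qed

section \<open>The potential, its gradient and the dissipation\<close>

lemma Phi_has_derivative:
  assumes "\<mu> \<in> prob_on K"
  shows "(Phi \<mu> has_derivative (\<lambda>h. \<Sum>b\<in>Basis. (h \<bullet> b) * weighted (w \<mu>) (D b) x)) (at x)"
  unfolding Phi_def by (rule weighted_has_derivative[OF weight_w[OF assms] \<Psi> D der])

lemma Phi_gradient:
  assumes "\<mu> \<in> prob_on K"
  shows "gradient (Phi \<mu>) x = (\<Sum>b\<in>Basis. weighted (w \<mu>) (D b) x *\<^sub>R b)"
  by (rule gradient_basisI[OF Phi_has_derivative[OF assms]])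

lemma Phi_C1:
  assumes "\<mu> \<in> prob_on K"
  shows "C1_on UNIV (Phi \<mu>)"
  by (rule C1_onI[OF Phi_has_derivative[OF assms] weighted_continuous[OF weight_w[OF assms] D]])

lemma Phi_gradient_continuous: "\<mu> \<in> prob_on K \<Longrightarrow> continuous_on UNIV (gradient (Phi \<mu>))"
  using C1_on_gradient(2)[OF Phi_C1] .

lemma Phi_gradient_bound:
  assumes "\<mu> \<in> prob_on K" "x \<in> cball 0 R"
  shows "norm (gradient (Phi \<mu>) x) \<le> real DIM('a) * (M * B)"
  unfolding Phi_gradient[OF assms(1)]
  by (intro norm_weighted_basis_le weighted_bound[OF weight_w[OF assms(1)]] D D_bound assms(2))

text \<open>The measure enters the potential only through its weight, and linearly so. The
  difference of gradients is thus the same integral with the difference of weights, which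
  \<open>weight_w_diff\<close> makes small.\<close>

lemma Phi_gradient_diff:
  assumes "\<mu> \<in> prob_on K" "\<nu> \<in> prob_on K" "close \<mu> \<nu> d" "x \<in> cball 0 R"
  shows "norm (gradient (Phi \<mu>) x - gradient (Phi \<nu>) x) \<le> real DIM('a) * (L * (real DIM('a) * B * d) * B)"
proof -
  have "gradient (Phi \<mu>) x - gradient (Phi \<nu>) x
      = (\<Sum>b\<in>Basis. (weighted (w \<mu>) (D b) x - weighted (w \<nu>) (D b) x) *\<^sub>R b)"
    unfolding Phi_gradient[OF assms(1)] Phi_gradient[OF assms(2)]
    by (simp add: sum_subtractf scaleR_diff_left)
  also have "\<dots> = (\<Sum>b\<in>Basis. weighted (\<lambda>X. w \<mu> X - w \<nu> X) (D b) x *\<^sub>R b)"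
    using weighted_integrable[OF weight_w[OF assms(1)] D] weighted_integrable[OF weight_w[OF assms(2)] D]
    by (intro sum.cong refl) (simp add: weighted_def inner_diff_left)
  also have "norm \<dots> \<le> real DIM('a) * (L * (real DIM('a) * B * d) * B)"
    by (intro norm_weighted_basis_le weighted_bound[OF weight_w_diff[OF assms(1-3)]] D D_bound assms(4))
  finally show ?thesis .
qed

text \<open>Makes the integrand of the dissipation an admissible test function for
  \<open>close\<close>. This is the point where the second derivatives of \<open>\<Psi>\<close>
  enter.\<close>

lemma gradient_square:
  assumes "\<mu> \<in> prob_on K"
  shows "C1_on UNIV (\<lambda>x. (norm (gradient (Phi \<mu>) x))\<^sup>2)"
    and "x \<in> cball 0 R \<Longrightarrow> norm (gradient (\<lambda>x. (norm (gradient (Phi \<mu>) x))\<^sup>2) x) \<le> real DIM('a) * (real DIM('a) * (2 * (M * B) * (M * B)))"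
proof -
  let ?p = "\<lambda>b. weighted (w \<mu>) (D b)" and ?q = "\<lambda>b c. weighted (w \<mu>) (D2 b c)"
  note ww = weight_w[OF assms]
  have sq: "(norm (gradient (Phi \<mu>) x))\<^sup>2 = (\<Sum>b\<in>Basis. (?p b x)\<^sup>2)" for x
    unfolding Phi_gradient[OF assms] by (rule norm_square_basis)
  have p: "(?p b has_derivative (\<lambda>h. \<Sum>c\<in>Basis. (h \<bullet> c) * ?q b c x)) (at x)" if "b \<in> Basis" for b x
    by (rule weighted_has_derivative[OF ww D[OF that] D2[OF that] der2[OF that]])
  have d: "((\<lambda>x. (norm (gradient (Phi \<mu>) x))\<^sup>2) has_derivative
      (\<lambda>h. \<Sum>c\<in>Basis. (h \<bullet> c) * (\<Sum>b\<in>Basis. 2 * ?p b x * ?q b c x))) (at x)" for x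
  proof -
    have "((\<lambda>x. \<Sum>b\<in>Basis. (?p b x)\<^sup>2) has_derivative
        (\<lambda>h. \<Sum>b\<in>Basis. 2 * ?p b x * (\<Sum>c\<in>Basis. (h \<bullet> c) * ?q b c x))) (at x)"
    proof (rule has_derivative_sum)
      fix b :: 'a assume "b \<in> Basis"
      from has_derivative_power[OF p[OF this], of 2]
      show "((\<lambda>x. (?p b x)\<^sup>2) has_derivative (\<lambda>h. 2 * ?p b x * (\<Sum>c\<in>Basis. (h \<bullet> c) * ?q b c x))) (at x)"
        by (simp add: mult_ac)
    qed
    moreover have "(\<Sum>b\<in>Basis. 2 * ?p b x * (\<Sum>c\<in>Basis. (h \<bullet> c) * ?q b c x))
        = (\<Sum>c\<in>Basis. (h \<bullet> c) * (\<Sum>b\<in>Basis. 2 * ?p b x * ?q b c x))" for h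
      unfolding sum_distrib_left by (subst sum.swap) (simp add: mult_ac)
    ultimately show ?thesis unfolding sq by simp
  qed
  have pc: "continuous_on UNIV (?p b)" "continuous_on UNIV (?q b c)" if "b \<in> Basis" "c \<in> Basis" for b c
    using that by (auto intro!: weighted_continuous[OF ww] D D2)
  show "C1_on UNIV (\<lambda>x. (norm (gradient (Phi \<mu>) x))\<^sup>2)"
    by (rule C1_onI[OF d]) (intro continuous_intros pc)
  assume x: "x \<in> cball 0 R"
  have "norm (\<Sum>c\<in>Basis. (\<Sum>b\<in>Basis. 2 * ?p b x * ?q b c x) *\<^sub>R c) \<le> real DIM('a) * (real DIM('a) * (2 * (M * B) * (M * B)))"
  proof (rule norm_weighted_basis_le)
    fix c :: 'a assume c: "c \<in> Basis"
    have "\<bar>\<Sum>b\<in>Basis. 2 * ?p b x * ?q b c x\<bar> \<le> (\<Sum>b\<in>(Basis :: 'a set). 2 * (M * B) * (M * B))"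
    proof (rule order_trans[OF sum_abs sum_mono])
      fix b :: 'a assume b: "b \<in> Basis"
      have "\<bar>?p b x\<bar> \<le> M * B" "\<bar>?q b c x\<bar> \<le> M * B"
        using b c x by (auto intro!: weighted_bound[OF ww] D D2 D_bound D2_bound)
      then have "\<bar>?p b x\<bar> * \<bar>?q b c x\<bar> \<le> (M * B) * (M * B)" by (intro mult_mono) auto
      then show "\<bar>2 * ?p b x * ?q b c x\<bar> \<le> 2 * (M * B) * (M * B)" by (simp add: abs_mult)
    qed
    then show "\<bar>\<Sum>b\<in>Basis. 2 * ?p b x * ?q b c x\<bar> \<le> real DIM('a) * (2 * (M * B) * (M * B))" by simp
  qed
  then show "norm (gradient (\<lambda>x. (norm (gradient (Phi \<mu>) x))\<^sup>2) x) \<le> real DIM('a) * (real DIM('a) * (2 * (M * B) * (M * B)))"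
    unfolding gradient_basisI[OF d] .
qed

text \<open>The first summand pays for exchanging the potential inside the integrand, by factoring a
  difference of squares; the second pays for exchanging the measure while the potential is
  kept.\<close>

definition dissipation_const :: real where
  "dissipation_const = 2 * (real DIM('a) * (M * B)) * (real DIM('a) * (L * (real DIM('a) * B) * B)) + real DIM('a) * (real DIM('a) * (2 * (M * B) * (M * B)))"

lemma dissipation_diff:
  assumes "\<mu> \<in> prob_on K" "\<nu> \<in> prob_on K" "close \<mu> \<nu> d"
  shows "\<bar>dissipation Phi \<mu> - dissipation Phi \<nu>\<bar> \<le> dissipation_const * d"
proof -
  let ?q = "\<lambda>\<mu> x. (norm (gradient (Phi \<mu>) x))\<^sup>2"
  have qc: "continuous_on UNIV (?q \<mu>)" "continuous_on UNIV (?q \<nu>)"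
    using Phi_gradient_continuous assms(1,2) by (auto intro!: continuous_intros)
  have "\<bar>\<integral>x. ?q \<mu> x - ?q \<nu> x \<partial>\<mu>\<bar> \<le> 2 * (real DIM('a) * (M * B)) * (real DIM('a) * (L * (real DIM('a) * B * d) * B))"
  proof (rule integral_bound_K[OF assms(1)])
    fix x assume "x \<in> K"
    then have x: "x \<in> cball 0 R" using K_R by blast
    let ?a = "norm (gradient (Phi \<mu>) x)" and ?b = "norm (gradient (Phi \<nu>) x)"
    have "\<bar>?a - ?b\<bar> \<le> real DIM('a) * (L * (real DIM('a) * B * d) * B)"
      using norm_triangle_ineq3 Phi_gradient_diff[OF assms x] order_trans by blast
    moreover have "?a + ?b \<le> 2 * (real DIM('a) * (M * B))"
      using Phi_gradient_bound[OF assms(1) x] Phi_gradient_bound[OF assms(2) x] by simp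
    ultimately have "(?a + ?b) * \<bar>?a - ?b\<bar> \<le> 2 * (real DIM('a) * (M * B)) * (real DIM('a) * (L * (real DIM('a) * B * d) * B))"
      using M_nonneg[OF assms(1)] B_nonneg by (intro mult_mono) auto
    moreover have "\<bar>?a\<^sup>2 - ?b\<^sup>2\<bar> = (?a + ?b) * \<bar>?a - ?b\<bar>"
    proof -
      have "?a\<^sup>2 - ?b\<^sup>2 = (?a + ?b) * (?a - ?b)" by (simp add: power2_eq_square algebra_simps)
      then show ?thesis by (simp add: abs_mult)
    qed
    ultimately show "\<bar>?a\<^sup>2 - ?b\<^sup>2\<bar> \<le> 2 * (real DIM('a) * (M * B)) * (real DIM('a) * (L * (real DIM('a) * B * d) * B))" by simp
  qed (intro continuous_intros qc)
  moreover have "\<bar>(\<integral>x. ?q \<nu> x \<partial>\<mu>) - (\<integral>x. ?q \<nu> x \<partial>\<nu>)\<bar> \<le> real DIM('a) * (real DIM('a) * (2 * (M * B) * (M * B))) * d"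
    using M_nonneg[OF assms(1)] B_nonneg
    by (intro closeD[OF assms(3)] gradient_square assms(2)) auto
  moreover have "(\<integral>x. ?q \<mu> x - ?q \<nu> x \<partial>\<mu>) = (\<integral>x. ?q \<mu> x \<partial>\<mu>) - (\<integral>x. ?q \<nu> x \<partial>\<mu>)"
    by (intro Bochner_Integration.integral_diff continuous_integrable[OF assms(1)] qc)
  ultimately have "\<bar>dissipation Phi \<mu> - dissipation Phi \<nu>\<bar>
      \<le> 2 * (real DIM('a) * (M * B)) * (real DIM('a) * (L * (real DIM('a) * B * d) * B)) + real DIM('a) * (real DIM('a) * (2 * (M * B) * (M * B))) * d"
    unfolding dissipation_def by linarith
  also have "\<dots> = dissipation_const * d" by (simp add: dissipation_const_def algebra_simps)
  finally show ?thesis .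
qed

lemma dissipation_const_nonneg: "\<mu> \<in> prob_on K \<Longrightarrow> 0 \<le> dissipation_const"
  unfolding dissipation_const_def using M_nonneg[of \<mu>] B_nonneg L_nonneg by simp

lemma dissipation_nonneg: "0 \<le> dissipation Phi \<mu>"
  unfolding dissipation_def by simp

section \<open>The energy and its convexity\<close>

lemma logits_bound:
  assumes "\<mu> \<in> prob_on K" "X \<in> C"
  shows "norm (logits \<mu> X) \<le> B"
proof -
  interpret mu: prob_space \<mu> by (rule prob_onD[OF assms(1)])
  have "norm (logits \<mu> X) \<le> (\<integral>\<omega>. norm (\<Psi> X \<omega>) \<partial>\<mu>)"
    unfolding logits_def by (rule integral_norm_bound)
  also have "\<dots> \<le> B"
    using integral_bound_K[OF assms(1), of "\<lambda>\<omega>. norm (\<Psi> X \<omega>)" B] \<Psi>_bound[OF assms(2)] K_R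
    by (force intro: continuous_intros \<Psi>_continuous)
  finally show ?thesis .
qed

lemma energy_integrable:
  assumes "\<mu> \<in> prob_on K"
  shows "integrable P (\<lambda>X. \<Lambda> X (logits \<mu> X))"
proof (rule integrable_P[OF \<Lambda>_measurable[OF logits_measurable[OF assms]]])
  fix X assume X: "X \<in> C"
  \<comment> \<open>The subgradient inequality at the logits, evaluated at zero, bounds the loss
    from above by its value at zero plus this inner product.\<close>
  have "\<bar>W X (logits \<mu> X) \<bullet> (0 - logits \<mu> X)\<bar> \<le> M * B"
    using Cauchy_Schwarz_ineq2[of "W X (logits \<mu> X)" "0 - logits \<mu> X"]
      mult_mono[OF W_bound[OF X, of "logits \<mu> X"] logits_bound[OF assms X]] M_nonneg[OF assms] by simp
  then have "\<Lambda> X (logits \<mu> X) \<le> M + M * B"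
    using \<Lambda>_convex[OF X, of "logits \<mu> X" 0] \<Lambda>_0[OF X] by linarith
  then show "norm (\<Lambda> X (logits \<mu> X)) \<le> M + M * B" using \<Lambda>_nonneg[OF X] by simp
qed

lemma energy_nonneg: "0 \<le> energy \<mu>"
  unfolding energy_def
  by (rule integral_nonneg_AE) (use AE_C in eventually_elim, rule \<Lambda>_nonneg)

text \<open>Fubini: integrating a frozen potential against \<open>\<nu>\<close> pairs its weight
  with the logits of \<open>\<nu>\<close>. In this form convexity of the loss in the logits becomes
  a statement about potentials.\<close>

lemma integral_Phi:
  assumes "\<mu> \<in> prob_on K" "\<nu> \<in> prob_on K"
  shows "(\<integral>\<omega>. Phi \<mu> \<omega> \<partial>\<nu>) = (\<integral>X. w \<mu> X \<bullet> logits \<nu> X \<partial>P)"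
    and "integrable P (\<lambda>X. w \<mu> X \<bullet> logits \<nu> X)"
proof -
  interpret nu: prob_space \<nu> by (rule prob_onD[OF assms(2)])
  interpret PN: pair_prob_space P \<nu> ..
  have wm[measurable]: "w \<mu> \<in> borel_measurable borel" by (rule weight_measurable[OF weight_w[OF assms(1)]])
  have s: "sets (P \<Otimes>\<^sub>M \<nu>) = sets (borel \<Otimes>\<^sub>M borel :: ('p \<times> 'a) measure)"
    by (intro sets_pair_measure_cong prob_onD[OF assms(2)] sets_P)
  have m: "(\<lambda>(X, \<omega>). w \<mu> X \<bullet> \<Psi> X \<omega>) \<in> borel_measurable (P \<Otimes>\<^sub>M \<nu>)"
  proof -
    have "(\<lambda>q. w \<mu> (fst q) \<bullet> (\<lambda>(p, x). \<Psi> p x) q) \<in> borel_measurable (borel \<Otimes>\<^sub>M borel :: ('p \<times> 'a) measure)"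
      by (intro borel_measurable_inner \<Psi>_measurable measurable_compose[OF measurable_fst wm])
    then have "(\<lambda>(X, \<omega>). w \<mu> X \<bullet> \<Psi> X \<omega>) \<in> borel_measurable (borel \<Otimes>\<^sub>M borel :: ('p \<times> 'a) measure)"
      by (simp add: case_prod_beta)
    then show ?thesis unfolding measurable_cong_sets[OF s refl] .
  qed
  have "AE X in P. AE \<omega> in \<nu>. X \<in> C \<and> \<omega> \<in> K"
    using AE_C by eventually_elim (use prob_on_AE[OF assms(2) compact_K] in simp)
  moreover have "{q \<in> space (P \<Otimes>\<^sub>M \<nu>). fst q \<in> C \<and> snd q \<in> K} \<in> sets (P \<Otimes>\<^sub>M \<nu>)"
  proof -
    have "C \<times> K \<in> sets (P \<Otimes>\<^sub>M \<nu>)"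
      by (intro pair_measureI) (simp_all add: sets_P prob_onD(2)[OF assms(2)] borel_compact compact_C compact_K)
    moreover have "{q \<in> space (P \<Otimes>\<^sub>M \<nu>). fst q \<in> C \<and> snd q \<in> K} = C \<times> K"
      using sets_eq_imp_space_eq[OF s] by (auto simp: space_pair_measure)
    ultimately show ?thesis by simp
  qed
  ultimately have AE: "AE q in P \<Otimes>\<^sub>M \<nu>. fst q \<in> C \<and> snd q \<in> K"
    by (intro PN.AE_pair_measure) simp_all
  have int: "integrable (P \<Otimes>\<^sub>M \<nu>) (\<lambda>(X, \<omega>). w \<mu> X \<bullet> \<Psi> X \<omega>)"
  proof (rule PN.P.integrable_const_bound[OF _ m])
    show "AE q in P \<Otimes>\<^sub>M \<nu>. norm ((\<lambda>(X, \<omega>). w \<mu> X \<bullet> \<Psi> X \<omega>) q) \<le> M * B"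
      using AE
    proof eventually_elim
      case (elim q)
      then have "norm (w \<mu> (fst q)) * norm (\<Psi> (fst q) (snd q)) \<le> M * B"
        using K_R by (intro mult_mono weight_bound[OF weight_w[OF assms(1)]] \<Psi>_bound M_nonneg[OF assms(1)]) auto
      then show ?case
        using Cauchy_Schwarz_ineq2[of "w \<mu> (fst q)" "\<Psi> (fst q) (snd q)"] by (simp add: case_prod_beta)
    qed
  qed
  have inn: "(\<integral>\<omega>. w \<mu> X \<bullet> \<Psi> X \<omega> \<partial>\<nu>) = w \<mu> X \<bullet> logits \<nu> X" for X
    unfolding logits_def using continuous_integrable[OF assms(2) \<Psi>_continuous[of X]] by simp
  have "(\<integral>\<omega>. Phi \<mu> \<omega> \<partial>\<nu>) = (\<integral>\<omega>. (\<integral>X. w \<mu> X \<bullet> \<Psi> X \<omega> \<partial>P) \<partial>\<nu>)"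
    by (simp add: Phi_def weighted_def)
  also have "\<dots> = (\<integral>X. (\<integral>\<omega>. w \<mu> X \<bullet> \<Psi> X \<omega> \<partial>\<nu>) \<partial>P)"
    using PN.Fubini_integral[OF int] by simp
  finally show "(\<integral>\<omega>. Phi \<mu> \<omega> \<partial>\<nu>) = (\<integral>X. w \<mu> X \<bullet> logits \<nu> X \<partial>P)"
    by (simp add: inn)
  show "integrable P (\<lambda>X. w \<mu> X \<bullet> logits \<nu> X)"
    using PN.integrable_fst[OF int] by (simp add: inn)
qed

lemma energy_convex:
  assumes "\<mu> \<in> prob_on K" "\<nu> \<in> prob_on K"
  shows "(\<integral>\<omega>. Phi \<mu> \<omega> \<partial>\<nu>) - (\<integral>\<omega>. Phi \<mu> \<omega> \<partial>\<mu>) \<le> energy \<nu> - energy \<mu>"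
proof -
  have "(\<integral>\<omega>. Phi \<mu> \<omega> \<partial>\<nu>) - (\<integral>\<omega>. Phi \<mu> \<omega> \<partial>\<mu>) = (\<integral>X. w \<mu> X \<bullet> logits \<nu> X - w \<mu> X \<bullet> logits \<mu> X \<partial>P)"
    using integral_Phi[OF assms] integral_Phi[OF assms(1,1)] by simp
  also have "\<dots> \<le> (\<integral>X. \<Lambda> X (logits \<nu> X) - \<Lambda> X (logits \<mu> X) \<partial>P)"
  proof (rule integral_mono_AE)
    show "AE X in P. w \<mu> X \<bullet> logits \<nu> X - w \<mu> X \<bullet> logits \<mu> X \<le> \<Lambda> X (logits \<nu> X) - \<Lambda> X (logits \<mu> X)"
      using AE_C by eventually_elim (metis \<Lambda>_convex inner_diff_right w_def)
  qed (use integral_Phi(2)[OF assms] integral_Phi(2)[OF assms(1,1)] energy_integrable assms in auto)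
  also have "\<dots> = energy \<nu> - energy \<mu>"
    unfolding energy_def using energy_integrable assms by simp
  finally show ?thesis .
qed

end

section \<open>Omega-limit sets in metric spaces\<close>

context Metric_space
begin

text \<open>The formula of \<open>omega_limit_set\<close> over an arbitrary metric space;
  \<open>prob_on K\<close> with \<open>wasserstein1\<close> is the instance used later.\<close>

definition omega_limits :: "(real \<Rightarrow> 'a) \<Rightarrow> 'a set" where
  "omega_limits x = {l\<in>M. \<exists>t :: nat \<Rightarrow> real. (\<forall>n. 0 \<le> t n) \<and> filterlim t at_top sequentially \<and>
     (\<lambda>n. d (x (t n)) l) \<longlonglongrightarrow> 0}"

text \<open>Together with \<open>omega_limitsD\<close> this trades sequences for arbitrarily late
  visits to every ball, a condition that is easy to negate. The visit numbered \<open>n\<close> is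
  chosen later than \<open>n\<close> and within \<open>inverse (Suc n)\<close>.\<close>

lemma omega_limitsI:
  assumes "l \<in> M" "\<And>e T. 0 < e \<Longrightarrow> \<exists>t\<ge>T. 0 \<le> t \<and> d (x t) l < e"
  shows "l \<in> omega_limits x"
proof -
  have "\<forall>n. \<exists>t. real n \<le> t \<and> 0 \<le> t \<and> d (x t) l < inverse (real (Suc n))"
    using assms(2) by (metis inverse_positive_iff_positive of_nat_0_less_iff zero_less_Suc)
  then obtain t where t: "\<And>n. real n \<le> t n" "\<And>n. 0 \<le> t n" "\<And>n. d (x (t n)) l < inverse (real (Suc n))"
    by metis
  have "filterlim t at_top sequentially"
    by (rule filterlim_at_top_mono[OF filterlim_real_sequentially]) (simp add: t)
  moreover have "(\<lambda>n. d (x (t n)) l) \<longlonglongrightarrow> 0"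
    by (rule tendsto_sandwich[OF _ _ tendsto_const LIMSEQ_inverse_real_of_nat])
      (use t(3) in \<open>auto intro: always_eventually less_imp_le\<close>)
  ultimately show ?thesis using assms(1) t(2) by (auto simp: omega_limits_def)
qed

lemma omega_limitsD:
  assumes "l \<in> omega_limits x" "0 < e"
  shows "\<exists>t\<ge>T. 0 \<le> t \<and> d (x t) l < e"
proof -
  obtain t :: "nat \<Rightarrow> real" where t: "\<forall>n. 0 \<le> t n" "filterlim t at_top sequentially" "(\<lambda>n. d (x (t n)) l) \<longlonglongrightarrow> 0"
    using assms(1) by (auto simp: omega_limits_def)
  have "eventually (\<lambda>n. T \<le> t n) sequentially" using t(2) by (simp add: filterlim_at_top)
  moreover have "eventually (\<lambda>n. d (x (t n)) l < e) sequentially"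
    using order_tendstoD(2)[OF t(3) assms(2)] .
  ultimately have "eventually (\<lambda>n. T \<le> t n \<and> d (x (t n)) l < e) sequentially" by (rule eventually_conj)
  then show ?thesis using t(1) eventually_happens'[OF sequentially_bot] by blast
qed

context
  fixes x :: "real \<Rightarrow> 'a"
  assumes x_M: "\<And>t. 0 \<le> t \<Longrightarrow> x t \<in> M"
    and compact_orbit: "compactin mtopology (mtopology closure_of (x ` {0..}))"
begin

lemma orbit_subsequence:
  fixes t :: "nat \<Rightarrow> real"
  assumes "\<And>n. 0 \<le> t n"
  obtains l r where "l \<in> M" "strict_mono r" "(\<lambda>n. d (x (t (r n))) l) \<longlonglongrightarrow> 0"
proof -
  have "x ` {0..} \<subseteq> mtopology closure_of (x ` {0..})"
    by (rule closure_of_subset) (use x_M in auto)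
  then have "range (x \<circ> t) \<subseteq> mtopology closure_of (x ` {0..})"
    using assms by auto
  then obtain l r where "strict_mono r" "limitin mtopology ((x \<circ> t) \<circ> r) l sequentially"
    using compact_orbit unfolding compactin_sequentially by meson
  then show ?thesis using that[of l r] by (simp add: limitin_metric_dist_null)
qed

lemma orbit_omega_subsequence:
  fixes t :: "nat \<Rightarrow> real"
  assumes "\<And>n. 0 \<le> t n" "\<And>n. real n \<le> t n"
  obtains l r where "l \<in> omega_limits x" "strict_mono r" "(\<lambda>n. d (x (t (r n))) l) \<longlonglongrightarrow> 0"
proof -
  obtain l r where lr: "l \<in> M" "strict_mono r" "(\<lambda>n. d (x (t (r n))) l) \<longlonglongrightarrow> 0"
    using orbit_subsequence[of t] assms by metis
  have "filterlim t at_top sequentially"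
    by (rule filterlim_at_top_mono[OF filterlim_real_sequentially]) (simp add: assms)
  then have "filterlim (\<lambda>n. t (r n)) at_top sequentially"
    using filterlim_compose filterlim_subseq[OF lr(2)] by blast
  then have "l \<in> omega_limits x"
    using lr assms unfolding omega_limits_def by (auto intro!: exI[of _ "\<lambda>n. t (r n)"])
  then show ?thesis using that lr by blast
qed

lemma omega_limits_nonempty: "omega_limits x \<noteq> {}"
  using orbit_omega_subsequence[of real] by auto

text \<open>If from some time on the orbit stays at distance \<open>e\<close> from \<open>l\<close>,
  then by the triangle inequality no limit point lies within \<open>e / 2\<close> of
  \<open>l\<close>.\<close>

lemma closedin_omega_limits: "closedin mtopology (omega_limits x)"
  unfolding closedin_metric
proof (intro conjI allI impI)
  show "omega_limits x \<subseteq> M" by (auto simp: omega_limits_def)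
  fix l assume l: "l \<in> M - omega_limits x"
  then obtain e T where e: "0 < e" "\<And>t. T \<le> t \<Longrightarrow> 0 \<le> t \<Longrightarrow> e \<le> d (x t) l"
    using omega_limitsI[of l x] by (metis DiffD1 DiffD2 not_le)
  have "disjnt (omega_limits x) (mball l (e / 2))"
    unfolding disjnt_iff
  proof (intro allI notI)
    fix m assume m: "m \<in> omega_limits x \<and> m \<in> mball l (e / 2)"
    obtain t where t: "T \<le> t" "0 \<le> t" "d (x t) m < e / 2"
      using omega_limitsD[of m x "e / 2" T] m e by auto
    have "d (x t) l \<le> d (x t) m + d m l"
      using m l t x_M by (intro triangle) (auto simp: omega_limits_def)
    also have "\<dots> < e" using t m commute[of m l] by auto
    finally show False using e(2)[OF t(1,2)] by simp
  qed
  then show "\<exists>r>0. disjnt (omega_limits x) (mball l r)" using e by (intro exI[of _ "e / 2"]) auto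
qed

lemma compactin_omega_limits: "compactin mtopology (omega_limits x)"
proof (rule closed_compactin[OF compact_orbit _ closedin_omega_limits])
  show "omega_limits x \<subseteq> mtopology closure_of (x ` {0..})"
  proof
    fix l assume l: "l \<in> omega_limits x"
    then have "l \<in> M" by (simp add: omega_limits_def)
    moreover have "\<exists>y\<in>x ` {0..}. y \<in> mball l r" if "0 < r" for r
      using omega_limitsD[OF l that, of 0] x_M \<open>l \<in> M\<close> by (auto simp: commute)
    ultimately show "l \<in> mtopology closure_of (x ` {0..})" by (simp add: metric_closure_of)
  qed
qed

text \<open>Otherwise some late times keep the orbit at distance \<open>e\<close> from
  \<open>l\<close>, and compactness extracts from them a limit point, which can only be
  \<open>l\<close>.\<close>

lemma orbit_converges:
  assumes "omega_limits x \<subseteq> {l}"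
  shows "((\<lambda>t. d (x t) l) \<longlongrightarrow> 0) at_top"
proof (rule ccontr)
  assume "\<not> ?thesis"
  then obtain e where e: "0 < e" "\<not> eventually (\<lambda>t. d (x t) l < e) at_top"
    by (auto simp: tendsto_iff)
  then have "\<forall>n. \<exists>t\<ge>real n. \<not> d (x t) l < e" by (auto simp: eventually_at_top_linorder)
  then obtain t where t: "\<And>n. real n \<le> t n" "\<And>n. e \<le> d (x (t n)) l" by (metis not_le)
  then have "0 \<le> t n" for n using of_nat_0_le_iff order_trans by blast
  then obtain m r where m: "m \<in> omega_limits x" "(\<lambda>n. d (x (t (r n))) m) \<longlonglongrightarrow> 0"
    using orbit_omega_subsequence[of t] t(1) by metis
  then have "(\<lambda>n. d (x (t (r n))) l) \<longlonglongrightarrow> 0" using assms by auto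
  then have "e \<le> 0" by (rule LIMSEQ_le_const) (use t(2) in auto)
  then show False using e by simp
qed

text \<open>Two disjoint closed pieces of the compact limit set have disjoint open neighbourhoods. A
  tail of the orbit stays in their union and visits both, yet it is connected as a continuous image
  of a half-line.\<close>

lemma connectedin_omega_limits:
  assumes cont: "\<And>s. 0 \<le> s \<Longrightarrow> ((\<lambda>t. d (x t) (x s)) \<longlongrightarrow> 0) (at s within {0..})"
  shows "connectedin mtopology (omega_limits x)"
proof (rule ccontr)
  assume "\<not> ?thesis"
  moreover have sub: "omega_limits x \<subseteq> M" by (auto simp: omega_limits_def)
  ultimately obtain E1 E2 where E: "closedin mtopology E1" "closedin mtopology E2" "omega_limits x \<subseteq> E1 \<union> E2"
    "E1 \<inter> E2 \<inter> omega_limits x = {}" "E1 \<inter> omega_limits x \<noteq> {}" "E2 \<inter> omega_limits x \<noteq> {}"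
    unfolding connectedin_closedin by auto
  have "compactin mtopology (E1 \<inter> omega_limits x)" "compactin mtopology (E2 \<inter> omega_limits x)"
    using E closed_Int_compactin compactin_omega_limits by blast+
  moreover have "disjnt (E1 \<inter> omega_limits x) (E2 \<inter> omega_limits x)"
    using E(4) by (auto simp: disjnt_def)
  ultimately obtain U V where UV: "openin mtopology U" "openin mtopology V"
    "E1 \<inter> omega_limits x \<subseteq> U" "E2 \<inter> omega_limits x \<subseteq> V" "disjnt U V"
    using Hausdorff_space_mtopology unfolding Hausdorff_space_compact_sets by metis
  have hit: "\<exists>t\<ge>T. 0 \<le> t \<and> x t \<in> G" if hyp: "openin mtopology G" "l \<in> G" "l \<in> omega_limits x" for G l T
  proof -
    obtain e where e: "0 < e" "mball l e \<subseteq> G" using hyp(1,2) unfolding openin_mtopology by blast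
    obtain t where t: "T \<le> t" "0 \<le> t" "d (x t) l < e" using omega_limitsD[OF hyp(3) e(1)] by blast
    then have "x t \<in> mball l e" using x_M hyp(3) by (auto simp: omega_limits_def commute)
    then show ?thesis using t e by blast
  qed
  \<comment> \<open>Otherwise arbitrarily late times lie outside \<open>U \<union> V\<close>, and a
    limit point extracted from them belongs to neither set.\<close>
  obtain T where T: "0 \<le> T" "\<And>t. T \<le> t \<Longrightarrow> x t \<in> U \<union> V"
  proof (rule ccontr)
    assume "\<not> thesis"
    then have "\<forall>n. \<exists>t\<ge>real n. x t \<notin> U \<union> V" using that of_nat_0_le_iff by blast
    then obtain t where t: "\<And>n. real n \<le> t n" "\<And>n. x (t n) \<notin> U \<union> V" by metis
    then have "0 \<le> t n" for n using of_nat_0_le_iff order_trans by blast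
    then obtain m r where m: "m \<in> omega_limits x" "(\<lambda>n. d (x (t (r n))) m) \<longlonglongrightarrow> 0"
      using orbit_omega_subsequence[of t] t(1) by metis
    have "m \<in> U \<union> V" using m(1) E(3) UV by blast
    moreover have "openin mtopology (U \<union> V)" using UV by blast
    ultimately obtain e where e: "0 < e" "mball m e \<subseteq> U \<union> V" unfolding openin_mtopology by blast
    obtain n where "d (x (t (r n))) m < e"
      using order_tendstoD(2)[OF m(2) e(1)] eventually_happens'[OF sequentially_bot] by blast
    then have "x (t (r n)) \<in> mball m e"
      using x_M[OF \<open>\<And>n. 0 \<le> t n\<close>] m(1) by (auto simp: omega_limits_def commute)
    then show False using e t by blast
  qed
  have "continuous_map (top_of_set {0..}) mtopology x"
    unfolding continuous_map_to_metric
  proof (intro ballI allI impI)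
    fix s and e :: real assume s: "s \<in> topspace (top_of_set {0::real..})" and e: "0 < e"
    then have s0: "0 \<le> s" by simp
    have "eventually (\<lambda>t. d (x t) (x s) < e) (at s within {0..})"
      using order_tendstoD(2)[OF cont[OF s0] e] .
    then obtain S where S: "open S" "s \<in> S" "\<And>t. t \<in> S \<Longrightarrow> t \<noteq> s \<Longrightarrow> t \<in> {0..} \<Longrightarrow> d (x t) (x s) < e"
      unfolding eventually_at_topological by blast
    have "x t \<in> mball (x s) e" if "t \<in> {0..} \<inter> S" for t
      using S(3)[of t] that x_M s0 e by (cases "t = s") (auto simp: commute)
    then show "\<exists>U. openin (top_of_set {0..}) U \<and> s \<in> U \<and> (\<forall>t\<in>U. x t \<in> mball (x s) e)"
      using S s0 by (intro exI[of _ "{0..} \<inter> S"]) (auto intro: openin_open_Int)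
  qed
  moreover have "connectedin (top_of_set {0..}) {T..}"
    using T(1) by (auto simp: connectedin_subtopology)
  ultimately have "connectedin mtopology (x ` {T..})" by (rule connectedin_continuous_map_image)
  moreover have "U \<inter> x ` {T..} \<noteq> {}" "V \<inter> x ` {T..} \<noteq> {}"
  proof -
    obtain l m where lm: "l \<in> U" "l \<in> omega_limits x" "m \<in> V" "m \<in> omega_limits x"
      using E(5,6) UV(3,4) by blast
    show "U \<inter> x ` {T..} \<noteq> {}" "V \<inter> x ` {T..} \<noteq> {}"
      using hit[OF UV(1) lm(1,2)] hit[OF UV(2) lm(3,4)] by (metis IntI atLeast_iff empty_iff image_eqI)+
  qed
  moreover have "x ` {T..} \<subseteq> U \<union> V" using T by auto
  moreover have "U \<inter> V \<inter> x ` {T..} = {}" using UV(5) by (auto simp: disjnt_def)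
  ultimately show False using UV(1,2) unfolding connectedin by blast
qed

end

text \<open>In a T1 space all subsets of a finite set are closed, so one point and the rest of
  \<open>C\<close> would separate \<open>C\<close>.\<close>

lemma finite_totally_disconnectedin:
  assumes "finite S" "S \<subseteq> M"
  shows "totally_disconnectedin mtopology S"
  unfolding totally_disconnectedin_def
proof (intro conjI allI impI ballI)
  fix C y z assume C: "C \<subseteq> S" "connectedin mtopology C" and yz: "y \<in> C" "z \<in> C"
  have "closedin mtopology F" if "F \<subseteq> C" for F
    using that C assms finite_subset Hausdorff_imp_t1_space[OF Hausdorff_space_mtopology]
    unfolding t1_space_closedin_finite by (metis order_trans topspace_mtopology)
  then have "closedin mtopology {y}" "closedin mtopology (C - {y})" using yz by auto
  then show "y = z" using C(2) yz unfolding connectedin_closedin by blast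
qed (use assms in simp)

end

section \<open>The flow\<close>

locale mean_field_flow = mean_field P C K \<Psi> D D2 W \<Lambda> M L R B
  for P :: "'p::euclidean_space measure" and C and K :: "'a::euclidean_space set"
    and \<Psi> :: "'p \<Rightarrow> 'a \<Rightarrow> 'e::euclidean_space" and D D2 W \<Lambda> M L R B +
  fixes \<zeta> :: "real \<Rightarrow> real" and \<rho> :: "real \<Rightarrow> 'a measure"
  assumes rate: "learning_rate \<zeta>" and solution: "weak_solution K \<zeta> Phi \<rho>"
    and precompact: "compactin (W1_topology K) (W1_topology K closure_of (\<rho> ` {0..}))"
begin

interpretation MS: Metric_space "prob_on K" wasserstein1
  by (rule Metric_space_wasserstein1[OF compact_K])

section \<open>Continuity of the path in time\<close>

lemma \<rho>_prob: "0 \<le> t \<Longrightarrow> \<rho> t \<in> prob_on K"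
  using solution by (simp add: weak_solution_def)

lemma M_pos: "0 \<le> M"
  using M_nonneg[OF \<rho>_prob[of 0]] by simp

text \<open>Narrow continuity speaks of bounded functions. Truncating \<open>g\<close> at its bound
  on \<open>K\<close> makes it bounded and changes no integral.\<close>

lemma integral_continuous:
  fixes g :: "'a \<Rightarrow> real"
  assumes "continuous_on UNIV g"
  shows "continuous_on {0..} (\<lambda>t. \<integral>\<omega>. g \<omega> \<partial>\<rho> t)"
proof -
  have "bounded (g ` K)"
    using compact_continuous_image[OF continuous_on_subset[OF assms] compact_K] compact_imp_bounded by simp
  then obtain c where c: "\<And>x. x \<in> K \<Longrightarrow> \<bar>g x\<bar> \<le> c" by (auto simp: bounded_iff)
  define g' where "g' x = max (- \<bar>c\<bar>) (min \<bar>c\<bar> (g x))" for x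
  have g': "continuous_on UNIV g'" unfolding g'_def by (intro continuous_intros assms)
  moreover have "bounded (range g')"
    unfolding bounded_iff by (intro exI[of _ "\<bar>c\<bar>"]) (auto simp: g'_def)
  ultimately have "continuous_on {0..} (\<lambda>t. \<integral>\<omega>. g' \<omega> \<partial>\<rho> t)"
    using solution by (simp add: weak_solution_def narrowly_continuous_def)
  moreover have "(\<integral>\<omega>. g' \<omega> \<partial>\<rho> t) = (\<integral>\<omega>. g \<omega> \<partial>\<rho> t)" if "t \<in> {0..}" for t
  proof (rule integral_cong_AE)
    have t: "\<rho> t \<in> prob_on K" using that \<rho>_prob by simp
    show "AE \<omega> in \<rho> t. g' \<omega> = g \<omega>"
      using prob_on_AE[OF t compact_K]
    proof eventually_elim
      case (elim \<omega>)
      then show ?case using c[of \<omega>] by (simp add: g'_def)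
    qed
    show "g' \<in> borel_measurable (\<rho> t)" "g \<in> borel_measurable (\<rho> t)"
      using continuous_integrable[OF t g'] continuous_integrable[OF t assms] by auto
  qed
  ultimately show ?thesis by (rule continuous_on_eq)
qed

text \<open>Narrow and \<open>W\<^sub>1\<close> limits agree, so compactness of the orbit upgrades narrow continuity.\<close>

lemma wasserstein1_continuous:
  assumes "0 \<le> s"
  shows "((\<lambda>t. wasserstein1 (\<rho> t) (\<rho> s)) \<longlongrightarrow> 0) (at s within {0..})"
proof (rule ccontr)
  assume "\<not> ?thesis"
  then obtain e where e: "0 < e" "\<not> eventually (\<lambda>t. wasserstein1 (\<rho> t) (\<rho> s) < e) (at s within {0..})"
    using wasserstein1_nonneg by (auto simp: tendsto_iff)
  then have "\<exists>t\<in>{0..}. t \<noteq> s \<and> dist t s < inverse (real (Suc n)) \<and> \<not> wasserstein1 (\<rho> t) (\<rho> s) < e" for n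
    unfolding eventually_at
    by (metis inverse_positive_iff_positive of_nat_0_less_iff zero_less_Suc)
  then obtain t where t: "\<And>n. 0 \<le> t n" "\<And>n. dist (t n) s < inverse (real (Suc n))"
    "\<And>n. e \<le> wasserstein1 (\<rho> (t n)) (\<rho> s)"
    by (metis atLeast_iff not_le)
  have lim: "t \<longlonglongrightarrow> s"
    unfolding tendsto_dist_iff[of t s]
    by (rule tendsto_sandwich[OF _ _ tendsto_const LIMSEQ_inverse_real_of_nat])
      (use t(2) in \<open>auto intro: always_eventually less_imp_le\<close>)
  obtain l r where l: "l \<in> prob_on K" "strict_mono r" "(\<lambda>n. wasserstein1 (\<rho> (t (r n))) l) \<longlonglongrightarrow> 0"
    using MS.orbit_subsequence[of \<rho> t] \<rho>_prob precompact t(1) unfolding W1_topology_def by metis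
  have "l = \<rho> s"
  proof (rule measure_eqI_lipschitz)
    fix h :: "'a \<Rightarrow> real" assume "\<exists>L. L-lipschitz_on UNIV h"
    then obtain L where L: "L-lipschitz_on UNIV h" by blast
    then have hc: "continuous_on UNIV h" by (rule lipschitz_on_continuous_on)
    have lr: "(\<lambda>n. t (r n)) \<longlonglongrightarrow> s" using LIMSEQ_subseq_LIMSEQ[OF lim l(2)] by (simp add: o_def)
    have 1: "(\<lambda>n. \<integral>x. h x \<partial>\<rho> (t (r n))) \<longlonglongrightarrow> (\<integral>x. h x \<partial>\<rho> s)"
      by (rule continuous_on_tendsto_compose[OF integral_continuous[OF hc] lr]) (use assms t in auto)
    have 2: "(\<lambda>n. \<integral>x. h x \<partial>\<rho> (t (r n))) \<longlonglongrightarrow> (\<integral>x. h x \<partial>l)"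
    proof (rule LIM_zero_cancel, rule Lim_null_comparison)
      show "eventually (\<lambda>n. norm ((\<integral>x. h x \<partial>\<rho> (t (r n))) - (\<integral>x. h x \<partial>l)) \<le> L * wasserstein1 (\<rho> (t (r n))) l) sequentially"
        unfolding real_norm_def
        by (intro always_eventually allI wasserstein1_lipschitz[OF compact_K _ l(1)] \<rho>_prob t
          borel_measurable_continuous_onI[OF hc] lipschitz_on_subset[OF L] subset_UNIV)
      show "(\<lambda>n. L * wasserstein1 (\<rho> (t (r n))) l) \<longlonglongrightarrow> 0"
        using tendsto_mult_right_zero[OF l(3)] .
    qed
    show "(\<integral>x. h x \<partial>l) = (\<integral>x. h x \<partial>\<rho> s)" using LIMSEQ_unique[OF 2 1] .
  qed (use prob_onD[OF l(1)] prob_onD[OF \<rho>_prob[OF assms]] in auto)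
  then have "(\<lambda>n. wasserstein1 (\<rho> (t (r n))) (\<rho> s)) \<longlonglongrightarrow> 0" using l by simp
  then have "e \<le> 0" by (rule LIMSEQ_le_const) (use t(3) in auto)
  then show False using e by simp
qed

text \<open>For \<open>v = gradient f\<close> this is the rate of change of the integral of
  \<open>f\<close> along the flow, up to the factor \<open>- 2 * \<zeta> t\<close>.\<close>

definition drift :: "('a \<Rightarrow> 'a) \<Rightarrow> real \<Rightarrow> real" where
  "drift v t = (\<integral>\<omega>. v \<omega> \<bullet> gradient (Phi (\<rho> t)) \<omega> \<partial>\<rho> t)"

lemma bounded_on_K:
  fixes v :: "'a \<Rightarrow> 'b::real_normed_vector"
  assumes "continuous_on UNIV v"
  obtains c where "0 \<le> c" "\<And>x. x \<in> K \<Longrightarrow> norm (v x) \<le> c"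
proof -
  have "bounded (v ` K)"
    using compact_continuous_image[OF continuous_on_subset[OF assms] compact_K] compact_imp_bounded by simp
  then obtain c where "\<forall>x\<in>v ` K. norm x \<le> c" by (auto simp: bounded_iff)
  then show ?thesis by (intro that[of "\<bar>c\<bar>"]) auto
qed

lemma gradient_continuous: "0 \<le> t \<Longrightarrow> continuous_on UNIV (gradient (Phi (\<rho> t)))"
  by (rule Phi_gradient_continuous[OF \<rho>_prob])

text \<open>Both the measure and the potential move. With the potential frozen at \<open>s\<close>,
  as in \<open>J\<close>, narrow continuity settles the matter; the error of freezing is at most a
  multiple of the \<open>W\<^sub>1\<close> distance to \<open>\<rho> s\<close>.\<close>

lemma drift_continuous:
  assumes v: "continuous_on UNIV v"
  shows "continuous_on {0..} (drift v)"
  unfolding continuous_on_def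
proof
  fix s :: real assume "s \<in> {0..}"
  then have s: "0 \<le> s" by simp
  obtain c where c: "0 \<le> c" "\<And>x. x \<in> K \<Longrightarrow> norm (v x) \<le> c" using bounded_on_K[OF v] by blast
  let ?k = "real DIM('a) * (L * (real DIM('a) * B) * B)"
  define J where "J t = (\<integral>\<omega>. v \<omega> \<bullet> gradient (Phi (\<rho> s)) \<omega> \<partial>\<rho> t)" for t
  have Jc: "continuous_on {0..} J"
    unfolding J_def by (intro integral_continuous continuous_intros v gradient_continuous s)
  have Js: "(J \<longlongrightarrow> drift v s) (at s within {0..})"
    using Jc s unfolding continuous_on_def by (simp add: J_def drift_def)
  have "((\<lambda>t. drift v t - J t) \<longlongrightarrow> 0) (at s within {0..})"
  proof (rule Lim_null_comparison)
    show "eventually (\<lambda>t. norm (drift v t - J t) \<le> c * ?k * wasserstein1 (\<rho> t) (\<rho> s)) (at s within {0..})"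
      unfolding eventually_at_filter
    proof (intro always_eventually allI impI)
      fix t :: real assume "t \<in> {0..}"
      then have t: "0 \<le> t" by simp
      have "drift v t - J t = (\<integral>\<omega>. v \<omega> \<bullet> (gradient (Phi (\<rho> t)) \<omega> - gradient (Phi (\<rho> s)) \<omega>) \<partial>\<rho> t)"
        unfolding drift_def J_def inner_diff_right
        by (rule Bochner_Integration.integral_diff[symmetric])
          (intro continuous_integrable[OF \<rho>_prob[OF t]] continuous_intros v gradient_continuous s t)+
      also have "\<bar>\<dots>\<bar> \<le> c * ?k * wasserstein1 (\<rho> t) (\<rho> s)"
      proof (rule integral_bound_K[OF \<rho>_prob[OF t]])
        fix x assume x: "x \<in> K"
        have "norm (v x) * norm (gradient (Phi (\<rho> t)) x - gradient (Phi (\<rho> s)) x)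
            \<le> c * (real DIM('a) * (L * (real DIM('a) * B * wasserstein1 (\<rho> t) (\<rho> s)) * B))"
          using x K_R c(1)
          by (intro mult_mono c(2) Phi_gradient_diff \<rho>_prob close_wasserstein1 s t) auto
        then show "\<bar>v x \<bullet> (gradient (Phi (\<rho> t)) x - gradient (Phi (\<rho> s)) x)\<bar> \<le> c * ?k * wasserstein1 (\<rho> t) (\<rho> s)"
          using Cauchy_Schwarz_ineq2 order_trans by (fastforce simp: mult_ac)
      qed (intro continuous_intros v gradient_continuous s t)
      finally show "norm (drift v t - J t) \<le> c * ?k * wasserstein1 (\<rho> t) (\<rho> s)" by simp
    qed
    show "((\<lambda>t. c * ?k * wasserstein1 (\<rho> t) (\<rho> s)) \<longlongrightarrow> 0) (at s within {0..})"
      using tendsto_mult_right_zero[OF wasserstein1_continuous[OF s]] .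
  qed
  from tendsto_add[OF this Js] show "(drift v \<longlongrightarrow> drift v s) (at s within {0..})" by simp
qed

section \<open>The integrated equation and its clock\<close>

lemma \<zeta>_continuous: "continuous_on {0..} \<zeta>"
  using rate lipschitz_on_continuous_on by (auto simp: learning_rate_def)

lemma \<zeta>_nonneg: "0 \<le> t \<Longrightarrow> 0 \<le> \<zeta> t"
  using rate by (simp add: learning_rate_def)

lemma integrable_Icc:
  fixes f :: "real \<Rightarrow> real"
  assumes "continuous_on {0..} f" "0 \<le> s"
  shows "f integrable_on {s..t}"
  by (intro integrable_continuous_interval continuous_on_subset[OF assms(1)]) (use assms(2) in auto)

text \<open>Continuity of the drift lets the fundamental lemma turn the distributional equation into
  an identity between any two times, time zero included.\<close>

lemma weak_solution_integrated:
  assumes f: "C1_on UNIV f" and st: "0 \<le> s" "s \<le> t"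
  shows "(\<integral>\<omega>. f \<omega> \<partial>\<rho> t) - (\<integral>\<omega>. f \<omega> \<partial>\<rho> s) = - 2 * integral {s..t} (\<lambda>r. \<zeta> r * drift (gradient f) r)"
proof -
  have "(\<integral>\<omega>. f \<omega> \<partial>\<rho> t) - (\<integral>\<omega>. f \<omega> \<partial>\<rho> s) = integral {s..t} (\<lambda>r. - 2 * \<zeta> r * drift (gradient f) r)"
  proof (rule du_Bois_Reymond[OF _ _ _ st])
    show "continuous_on {0..} (\<lambda>t. \<integral>\<omega>. f \<omega> \<partial>\<rho> t)"
      by (rule integral_continuous[OF C1_on_continuous[OF f]])
    show "continuous_on {0..} (\<lambda>r. - 2 * \<zeta> r * drift (gradient f) r)"
      by (intro continuous_intros \<zeta>_continuous drift_continuous C1_on_gradient(2)[OF f])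
    fix \<eta> assume "time_test \<eta>"
    then show "- (LINT t:{0<..}|lborel. deriv \<eta> t * (\<integral>\<omega>. f \<omega> \<partial>\<rho> t))
        = (LINT t:{0<..}|lborel. \<eta> t * (- 2 * \<zeta> t * drift (gradient f) t))"
      using solution f unfolding weak_solution_def drift_def by blast
  qed
  also have "\<dots> = integral {s..t} (\<lambda>r. - 2 * (\<zeta> r * drift (gradient f) r))" by (simp add: mult.assoc)
  also have "\<dots> = - 2 * integral {s..t} (\<lambda>r. \<zeta> r * drift (gradient f) r)"
    by (rule integral_mult_right)
  finally show ?thesis .
qed

definition Z :: "real \<Rightarrow> real" where "Z t = integral {0..t} \<zeta>"

lemma Z_diff: "0 \<le> s \<Longrightarrow> s \<le> t \<Longrightarrow> integral {s..t} \<zeta> = Z t - Z s"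
  unfolding Z_def
  using Henstock_Kurzweil_Integration.integral_combine[of 0 s t \<zeta>] integrable_Icc[OF \<zeta>_continuous] by simp

lemma Z_mono: "0 \<le> s \<Longrightarrow> s \<le> t \<Longrightarrow> Z s \<le> Z t"
  using Z_diff[of s t] integral_nonneg[OF integrable_Icc[OF \<zeta>_continuous, of s t]] \<zeta>_nonneg by fastforce

lemma Z_continuous: "continuous_on {0..} Z"
  unfolding Z_def[abs_def] by (rule continuous_on_indefinite_integral[OF \<zeta>_continuous])

lemma integral_\<zeta>_bound:
  assumes st: "0 \<le> s" "s \<le> t" and J: "continuous_on {0..} J"
    and c: "\<And>r. s \<le> r \<Longrightarrow> r \<le> t \<Longrightarrow> \<bar>J r\<bar> \<le> c"
  shows "\<bar>integral {s..t} (\<lambda>r. \<zeta> r * J r)\<bar> \<le> c * (Z t - Z s)"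
proof -
  have "norm (integral {s..t} (\<lambda>r. \<zeta> r * J r)) \<le> integral {s..t} (\<lambda>r. c * \<zeta> r)"
  proof (rule integral_norm_bound_integral)
    fix r assume r: "r \<in> {s..t}"
    then have "\<zeta> r * \<bar>J r\<bar> \<le> \<zeta> r * c" using st by (intro mult_left_mono c \<zeta>_nonneg) auto
    then show "norm (\<zeta> r * J r) \<le> c * \<zeta> r" using r st \<zeta>_nonneg[of r] by (simp add: abs_mult mult.commute)
  qed (intro integrable_Icc continuous_intros \<zeta>_continuous J st(1))+
  then show ?thesis using Z_diff[OF st] by simp
qed

text \<open>The factor 2 of the equation times the bound on the gradient of the potential: the
  largest velocity per unit of the clock \<open>Z\<close>.\<close>

definition speed :: real where "speed = 2 * (real DIM('a) * (M * B))"

lemma speed_nonneg: "0 \<le> speed"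
  unfolding speed_def using M_pos B_nonneg by simp

text \<open>The integrated equation is tested with \<open>h\<close>: along the flow its integral
  changes at most at \<open>G\<close> times the maximal velocity. The result is phrased with
  \<open>close\<close> because the equation controls test functions, whereas
  \<open>wasserstein1\<close> is defined through couplings.\<close>

lemma flow_close:
  assumes st: "0 \<le> s" "s \<le> t"
  shows "close (\<rho> t) (\<rho> s) (speed * (Z t - Z s))"
  unfolding close_def
proof (intro allI impI)
  fix h :: "'a \<Rightarrow> real" and G assume h: "C1_on UNIV h" "0 \<le> G" "\<forall>x\<in>cball 0 R. norm (gradient h x) \<le> G"
  have "\<bar>integral {s..t} (\<lambda>r. \<zeta> r * drift (gradient h) r)\<bar> \<le> G * (real DIM('a) * (M * B)) * (Z t - Z s)"
  proof (rule integral_\<zeta>_bound[OF st drift_continuous[OF C1_on_gradient(2)[OF h(1)]]])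
    fix r assume "s \<le> r" "r \<le> t"
    then have r: "0 \<le> r" using st by simp
    show "\<bar>drift (gradient h) r\<bar> \<le> G * (real DIM('a) * (M * B))"
      unfolding drift_def
    proof (rule integral_bound_K[OF \<rho>_prob[OF r]])
      fix x assume "x \<in> K"
      then have x: "x \<in> cball 0 R" using K_R by blast
      have "norm (gradient h x) * norm (gradient (Phi (\<rho> r)) x) \<le> G * (real DIM('a) * (M * B))"
        using x h by (intro mult_mono Phi_gradient_bound \<rho>_prob r) auto
      then show "\<bar>gradient h x \<bullet> gradient (Phi (\<rho> r)) x\<bar> \<le> G * (real DIM('a) * (M * B))"
        using Cauchy_Schwarz_ineq2 order_trans by blast
    qed (intro continuous_intros C1_on_gradient(2)[OF h(1)] gradient_continuous r)
  qed
  moreover have "G * (speed * (Z t - Z s)) = 2 * (G * (real DIM('a) * (M * B)) * (Z t - Z s))"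
    unfolding speed_def by (simp only: mult_ac)
  ultimately show "\<bar>(\<integral>\<omega>. h \<omega> \<partial>\<rho> t) - (\<integral>\<omega>. h \<omega> \<partial>\<rho> s)\<bar> \<le> G * (speed * (Z t - Z s))"
    unfolding weak_solution_integrated[OF h(1) st] by (simp only: abs_mult)
qed

section \<open>Dissipation along the flow and the energy identity\<close>

definition I :: "real \<Rightarrow> real" where "I t = dissipation Phi (\<rho> t)"

lemma I_nonneg: "0 \<le> I t"
  unfolding I_def by (rule dissipation_nonneg)

lemma I_diff:
  assumes "0 \<le> s" "s \<le> t"
  shows "\<bar>I t - I s\<bar> \<le> dissipation_const * speed * (Z t - Z s)"
  unfolding I_def using dissipation_diff[OF _ _ flow_close[OF assms]] \<rho>_prob assms by (simp add: mult.assoc)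

lemma I_drift: "I t = drift (gradient (Phi (\<rho> t))) t"
  by (simp add: I_def dissipation_def drift_def power2_norm_eq_inner)

lemma const_nonneg: "0 \<le> dissipation_const"
  using dissipation_const_nonneg[OF \<rho>_prob[of 0]] by simp

lemma I_continuous: "continuous_on {0..} I"
  unfolding continuous_on_def
proof
  fix s :: real assume "s \<in> {0..}"
  then have s: "0 \<le> s" by simp
  have "((\<lambda>t. I t - I s) \<longlongrightarrow> 0) (at s within {0..})"
  proof (rule Lim_null_comparison)
    show "eventually (\<lambda>t. norm (I t - I s) \<le> dissipation_const * wasserstein1 (\<rho> t) (\<rho> s)) (at s within {0..})"
      unfolding eventually_at_filter I_def using s
      by (intro always_eventually allI impI)
        (simp add: dissipation_diff[OF \<rho>_prob \<rho>_prob close_wasserstein1[OF \<rho>_prob \<rho>_prob]])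
    show "((\<lambda>t. dissipation_const * wasserstein1 (\<rho> t) (\<rho> s)) \<longlongrightarrow> 0) (at s within {0..})"
      using tendsto_mult_right_zero[OF wasserstein1_continuous[OF s]] .
  qed
  then show "(I \<longlongrightarrow> I s) (at s within {0..})" by (rule LIM_zero_cancel)
qed

definition A :: "real \<Rightarrow> real" where "A t = integral {0..t} (\<lambda>r. \<zeta> r * I r)"

lemma A_diff: "0 \<le> s \<Longrightarrow> s \<le> t \<Longrightarrow> integral {s..t} (\<lambda>r. \<zeta> r * I r) = A t - A s"
  unfolding A_def
  using Henstock_Kurzweil_Integration.integral_combine[of 0 s t "\<lambda>r. \<zeta> r * I r"]
    integrable_Icc[OF continuous_on_mult[OF \<zeta>_continuous I_continuous]] by simp

lemma A_mono: "0 \<le> s \<Longrightarrow> s \<le> t \<Longrightarrow> A s \<le> A t"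
  using A_diff[of s t] integral_nonneg[OF integrable_Icc[OF continuous_on_mult[OF \<zeta>_continuous I_continuous], of s t]]
    \<zeta>_nonneg I_nonneg by fastforce

text \<open>The factor 2 of the equation, the bound of \<open>Phi_gradient_diff\<close> for measures
  at distance \<open>speed\<close>, and the bound on the gradient it is paired with.\<close>

definition energy_const :: real where
  "energy_const = 2 * ((real DIM('a) * (L * (real DIM('a) * B * speed) * B)) * (real DIM('a) * (M * B)))"

text \<open>Freezing the potential at either end of a time interval costs an error of second order
  in the elapsed learning rate.\<close>

lemma Phi_increment:
  assumes st: "0 \<le> s" "s \<le> t" and u: "u = s \<or> u = t"
  shows "\<bar>(\<integral>\<omega>. Phi (\<rho> u) \<omega> \<partial>\<rho> t) - (\<integral>\<omega>. Phi (\<rho> u) \<omega> \<partial>\<rho> s) + 2 * (A t - A s)\<bar> \<le> energy_const * (Z t - Z s)\<^sup>2"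
proof -
  have u0: "0 \<le> u" using st u by auto
  let ?v = "gradient (Phi (\<rho> u))"
  let ?k = "real DIM('a) * (L * (real DIM('a) * B * speed) * B)" and ?m = "real DIM('a) * (M * B)"
  have vc: "continuous_on UNIV ?v" by (rule gradient_continuous[OF u0])
  have "\<bar>integral {s..t} (\<lambda>r. \<zeta> r * (drift ?v r - I r))\<bar> \<le> ?k * (Z t - Z s) * ?m * (Z t - Z s)"
  proof (rule integral_\<zeta>_bound[OF st])
    fix r assume r: "s \<le> r" "r \<le> t"
    then have r0: "0 \<le> r" using st by simp
    \<comment> \<open>Whichever end the potential is frozen at, on the clock it is at most
      \<open>Z t - Z s\<close> away from any intermediate time.\<close>
    have cl: "close (\<rho> u) (\<rho> r) (speed * (Z t - Z s))"
    proof -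
      have "close (\<rho> u) (\<rho> r) (speed * \<bar>Z u - Z r\<bar>)"
        using u
      proof
        assume "u = s"
        then show ?thesis
          using close_commute[OF flow_close[of s r]] r st Z_mono[of s r] by (simp add: abs_minus_commute)
      next
        assume "u = t"
        then show ?thesis using flow_close[of r t] r r0 Z_mono[of r t] by simp
      qed
      moreover have "\<bar>Z u - Z r\<bar> \<le> Z t - Z s"
        using u r st r0 Z_mono[of s r] Z_mono[of r t] by auto
      ultimately show ?thesis
        unfolding close_def using speed_nonneg by (meson mult_left_mono order_trans)
    qed
    have "drift ?v r - I r = (\<integral>\<omega>. (?v \<omega> - gradient (Phi (\<rho> r)) \<omega>) \<bullet> gradient (Phi (\<rho> r)) \<omega> \<partial>\<rho> r)"
      unfolding I_drift drift_def inner_diff_left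
      by (rule Bochner_Integration.integral_diff[symmetric])
        (intro continuous_integrable[OF \<rho>_prob[OF r0]] continuous_intros vc gradient_continuous r0)+
    also have "\<bar>\<dots>\<bar> \<le> ?k * (Z t - Z s) * ?m"
    proof (rule integral_bound_K[OF \<rho>_prob[OF r0]])
      fix x assume "x \<in> K"
      then have x: "x \<in> cball 0 R" using K_R by blast
      have "norm (?v x - gradient (Phi (\<rho> r)) x) \<le> ?k * (Z t - Z s)"
        using Phi_gradient_diff[OF \<rho>_prob[OF u0] \<rho>_prob[OF r0] cl x] by (simp add: mult_ac)
      then have "norm (?v x - gradient (Phi (\<rho> r)) x) * norm (gradient (Phi (\<rho> r)) x) \<le> ?k * (Z t - Z s) * ?m"
        by (intro mult_mono' Phi_gradient_bound[OF \<rho>_prob[OF r0] x]) auto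
      then show "\<bar>(?v x - gradient (Phi (\<rho> r)) x) \<bullet> gradient (Phi (\<rho> r)) x\<bar> \<le> ?k * (Z t - Z s) * ?m"
        using Cauchy_Schwarz_ineq2 order_trans by blast
    qed (intro continuous_intros vc gradient_continuous r0)
    finally show "\<bar>drift ?v r - I r\<bar> \<le> ?k * (Z t - Z s) * ?m" .
  qed (intro continuous_intros drift_continuous vc I_continuous)
  moreover have "integral {s..t} (\<lambda>r. \<zeta> r * (drift ?v r - I r))
      = integral {s..t} (\<lambda>r. \<zeta> r * drift ?v r) - (A t - A s)"
    unfolding right_diff_distrib A_diff[OF st, symmetric]
    by (intro Henstock_Kurzweil_Integration.integral_diff integrable_Icc continuous_intros \<zeta>_continuous drift_continuous vc I_continuous st(1))
  moreover have "energy_const * (Z t - Z s)\<^sup>2 = 2 * (?k * (Z t - Z s) * ?m * (Z t - Z s))"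
    by (simp add: energy_const_def power2_eq_square mult_ac)
  ultimately have bd: "2 * \<bar>integral {s..t} (\<lambda>r. \<zeta> r * drift ?v r) - (A t - A s)\<bar> \<le> energy_const * (Z t - Z s)\<^sup>2"
    by simp
  have two: "\<bar>- 2 * x + 2 * y\<bar> = 2 * \<bar>x - y\<bar>" for x y :: real
    by (simp add: abs_if)
  show ?thesis
    unfolding weak_solution_integrated[OF Phi_C1[OF \<rho>_prob[OF u0]] st] two by (rule bd)
qed

lemma energy_increment:
  assumes st: "0 \<le> s" "s \<le> t"
  shows "\<bar>(energy (\<rho> t) + 2 * A t) - (energy (\<rho> s) + 2 * A s)\<bar> \<le> energy_const * (Z t - Z s)\<^sup>2"
proof -
  have p: "\<rho> s \<in> prob_on K" "\<rho> t \<in> prob_on K" using \<rho>_prob st by auto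
  show ?thesis
    using Phi_increment[OF st disjI1[OF refl]] Phi_increment[OF st disjI2[OF refl]] energy_convex[OF p] energy_convex[OF p(2,1)]
    by (auto simp: abs_le_iff)
qed

lemma Z_lipschitz: obtains c where "0 \<le> c" "\<And>s t. 0 \<le> s \<Longrightarrow> s \<le> t \<Longrightarrow> Z t - Z s \<le> c * (t - s)"
proof -
  obtain c where "\<forall>x\<in>\<zeta> ` {0..}. norm x \<le> c"
    using rate unfolding learning_rate_def bounded_iff by blast
  then have c: "\<And>t. 0 \<le> t \<Longrightarrow> \<bar>\<zeta> t\<bar> \<le> c" by auto
  have "Z t - Z s \<le> c * (t - s)" if "0 \<le> s" "s \<le> t" for s t
  proof -
    have "integral {s..t} \<zeta> \<le> integral {s..t} (\<lambda>_. c)"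
      using that by (intro integral_le integrable_Icc \<zeta>_continuous) (auto intro: order_trans[OF abs_ge_self c])
    then show ?thesis using Z_diff[OF that] that by (simp add: mult.commute)
  qed
  moreover have "0 \<le> c" using c[of 0] by simp
  ultimately show ?thesis using that by blast
qed

lemma energy_const_nonneg: "0 \<le> energy_const"
  unfolding energy_const_def using M_pos B_nonneg L_nonneg speed_nonneg by simp

text \<open>Boundedness of the rate turns an error quadratic in the clock into one quadratic in
  time. A function with quadratically small increments has derivative zero and is constant.\<close>

lemma energy_identity:
  assumes "0 \<le> t"
  shows "energy (\<rho> t) + 2 * A t = energy (\<rho> 0)"
proof -
  let ?V = "\<lambda>t. energy (\<rho> t) + 2 * A t"
  obtain c where c: "0 \<le> c" "\<And>s t. 0 \<le> s \<Longrightarrow> s \<le> t \<Longrightarrow> Z t - Z s \<le> c * (t - s)" using Z_lipschitz by blast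
  let ?k = "energy_const * c\<^sup>2"
  have ord: "\<bar>?V t - ?V s\<bar> \<le> ?k * (t - s)\<^sup>2" if "0 \<le> s" "s \<le> t" for s t
  proof -
    have "(Z t - Z s)\<^sup>2 \<le> (c * (t - s))\<^sup>2" using c(2)[OF that] Z_mono[OF that] by (intro power_mono) auto
    then have "energy_const * (Z t - Z s)\<^sup>2 \<le> ?k * (t - s)\<^sup>2"
      using mult_left_mono[OF _ energy_const_nonneg] by (simp add: power_mult_distrib mult.assoc)
    then show ?thesis using energy_increment[OF that] by linarith
  qed
  have quad: "\<bar>?V t - ?V s\<bar> \<le> ?k * (t - s)\<^sup>2" if "0 \<le> s" "0 \<le> t" for s t
    using ord[of s t] ord[of t s] that by (cases "s \<le> t") (auto simp: abs_minus_commute power2_commute)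
  have "?V t = ?V 0"
  proof (rule has_field_derivative_zero_constant[of "{0..}", THEN exE])
    fix s :: real assume "s \<in> {0..}"
    then have s: "0 \<le> s" by simp
    have "((\<lambda>t. (?V t - ?V s) / (t - s)) \<longlongrightarrow> 0) (at s within {0..})"
    proof (rule Lim_null_comparison)
      show "eventually (\<lambda>t. norm ((?V t - ?V s) / (t - s)) \<le> ?k * \<bar>t - s\<bar>) (at s within {0..})"
        unfolding eventually_at_filter
      proof (intro always_eventually allI impI)
        fix t :: real assume "t \<noteq> s" "t \<in> {0..}"
        then have "\<bar>?V t - ?V s\<bar> \<le> ?k * \<bar>t - s\<bar> * \<bar>t - s\<bar>" "0 < \<bar>t - s\<bar>"
          using quad[OF s, of t] by (auto simp: power2_eq_square mult.assoc simp flip: abs_mult)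
        then show "norm ((?V t - ?V s) / (t - s)) \<le> ?k * \<bar>t - s\<bar>"
          by (simp only: real_norm_def abs_divide) (simp add: pos_divide_le_eq)
      qed
      have "((\<lambda>t. ?k * \<bar>t - s\<bar>) \<longlongrightarrow> ?k * \<bar>s - s\<bar>) (at s within {0..})"
        by (intro tendsto_intros)
      then show "((\<lambda>t. ?k * \<bar>t - s\<bar>) \<longlongrightarrow> 0) (at s within {0..})" by simp
    qed
    then show "(?V has_field_derivative 0) (at s within {0..})" by (simp add: has_field_derivative_iff)
  next
    fix v assume "\<forall>t\<in>{0..}. ?V t = v"
    then show ?thesis using assms by simp
  qed simp
  then show ?thesis by (simp add: A_def)
qed

section \<open>Convergence of the energy and decay of the dissipation\<close>

lemma A_converges: "\<exists>a. (A \<longlongrightarrow> a) at_top \<and> (\<forall>t\<ge>0. A t \<le> a)"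
proof -
  \<comment> \<open>The energy is nonnegative, so the identity leaves at most half the initial
    energy for \<open>A\<close>.\<close>
  have bd: "A t \<le> energy (\<rho> 0) / 2" if "0 \<le> t" for t
    using energy_identity[OF that] energy_nonneg[of "\<rho> t"] by simp
  define a where "a = (SUP t\<in>{0..}. A t)"
  have bdd: "bdd_above (A ` {0..})" by (rule bdd_aboveI2[where M = "energy (\<rho> 0) / 2"]) (use bd in simp)
  have up: "A t \<le> a" if "0 \<le> t" for t unfolding a_def by (rule cSUP_upper[OF _ bdd]) (use that in simp)
  have "(A \<longlongrightarrow> a) at_top"
  proof (rule order_tendstoI)
    fix y assume "y < a"
    then obtain s where s: "0 \<le> s" "y < A s"
      using less_cSUP_iff[of "{0::real..}" A y] bdd unfolding a_def by auto
    show "eventually (\<lambda>t. y < A t) at_top"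
      using eventually_ge_at_top[of s] by eventually_elim (use s A_mono[of s] in \<open>auto intro: less_le_trans\<close>)
  next
    fix y assume y: "a < y"
    show "eventually (\<lambda>t. A t < y) at_top"
      using eventually_ge_at_top[of "0::real"] by eventually_elim (use up y in \<open>auto intro: le_less_trans\<close>)
  qed
  then show ?thesis using up by blast
qed

lemma energy_converges: "\<exists>E. ((\<lambda>t. energy (\<rho> t)) \<longlongrightarrow> E) at_top"
proof -
  obtain a where a: "(A \<longlongrightarrow> a) at_top" using A_converges by blast
  have "((\<lambda>t. energy (\<rho> 0) - 2 * A t) \<longlongrightarrow> energy (\<rho> 0) - 2 * a) at_top"
    by (intro tendsto_intros a)
  moreover have "eventually (\<lambda>t. energy (\<rho> 0) - 2 * A t = energy (\<rho> t)) at_top"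
    using eventually_ge_at_top[of "0::real"]
  proof eventually_elim
    case (elim t)
    then show ?case using energy_identity[of t] by simp
  qed
  ultimately have "((\<lambda>t. energy (\<rho> t)) \<longlongrightarrow> energy (\<rho> 0) - 2 * a) at_top"
    by (rule Lim_transform_eventually)
  then show ?thesis by (rule exI)
qed

text \<open>Divergence is assumed for a Lebesgue integral over the half-line. By monotone
  convergence along the intervals \<open>{0..real n}\<close>, a bound on \<open>Z\<close> would
  bound that integral as well.\<close>

lemma Z_unbounded: "\<exists>t\<ge>0. c \<le> Z t"
proof (rule ccontr)
  assume "\<not> ?thesis"
  then have Zc: "\<And>t. 0 \<le> t \<Longrightarrow> Z t \<le> c" by (meson less_imp_le not_le)
  define f where "f n t = ennreal (\<zeta> t) * indicator {0..real n} t" for n t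
  have f_eq: "f n t = ennreal (\<zeta> t * indicator {0..real n} t)" for n t
    by (auto simp: f_def indicator_def)
  have m: "(\<lambda>t. \<zeta> t * indicator {0..real n} t) \<in> borel_measurable borel" for n
    using borel_measurable_continuous_on_indicator[of "{0..real n}" \<zeta>] continuous_on_subset[OF \<zeta>_continuous, of "{0..real n}"]
    by (simp add: mult.commute)
  then have fm: "f n \<in> borel_measurable lborel" for n
    unfolding f_eq[abs_def] by simp
  have f: "(\<integral>\<^sup>+t. f n t \<partial>lborel) \<le> ennreal c" for n
  proof -
    have "(\<zeta> has_integral Z (real n)) {0..real n}"
      unfolding Z_def by (intro integrable_integral integrable_Icc \<zeta>_continuous) simp
    moreover have "(\<lambda>t. \<zeta> t * indicator {0..real n} t) = (\<lambda>t. if t \<in> {0..real n} then \<zeta> t else 0)"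
      by (auto simp: indicator_def)
    ultimately have "((\<lambda>t. \<zeta> t * indicator {0..real n} t) has_integral Z (real n)) UNIV"
      using has_integral_restrict_UNIV by metis
    then have "(\<integral>\<^sup>+t. f n t \<partial>lborel) = ennreal (Z (real n))"
      unfolding f_eq using m by (intro nn_integral_has_integral_lborel) (auto simp: indicator_def \<zeta>_nonneg)
    then show ?thesis using Zc[of "real n"] by (simp add: ennreal_leI)
  qed
  have "incseq f"
    by (auto simp: incseq_def le_fun_def f_def indicator_def)
  have sup: "(SUP n. f n t) = ennreal (\<zeta> t) * indicator {0..} t" for t
  proof (rule antisym)
    show "(SUP n. f n t) \<le> ennreal (\<zeta> t) * indicator {0..} t"
      by (rule SUP_least) (auto simp: f_def indicator_def)
    obtain n where "t \<le> real n" using real_arch_simple by blast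
    then have "ennreal (\<zeta> t) * indicator {0..} t = f n t" by (auto simp: f_def indicator_def)
    then show "ennreal (\<zeta> t) * indicator {0..} t \<le> (SUP n. f n t)" by (metis SUP_upper UNIV_I)
  qed
  have "(\<integral>\<^sup>+t\<in>{0..}. ennreal (\<zeta> t) \<partial>lborel) = (SUP n. \<integral>\<^sup>+t. f n t \<partial>lborel)"
    unfolding sup[symmetric] by (rule nn_integral_monotone_convergence_SUP[OF \<open>incseq f\<close> fm])
  also have "\<dots> \<le> ennreal c" by (rule SUP_least) (rule f)
  finally show False using rate by (simp add: learning_rate_def top_unique)
qed

text \<open>While the elapsed learning rate after \<open>t\<close> stays below \<open>I t / (2 k)\<close>, the dissipation stays above \<open>I t / 2\<close>.\<close>

lemma I_tendsto_0: "(I \<longlongrightarrow> 0) at_top"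
proof -
  obtain a where a: "(A \<longlongrightarrow> a) at_top" "\<And>t. 0 \<le> t \<Longrightarrow> A t \<le> a" using A_converges by blast
  define k where "k = dissipation_const * speed + 1"
  have k: "0 < k" using const_nonneg speed_nonneg by (simp add: k_def add_nonneg_pos)
  have sq: "(I t)\<^sup>2 \<le> 4 * k * (a - A t)" if t: "0 \<le> t" for t
  proof -
    let ?y = "Z t + I t / (2 * k)"
    \<comment> \<open>The extra \<open>1\<close> makes \<open>Z T\<close> strictly larger than
      \<open>Z t\<close> even when \<open>I t = 0\<close>, so that \<open>T\<close> cannot precede
      \<open>t\<close>.\<close>
    obtain T where T: "0 \<le> T" "?y + 1 \<le> Z T" using Z_unbounded by blast
    have y: "Z t \<le> ?y" using I_nonneg[of t] k by simp
    have "t \<le> T"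
    proof (rule ccontr)
      assume "\<not> t \<le> T"
      then have "Z T \<le> Z t" using T(1) by (intro Z_mono) auto
      then show False using T(2) y by linarith
    qed
    moreover have "?y \<le> Z T" using T(2) by linarith
    moreover have "continuous_on {t..T} Z"
      by (rule continuous_on_subset[OF Z_continuous]) (use t in auto)
    ultimately obtain t' where t': "t \<le> t'" "t' \<le> T" "Z t' = ?y"
      using IVT'[of Z t ?y T] y by blast
    have low: "I t / 2 \<le> I r" if r: "t \<le> r" "r \<le> t'" for r
    proof -
      have 1: "Z r - Z t \<le> I t / (2 * k)" using Z_mono[of r t'] r t t'(3) by simp
      have 2: "0 \<le> Z r - Z t" using Z_mono[of t r] t r by simp
      have "\<bar>I r - I t\<bar> \<le> dissipation_const * speed * (Z r - Z t)" by (rule I_diff[OF t r(1)])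
      also have "\<dots> \<le> k * (Z r - Z t)" using 2 by (intro mult_right_mono) (simp_all add: k_def)
      also have "\<dots> \<le> k * (I t / (2 * k))" using 1 k by (intro mult_left_mono) simp_all
      finally have "\<bar>I r - I t\<bar> \<le> k * (I t / (2 * k))" .
      then have "\<bar>I r - I t\<bar> \<le> I t / 2" using k by simp
      then show ?thesis by linarith
    qed
    \<comment> \<open>Dissipation of at least \<open>I t / 2\<close> over a clock length of
      \<open>I t / (2 * k)\<close> uses up a multiple of the square of \<open>I t\<close>; what
      remains to be spent after \<open>t\<close> is at most \<open>a - A t\<close>.\<close>
    have "I t / 2 * (Z t' - Z t) = integral {t..t'} (\<lambda>r. I t / 2 * \<zeta> r)"
      using Z_diff[OF t t'(1)] by simp
    also have "\<dots> \<le> integral {t..t'} (\<lambda>r. \<zeta> r * I r)"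
    proof (rule integral_le)
      fix r assume "r \<in> {t..t'}"
      then show "I t / 2 * \<zeta> r \<le> \<zeta> r * I r"
        using mult_right_mono[OF low, of r "\<zeta> r"] \<zeta>_nonneg[of r] t by (simp add: mult.commute)
    qed (intro integrable_Icc continuous_intros \<zeta>_continuous I_continuous t)+
    also have "\<dots> = A t' - A t" by (rule A_diff[OF t t'(1)])
    also have "\<dots> \<le> a - A t" using a(2)[of t'] t t'(1) by simp
    finally have le: "I t / 2 * (I t / (2 * k)) \<le> a - A t" using t'(3) by simp
    have "(I t)\<^sup>2 = 4 * k * (I t / 2 * (I t / (2 * k)))" using k by (simp add: power2_eq_square)
    also have "\<dots> \<le> 4 * k * (a - A t)" using k by (intro mult_left_mono le) simp
    finally show ?thesis .
  qed
  have "((\<lambda>t. (I t)\<^sup>2) \<longlongrightarrow> 0) at_top"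
  proof (rule Lim_null_comparison)
    show "eventually (\<lambda>t. norm ((I t)\<^sup>2) \<le> 4 * k * (a - A t)) at_top"
      using eventually_ge_at_top[of "0::real"] by eventually_elim (simp add: sq)
    have "((\<lambda>t. 4 * k * (a - A t)) \<longlongrightarrow> 4 * k * (a - a)) at_top" by (intro tendsto_intros a)
    then show "((\<lambda>t. 4 * k * (a - A t)) \<longlongrightarrow> 0) at_top" by simp
  qed
  from tendsto_real_sqrt[OF this] show ?thesis using I_nonneg by simp
qed

section \<open>Limit points and the abstract theorem\<close>

lemma stationary:
  assumes "\<mu> \<in> prob_on K" "dissipation Phi \<mu> = 0"
  shows "\<mu> \<in> stationary_solutions K \<zeta> Phi"
proof -
  let ?g = "gradient (Phi \<mu>)"
  have gc: "continuous_on UNIV (\<lambda>\<omega>. (norm (?g \<omega>))\<^sup>2)"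
    by (intro continuous_intros Phi_gradient_continuous[OF assms(1)])
  have "AE \<omega> in \<mu>. (norm (?g \<omega>))\<^sup>2 = 0"
    using assms(2) unfolding dissipation_def
    by (subst (asm) integral_nonneg_eq_0_iff_AE[OF continuous_integrable[OF assms(1) gc]]) auto
  then have g0: "AE \<omega> in \<mu>. ?g \<omega> = 0" by simp
  have drift0: "(\<integral>\<omega>. v \<omega> \<bullet> ?g \<omega> \<partial>\<mu>) = 0" for v
    by (rule integral_eq_zero_AE) (use g0 in eventually_elim, simp)
  \<comment> \<open>For a constant curve the left side is a constant times the integral of the
    derivative of a compactly supported function.\<close>
  have test: "(LINT t:{0<..}|lborel. deriv \<eta> t * c) = 0" if \<eta>: "time_test \<eta>" for \<eta> c
  proof -
    obtain a b where ab: "0 < a" "a < b" "\<And>t. t \<notin> {a..b} \<Longrightarrow> \<eta> t = 0"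
      using \<eta> unfolding time_test_def by blast
    have d: "(\<eta> has_real_derivative deriv \<eta> t) (at t)" for t
      using \<eta>[unfolded time_test_def, THEN conjunct1, rule_format, of 0 t]
      by (simp add: DERIV_deriv_iff_real_differentiable)
    have dc: "continuous_on A (deriv \<eta>)" for A
      using \<eta>[unfolded time_test_def, THEN conjunct1, rule_format, of 1]
      by (intro continuous_at_imp_continuous_on ballI differentiable_imp_continuous_within) simp
    have d0: "deriv \<eta> t = 0" if "t \<notin> {a..b}" for t
    proof (rule DERIV_imp_deriv)
      have "open (- {a..b})" by auto
      then show "(\<eta> has_real_derivative 0) (at t)"
        by (rule has_field_derivative_transform_within_open[where f = "\<lambda>_. 0", rotated 1])
          (use ab that in auto)
    qed
    \<comment> \<open>The interval ends at \<open>b + 1\<close>, since \<open>time_test\<close>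
      states the vanishing of \<open>\<eta>\<close> only strictly beyond \<open>b\<close>.\<close>
    have "(LINT t:{0<..}|lborel. deriv \<eta> t * c) = integral {0..b + 1} (\<lambda>t. deriv \<eta> t * c)"
      by (rule set_lebesgue_integral_compact_support[OF ab(1)]) (intro continuous_intros dc, use d0 in auto)
    moreover have "((\<lambda>t. deriv \<eta> t * c) has_integral \<eta> (b + 1) * c - \<eta> 0 * c) {0..b + 1}"
    proof (rule fundamental_theorem_of_calculus)
      show "((\<lambda>t. \<eta> t * c) has_vector_derivative deriv \<eta> t * c) (at t within {0..b + 1})" for t
        unfolding has_real_derivative_iff_has_vector_derivative[symmetric]
        by (rule DERIV_cmult_right[OF has_field_derivative_at_within[OF d]])
    qed (use ab in simp)
    ultimately have "(LINT t:{0<..}|lborel. deriv \<eta> t * c) = \<eta> (b + 1) * c - \<eta> 0 * c"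
      by (simp only: integral_unique)
    then show ?thesis using ab(1,3) by simp
  qed
  have weak: "- (LINT t:{0<..}|lborel. deriv \<eta> t * (\<integral>\<omega>. f \<omega> \<partial>\<mu>)) =
      (LINT t:{0<..}|lborel. \<eta> t * (- 2 * \<zeta> t * (\<integral>\<omega>. gradient f \<omega> \<bullet> ?g \<omega> \<partial>\<mu>)))" if "time_test \<eta>" for f \<eta>
    unfolding test[OF that] drift0 by simp
  show ?thesis
    unfolding stationary_solutions_def weak_solution_def narrowly_continuous_def
    by (intro CollectI conjI allI impI continuous_on_const assms(1) weak) simp
qed

lemma omega_limit_set_eq: "omega_limit_set K \<rho> = MS.omega_limits \<rho>"
  unfolding omega_limit_set_def MS.omega_limits_def ..

lemma omega_limit_stationary:
  assumes "\<mu> \<in> omega_limit_set K \<rho>"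
  shows "\<mu> \<in> stationary_solutions K \<zeta> Phi"
proof -
  obtain t :: "nat \<Rightarrow> real" where \<mu>: "\<mu> \<in> prob_on K" and t: "\<forall>n. 0 \<le> t n" "filterlim t at_top sequentially"
    "(\<lambda>n. wasserstein1 (\<rho> (t n)) \<mu>) \<longlonglongrightarrow> 0"
    using assms by (auto simp: omega_limit_set_def)
  have "(\<lambda>n. I (t n)) \<longlonglongrightarrow> dissipation Phi \<mu>"
  proof (rule LIM_zero_cancel, rule Lim_null_comparison)
    show "eventually (\<lambda>n. norm (I (t n) - dissipation Phi \<mu>) \<le> dissipation_const * wasserstein1 (\<rho> (t n)) \<mu>) sequentially"
      unfolding I_def real_norm_def using t(1)
      by (intro always_eventually allI dissipation_diff close_wasserstein1 \<rho>_prob \<mu>) auto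
    show "(\<lambda>n. dissipation_const * wasserstein1 (\<rho> (t n)) \<mu>) \<longlonglongrightarrow> 0"
      using tendsto_mult_right_zero[OF t(3)] .
  qed
  moreover have "(\<lambda>n. I (t n)) \<longlonglongrightarrow> 0"
    using filterlim_compose[OF I_tendsto_0 t(2)] .
  ultimately have "dissipation Phi \<mu> = 0" by (rule LIMSEQ_unique)
  then show ?thesis by (rule stationary[OF \<mu>])
qed

theorem long_time_behaviour:
  defines "\<S> \<equiv> stationary_solutions K \<zeta> Phi"
  shows "(\<exists>E. ((\<lambda>t. energy (\<rho> t)) \<longlongrightarrow> E) at_top)
    \<and> ((\<lambda>t. dissipation Phi (\<rho> t)) \<longlongrightarrow> 0) at_top
    \<and> (\<forall>\<mu>\<in>omega_limit_set K \<rho>. \<mu> \<in> \<S>)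
    \<and> (omega_limit_set K \<rho> \<noteq> {} \<and> compactin (W1_topology K) (omega_limit_set K \<rho>)
        \<and> connectedin (W1_topology K) (omega_limit_set K \<rho>) \<and> omega_limit_set K \<rho> \<subseteq> \<S>)
    \<and> (totally_disconnectedin (W1_topology K) (\<S> \<inter> omega_limit_set K \<rho>) \<longrightarrow>
        (\<exists>\<mu>\<in>\<S>. ((\<lambda>t. wasserstein1 (\<rho> t) \<mu>) \<longlongrightarrow> 0) at_top))
    \<and> (finite (\<S> \<inter> omega_limit_set K \<rho>) \<longrightarrow>
        totally_disconnectedin (W1_topology K) (\<S> \<inter> omega_limit_set K \<rho>))"
proof -
  let ?\<Omega> = "omega_limit_set K \<rho>"
  note pre = precompact[unfolded W1_topology_def]
  have sub: "?\<Omega> \<subseteq> \<S>" unfolding \<S>_def using omega_limit_stationary by blast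
  then have inter: "\<S> \<inter> ?\<Omega> = ?\<Omega>" by blast
  have ne: "?\<Omega> \<noteq> {}"
    unfolding omega_limit_set_eq by (rule MS.omega_limits_nonempty[OF \<rho>_prob pre])
  have comp: "compactin (W1_topology K) ?\<Omega>"
    unfolding omega_limit_set_eq W1_topology_def by (rule MS.compactin_omega_limits[OF \<rho>_prob pre])
  have conn: "connectedin (W1_topology K) ?\<Omega>"
    unfolding omega_limit_set_eq W1_topology_def
    by (rule MS.connectedin_omega_limits[OF \<rho>_prob pre wasserstein1_continuous])
  have "\<exists>\<mu>\<in>\<S>. ((\<lambda>t. wasserstein1 (\<rho> t) \<mu>) \<longlongrightarrow> 0) at_top" if "totally_disconnectedin (W1_topology K) ?\<Omega>"
  proof -
    obtain \<mu> where \<mu>: "\<mu> \<in> ?\<Omega>" using ne by blast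
    \<comment> \<open>The omega-limit set is itself one of its connected subsets, so total
      disconnectedness reduces it to a point.\<close>
    have "?\<Omega> \<subseteq> {\<mu>}"
      using that conn \<mu> unfolding totally_disconnectedin_def by blast
    then have "((\<lambda>t. wasserstein1 (\<rho> t) \<mu>) \<longlongrightarrow> 0) at_top"
      using MS.orbit_converges[OF \<rho>_prob pre] unfolding omega_limit_set_eq by blast
    then show ?thesis using \<mu> sub by blast
  qed
  moreover have "totally_disconnectedin (W1_topology K) ?\<Omega>" if "finite ?\<Omega>"
    unfolding W1_topology_def using that
    by (intro MS.finite_totally_disconnectedin) (auto simp: omega_limit_set_def)
  moreover have "((\<lambda>t. dissipation Phi (\<rho> t)) \<longlongrightarrow> 0) at_top"
    using I_tendsto_0 unfolding I_def .
  ultimately show ?thesis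
    using energy_converges ne comp conn sub unfolding inter by auto
qed

end

section \<open>The cross-entropy loss\<close>

lemma softmax_pos: "0 < softmax z $ j"
  unfolding softmax_def by (simp add: sum_pos)

lemma softmax_sum: "(\<Sum>j\<in>UNIV. softmax z $ j) = 1"
proof -
  have "0 < (\<Sum>m\<in>UNIV. exp (z $ m))" by (rule sum_pos) auto
  then show ?thesis unfolding softmax_def by (simp flip: sum_divide_distrib)
qed

lemma norm_vec_le_sum: "norm x \<le> (\<Sum>i\<in>UNIV. norm (x $ i))"
  unfolding norm_vec_def by (rule L2_set_le_sum) simp

lemma norm_softmax_le: "norm (softmax z) \<le> 1"
  using norm_vec_le_sum[of "softmax z"] softmax_sum[of z] less_imp_le[OF softmax_pos[of z]] by simp

lemma norm_one_hot: "one_hot y \<Longrightarrow> norm y = 1"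
  by (auto simp: one_hot_def)

text \<open>Jensen's inequality for the exponential, from its tangent at the mean \<open>m\<close>.\<close>

lemma cross_entropy_convex:
  "(softmax z - y) \<bullet> (z' - z) \<le> cross_entropy y z' - cross_entropy y z"
proof -
  let ?S = "\<Sum>j\<in>UNIV. exp (z $ j)" and ?S' = "\<Sum>j\<in>UNIV. exp (z' $ j)"
  define m where "m = softmax z \<bullet> (z' - z)"
  have S: "0 < ?S" "0 < ?S'" by (auto intro: sum_pos)
  have m: "m = (\<Sum>j\<in>UNIV. softmax z $ j * (z' $ j - z $ j))"
    by (simp add: m_def inner_vec_def)
  \<comment> \<open>The linear terms cancel because \<open>m\<close> is exactly their
    softmax-weighted mean.\<close>
  have "1 = (\<Sum>j\<in>UNIV. softmax z $ j * (1 + (z' $ j - z $ j - m)))"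
    unfolding distrib_left right_diff_distrib[of _ _ m] sum.distrib sum_subtractf
    by (simp add: softmax_sum m[symmetric] flip: sum_distrib_right)
  also have "\<dots> \<le> (\<Sum>j\<in>UNIV. softmax z $ j * exp (z' $ j - z $ j - m))"
    using less_imp_le[OF softmax_pos[of z]] by (intro sum_mono mult_left_mono exp_ge_add_one_self) auto
  also have "\<dots> = (\<Sum>j\<in>UNIV. exp (z' $ j) * (exp (- m) / ?S))"
  proof (intro sum.cong refl)
    fix j
    have "exp (z' $ j - z $ j - m) = exp (z' $ j) * inverse (exp (z $ j)) * exp (- m)"
      by (simp add: exp_diff exp_minus divide_inverse)
    then show "softmax z $ j * exp (z' $ j - z $ j - m) = exp (z' $ j) * (exp (- m) / ?S)"
      by (simp add: softmax_def)
  qed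
  also have "\<dots> = ?S' * (exp (- m) / ?S)" by (rule sum_distrib_right[symmetric])
  finally have "exp m \<le> ?S' / ?S" using S by (simp add: exp_minus field_simps)
  then have "m \<le> ln (?S' / ?S)" using S by (simp add: ln_ge_iff)
  also have "\<dots> = ln ?S' - ln ?S" using S by (simp add: ln_div)
  finally show ?thesis
    unfolding cross_entropy_def m_def by (simp add: inner_diff_left inner_diff_right)
qed

text \<open>For a one-hot label the loss is log-sum-exp minus one of its exponents, and the sum of
  exponentials dominates each term.\<close>

lemma cross_entropy_nonneg:
  assumes "one_hot y"
  shows "0 \<le> cross_entropy y z"
proof -
  obtain j where y: "y = axis j 1" using assms by (auto simp: one_hot_def)
  have "exp (z $ j) \<le> (\<Sum>j\<in>UNIV. exp (z $ j))"
    by (rule member_le_sum) auto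
  then have "z $ j \<le> ln (\<Sum>j\<in>UNIV. exp (z $ j))"
    by (subst ln_ge_iff) (auto intro: sum_pos)
  then show ?thesis by (simp add: cross_entropy_def y inner_axis')
qed

text \<open>The derivative along \<open>h\<close> is the softmax component times the deviation of
  \<open>h $ j\<close> from the softmax-weighted mean of \<open>h\<close>. The component is at most
  one, and entry and mean are each at most \<open>norm h\<close>, whence the factor 2.\<close>

lemma softmax_component_lipschitz:
  "\<bar>softmax z $ j - softmax z' $ j\<bar> \<le> 2 * norm (z - z')"
proof -
  have "norm (softmax z $ j - softmax z' $ j) \<le> 2 * norm (z - z')"
  proof (rule differentiable_bound[where S = UNIV])
    fix x :: "real ^ 'a"
    let ?S = "\<Sum>m\<in>UNIV. exp (x $ m)"
    have S: "0 < ?S" by (rule sum_pos) auto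
    have nth: "((\<lambda>x. x $ i) has_derivative (\<lambda>h. h $ i)) (at x)" for i
      by (rule bounded_linear_imp_has_derivative[OF bounded_linear_vec_nth])
    have e: "((\<lambda>x. exp (x $ i)) has_derivative (\<lambda>h. exp (x $ i) * h $ i)) (at x)" for i
      using has_derivative_exp[OF nth] by (simp add: mult.commute)
    have "((\<lambda>x. exp (x $ j) / (\<Sum>m\<in>UNIV. exp (x $ m))) has_derivative
        (\<lambda>h. (exp (x $ j) * h $ j * ?S - exp (x $ j) * (\<Sum>m\<in>UNIV. exp (x $ m) * h $ m)) / (?S * ?S))) (at x)"
      using S by (intro has_derivative_divide' has_derivative_sum e) simp
    moreover have "(exp (x $ j) * h $ j * ?S - exp (x $ j) * (\<Sum>m\<in>UNIV. exp (x $ m) * h $ m)) / (?S * ?S)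
        = softmax x $ j * (h $ j - (\<Sum>m\<in>UNIV. softmax x $ m * h $ m))" for h
    proof -
      have "(\<Sum>m\<in>UNIV. softmax x $ m * h $ m) = (\<Sum>m\<in>UNIV. exp (x $ m) * h $ m) / ?S"
        by (simp add: softmax_def sum_divide_distrib)
      then show ?thesis using S by (simp add: softmax_def field_simps)
    qed
    ultimately show "((\<lambda>x. softmax x $ j) has_derivative
        (\<lambda>h. softmax x $ j * (h $ j - (\<Sum>m\<in>UNIV. softmax x $ m * h $ m)))) (at x within UNIV)"
      by (simp add: softmax_def)
    show "onorm (\<lambda>h. softmax x $ j * (h $ j - (\<Sum>m\<in>UNIV. softmax x $ m * h $ m))) \<le> 2"
    proof (rule onorm_le)
      fix h :: "real ^ 'a"
      have p: "0 \<le> softmax x $ m" for m using softmax_pos[of x m] by simp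
      have "softmax x $ j \<le> 1"
        using member_le_sum[of j UNIV "\<lambda>j. softmax x $ j"] p softmax_sum[of x] by simp
      have "\<bar>\<Sum>m\<in>UNIV. softmax x $ m * h $ m\<bar> \<le> (\<Sum>m\<in>UNIV. softmax x $ m * norm h)"
        by (rule order_trans[OF sum_abs sum_mono])
          (simp add: abs_mult p mult_left_mono component_le_norm_cart)
      also have "\<dots> = norm h" by (simp add: softmax_sum flip: sum_distrib_right)
      finally have "\<bar>h $ j - (\<Sum>m\<in>UNIV. softmax x $ m * h $ m)\<bar> \<le> 2 * norm h"
        using component_le_norm_cart[of h j] by linarith
      then have "softmax x $ j * \<bar>h $ j - (\<Sum>m\<in>UNIV. softmax x $ m * h $ m)\<bar> \<le> 1 * (2 * norm h)"
        using \<open>softmax x $ j \<le> 1\<close> p by (intro mult_mono) auto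
      then show "norm (softmax x $ j * (h $ j - (\<Sum>m\<in>UNIV. softmax x $ m * h $ m))) \<le> 2 * norm h"
        by (simp add: abs_mult p)
    qed
  qed auto
  then show ?thesis by simp
qed

lemma softmax_lipschitz:
  fixes z z' :: "real ^ 'v"
  shows "norm (softmax z - softmax z') \<le> 2 * real CARD('v) * norm (z - z')"
proof -
  have "norm (softmax z - softmax z') \<le> (\<Sum>j\<in>(UNIV :: 'v set). 2 * norm (z - z'))"
    by (rule order_trans[OF norm_vec_le_sum sum_mono]) (simp add: softmax_component_lipschitz)
  then show ?thesis by simp
qed

lemma continuous_on_softmax: "continuous_on UNIV softmax"
proof -
  have "(\<Sum>m\<in>UNIV. exp (z $ m)) \<noteq> 0" for z :: "real ^ 'a"
    using sum_pos[of UNIV "\<lambda>m. exp (z $ m)"] by simp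
  then show ?thesis unfolding softmax_def[abs_def] by (intro continuous_intros) auto
qed

lemma continuous_on_log_sum_exp: "continuous_on UNIV (\<lambda>z :: real ^ 'v. ln (\<Sum>j\<in>UNIV. exp (z $ j)))"
proof -
  have "(\<Sum>m\<in>UNIV. exp (z $ m)) \<noteq> 0" for z :: "real ^ 'v"
    using sum_pos[of UNIV "\<lambda>m. exp (z $ m)"] by simp
  then show ?thesis by (intro continuous_intros) auto
qed

section \<open>Passage from the abstract flow to the attention head\<close>

lemma borel_measurable_vec_lambda:
  fixes f :: "'i::finite \<Rightarrow> 'a \<Rightarrow> 'b::euclidean_space"
  assumes "\<And>i. f i \<in> borel_measurable M"
  shows "(\<lambda>x. \<chi> i. f i x) \<in> borel_measurable M"
  unfolding borel_measurable_euclidean_space[of "\<lambda>x. \<chi> i. f i x"]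
  using assms by (auto simp: Basis_vec_def inner_axis)

lemma compact_inputs:
  assumes "compact K\<^sub>x"
  shows "compact (inputs K\<^sub>x :: ('l::finite, 'x::finite) tokens set)"
  unfolding compact_eq_bounded_closed
proof
  obtain c where c: "\<And>x. x \<in> K\<^sub>x \<Longrightarrow> norm x \<le> c"
    using compact_imp_bounded[OF assms] by (auto simp: bounded_iff)
  have "norm X \<le> (\<Sum>l\<in>(UNIV :: 'l set). c)" if "X \<in> inputs K\<^sub>x" for X :: "('l, 'x) tokens"
    by (rule order_trans[OF norm_vec_le_sum sum_mono]) (use that c in \<open>auto simp: inputs_def\<close>)
  then show "bounded (inputs K\<^sub>x :: ('l, 'x) tokens set)" unfolding bounded_iff by blast
  have "closed ((\<lambda>X :: ('l, 'x) tokens. X $ l) -` K\<^sub>x)" for l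
    by (intro closed_vimage compact_imp_closed assms continuous_intros)
  moreover have "inputs K\<^sub>x = (\<Inter>l. (\<lambda>X :: ('l, 'x) tokens. X $ l) -` K\<^sub>x)"
    by (auto simp: inputs_def)
  ultimately show "closed (inputs K\<^sub>x :: ('l, 'x) tokens set)" by auto
qed

text \<open>The abstract potential is identified with \<open>first_variation\<close> only for
  measures in \<open>prob_on K\<close>, where outputs are integrable. A weak solution visits no
  other measures on the half-line.\<close>

lemma weak_solution_cong:
  assumes "\<And>\<mu>. \<mu> \<in> prob_on K \<Longrightarrow> \<Phi> \<mu> = \<Phi>' \<mu>"
  shows "weak_solution K \<zeta> \<Phi> \<rho> \<longleftrightarrow> weak_solution K \<zeta> \<Phi>' \<rho>"
proof (cases "\<forall>t\<ge>0. \<rho> t \<in> prob_on K")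
  case True
  have "(LINT t:{0<..}|lborel. \<eta> t * (- 2 * \<zeta> t * (\<integral>\<omega>. gradient f \<omega> \<bullet> gradient (\<Phi> (\<rho> t)) \<omega> \<partial>\<rho> t)))
      = (LINT t:{0<..}|lborel. \<eta> t * (- 2 * \<zeta> t * (\<integral>\<omega>. gradient f \<omega> \<bullet> gradient (\<Phi>' (\<rho> t)) \<omega> \<partial>\<rho> t)))"
    for f :: "'a \<Rightarrow> real" and \<eta>
    unfolding set_lebesgue_integral_def
    by (rule Bochner_Integration.integral_cong) (use True assms in \<open>auto simp: indicator_def\<close>)
  then show ?thesis unfolding weak_solution_def by simp
next
  case False
  then show ?thesis unfolding weak_solution_def by argo
qed

lemma stationary_solutions_cong:
  assumes "\<And>\<mu>. \<mu> \<in> prob_on K \<Longrightarrow> \<Phi> \<mu> = \<Phi>' \<mu>"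
  shows "stationary_solutions K \<zeta> \<Phi> = stationary_solutions K \<zeta> \<Phi>'"
  unfolding stationary_solutions_def using weak_solution_cong[of K \<Phi> \<Phi>' \<zeta>, OF assms] by simp

text \<open>Unpacks two orders of smoothness. The finitely many bounds, one for the function and one
  for each partial derivative, are merged into a single constant by summation.\<close>

lemma Cn_param_2_bounded:
  fixes f :: "'p::metric_space \<Rightarrow> 'a::euclidean_space \<Rightarrow> 'b::real_normed_vector"
  assumes f: "Cn_param 2 f" and C: "compact C" and S: "compact S"
  obtains D D2 B where
    "\<And>b. b \<in> Basis \<Longrightarrow> jointly_continuous (D b)"
    "\<And>b c. b \<in> Basis \<Longrightarrow> c \<in> Basis \<Longrightarrow> jointly_continuous (D2 b c)"
    "\<And>p x. (f p has_derivative (\<lambda>h. \<Sum>b\<in>Basis. (h \<bullet> b) *\<^sub>R D b p x)) (at x)"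
    "\<And>b p x. b \<in> Basis \<Longrightarrow> (D b p has_derivative (\<lambda>h. \<Sum>c\<in>Basis. (h \<bullet> c) *\<^sub>R D2 b c p x)) (at x)"
    "0 \<le> B" "\<And>p x. p \<in> C \<Longrightarrow> x \<in> S \<Longrightarrow> norm (f p x) \<le> B"
    "\<And>b p x. b \<in> Basis \<Longrightarrow> p \<in> C \<Longrightarrow> x \<in> S \<Longrightarrow> norm (D b p x) \<le> B"
    "\<And>b c p x. b \<in> Basis \<Longrightarrow> c \<in> Basis \<Longrightarrow> p \<in> C \<Longrightarrow> x \<in> S \<Longrightarrow> norm (D2 b c p x) \<le> B"
proof -
  have "Cn_param (Suc (Suc 0)) f" using f by (simp add: numeral_2_eq_2)
  then obtain D where D: "\<And>b. b \<in> Basis \<Longrightarrow> Cn_param (Suc 0) (D b)"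
    "\<And>p x. (f p has_derivative (\<lambda>h. \<Sum>b\<in>Basis. (h \<bullet> b) *\<^sub>R D b p x)) (at x)"
    by (rule Cn_param_SucE) (rule that)
  have "\<forall>b\<in>Basis. \<exists>E. (\<forall>c\<in>Basis. Cn_param 0 (E c)) \<and>
      (\<forall>p x. (D b p has_derivative (\<lambda>h. \<Sum>c\<in>Basis. (h \<bullet> c) *\<^sub>R E c p x)) (at x))"
    using D(1) by simp
  from bchoice[OF this] obtain D2 where D2: "\<And>b c. b \<in> Basis \<Longrightarrow> c \<in> Basis \<Longrightarrow> Cn_param 0 (D2 b c)"
    "\<And>b p x. b \<in> Basis \<Longrightarrow> (D b p has_derivative (\<lambda>h. \<Sum>c\<in>Basis. (h \<bullet> c) *\<^sub>R D2 b c p x)) (at x)"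
    by blast
  note cD = Cn_param_continuous[OF D(1)] and cD2 = Cn_param_continuous[OF D2(1)]
  have ex: "\<exists>B. 0 \<le> B \<and> (\<forall>p\<in>C. \<forall>x\<in>S. norm (g p x) \<le> B)" if "jointly_continuous g"
    for g :: "'p \<Rightarrow> 'a \<Rightarrow> 'b"
    by (rule continuous_on_param_bounded[OF that C S]) blast
  obtain B0 where B0: "0 \<le> B0" "\<And>p x. p \<in> C \<Longrightarrow> x \<in> S \<Longrightarrow> norm (f p x) \<le> B0"
    using ex[OF Cn_param_continuous[OF f]] by blast
  have "\<forall>b\<in>Basis. \<exists>B. 0 \<le> B \<and> (\<forall>p\<in>C. \<forall>x\<in>S. norm (D b p x) \<le> B)"
    using ex[OF cD] by blast
  from bchoice[OF this] obtain B1 where B1: "\<And>b. b \<in> Basis \<Longrightarrow> 0 \<le> B1 b"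
    "\<And>b p x. b \<in> Basis \<Longrightarrow> p \<in> C \<Longrightarrow> x \<in> S \<Longrightarrow> norm (D b p x) \<le> B1 b"
    by blast
  have "\<forall>q\<in>Basis \<times> Basis. \<exists>B. 0 \<le> B \<and> (\<forall>p\<in>C. \<forall>x\<in>S. norm (D2 (fst q) (snd q) p x) \<le> B)"
    using ex[OF cD2] by auto
  from bchoice[OF this] obtain B2 where "\<forall>q\<in>Basis \<times> Basis. 0 \<le> B2 q \<and>
      (\<forall>p\<in>C. \<forall>x\<in>S. norm (D2 (fst q) (snd q) p x) \<le> B2 q)" by blast
  then have B2: "\<And>b c. b \<in> Basis \<Longrightarrow> c \<in> Basis \<Longrightarrow> 0 \<le> B2 (b, c)"
    "\<And>b c p x. b \<in> Basis \<Longrightarrow> c \<in> Basis \<Longrightarrow> p \<in> C \<Longrightarrow> x \<in> S \<Longrightarrow> norm (D2 b c p x) \<le> B2 (b, c)"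
    by auto
  define s1 where "s1 = (\<Sum>b\<in>Basis. B1 b)"
  define s2 where "s2 = (\<Sum>b\<in>Basis. \<Sum>c\<in>Basis. B2 (b, c))"
  have s: "0 \<le> s1" "0 \<le> s2" unfolding s1_def s2_def using B1 B2 by (auto intro!: sum_nonneg)
  have 1: "B1 b \<le> s1" if "b \<in> Basis" for b
    unfolding s1_def using that B1 by (intro member_le_sum) auto
  have 2: "B2 (b, c) \<le> s2" if "b \<in> Basis" "c \<in> Basis" for b c
  proof -
    have "B2 (b, c) \<le> (\<Sum>c\<in>Basis. B2 (b, c))" using that B2 by (intro member_le_sum) auto
    also have "\<dots> \<le> s2" unfolding s2_def using that B2 by (intro member_le_sum sum_nonneg) (auto intro: sum_nonneg)
    finally show ?thesis .
  qed
  show ?thesis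
  proof (rule that[of D D2 "B0 + s1 + s2"])
    show "0 \<le> B0 + s1 + s2" using B0 s by simp
    show "norm (f p x) \<le> B0 + s1 + s2" if "p \<in> C" "x \<in> S" for p x
      using B0(2)[OF that] s by linarith
    show "norm (D b p x) \<le> B0 + s1 + s2" if "b \<in> Basis" "p \<in> C" "x \<in> S" for b p x
      using B1(2)[OF that] 1[OF that(1)] s B0(1) by linarith
    show "norm (D2 b c p x) \<le> B0 + s1 + s2" if "b \<in> Basis" "c \<in> Basis" "p \<in> C" "x \<in> S" for b c p x
      using B2(2)[OF that] 2[OF that(1,2)] s B0(1) by linarith
  qed (use cD cD2 D(2) D2(2) in auto)
qed

theorem theorem6p6:
  fixes Wout :: "real ^ 'v ^ 'x"
    and P :: "('l::{finite,linorder}, 'x) tokens measure"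
    and Y :: "('l, 'x) tokens \<Rightarrow> 'l \<Rightarrow> real ^ 'v"
    and K :: "('x, 'k::finite) head set"
    and K\<^sub>x :: "(real ^ 'x) set"
    and \<zeta> :: "real \<Rightarrow> real"
    and \<rho> :: "real \<Rightarrow> ('x, 'k) head measure"
  defines "\<Phi> \<equiv> first_variation Wout P Y"
    and "\<S> \<equiv> stationary_solutions K \<zeta> (first_variation Wout P Y)"
  assumes "prob_space P" and "sets P = sets borel"
    and "\<And>l. (\<lambda>X. Y X l) \<in> borel_measurable P"
    and "\<And>X l. X \<in> inputs K\<^sub>x \<Longrightarrow> one_hot (Y X l)"
    and "learning_rate \<zeta>"
    and "smoothness Wout P K K\<^sub>x"
    and "weak_solution K \<zeta> \<Phi> \<rho>"
    and "compactin (W1_topology K) (W1_topology K closure_of (\<rho> ` {0..}))"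
  shows "(\<exists>E. ((\<lambda>t. risk Wout P Y (\<rho> t)) \<longlongrightarrow> E) at_top)
    \<and> ((\<lambda>t. dissipation \<Phi> (\<rho> t)) \<longlongrightarrow> 0) at_top
    \<and> (\<forall>\<mu>\<in>omega_limit_set K \<rho>. \<mu> \<in> \<S>)
    \<and> (omega_limit_set K \<rho> \<noteq> {} \<and> compactin (W1_topology K) (omega_limit_set K \<rho>)
        \<and> connectedin (W1_topology K) (omega_limit_set K \<rho>) \<and> omega_limit_set K \<rho> \<subseteq> \<S>)
    \<and> (totally_disconnectedin (W1_topology K) (\<S> \<inter> omega_limit_set K \<rho>) \<longrightarrow>
        (\<exists>\<mu>\<in>\<S>. ((\<lambda>t. wasserstein1 (\<rho> t) \<mu>) \<longlongrightarrow> 0) at_top))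
    \<and> (finite (\<S> \<inter> omega_limit_set K \<rho>) \<longrightarrow>
        totally_disconnectedin (W1_topology K) (\<S> \<inter> omega_limit_set K \<rho>))"
proof -
  interpret P: prob_space P by fact
  have smooth: "compact K" "compact K\<^sub>x" "AE X in P. X \<in> inputs K\<^sub>x"
    using assms(8) by (auto simp: smoothness_def)
  \<comment> \<open>All positions form one vector of logits, so that \<open>\<Lambda>\<close>, the
    loss averaged over positions, is one convex function with gradient \<open>W\<close>.\<close>
  define \<Psi> :: "('l, 'x) tokens \<Rightarrow> ('x, 'k) head \<Rightarrow> (real ^ 'v, 'l) vec" where
    "\<Psi> X \<omega> = (\<chi> l. head_output Wout l X \<omega>)" for X \<omega>
  define W :: "('l, 'x) tokens \<Rightarrow> (real ^ 'v, 'l) vec \<Rightarrow> (real ^ 'v, 'l) vec" where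
    "W X z = (1 / real CARD('l)) *\<^sub>R (\<chi> l. softmax (z $ l) - Y X l)" for X z
  define \<Lambda> where "\<Lambda> X z = (1 / real CARD('l)) * (\<Sum>l\<in>UNIV. cross_entropy (Y X l) (z $ l))"
    for X and z :: "(real ^ 'v, 'l) vec"
  have \<Psi>_nth: "\<Psi> X \<omega> $ l = head_output Wout l X \<omega>" for X \<omega> l by (simp add: \<Psi>_def)
  let ?C = "inputs K\<^sub>x :: ('l, 'x) tokens set"
  have C: "compact ?C" by (rule compact_inputs[OF smooth(2)])
  obtain R where R: "K \<subseteq> cball 0 R"
    using compact_imp_bounded[OF smooth(1)] by (auto simp: bounded_iff subset_iff)
  have \<Psi>: "Cn_param 2 \<Psi>" unfolding \<Psi>_def[abs_def] by (rule Cn_param_head_output)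
  obtain D D2 B where DB:
    "\<And>b. b \<in> Basis \<Longrightarrow> jointly_continuous (D b)"
    "\<And>b c. b \<in> Basis \<Longrightarrow> c \<in> Basis \<Longrightarrow> jointly_continuous (D2 b c)"
    "\<And>p x. (\<Psi> p has_derivative (\<lambda>h. \<Sum>b\<in>Basis. (h \<bullet> b) *\<^sub>R D b p x)) (at x)"
    "\<And>b p x. b \<in> Basis \<Longrightarrow> (D b p has_derivative (\<lambda>h. \<Sum>c\<in>Basis. (h \<bullet> c) *\<^sub>R D2 b c p x)) (at x)"
    "0 \<le> B" "\<And>p x. p \<in> ?C \<Longrightarrow> x \<in> cball 0 R \<Longrightarrow> norm (\<Psi> p x) \<le> B"
    "\<And>b p x. b \<in> Basis \<Longrightarrow> p \<in> ?C \<Longrightarrow> x \<in> cball 0 R \<Longrightarrow> norm (D b p x) \<le> B"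
    "\<And>b c p x. b \<in> Basis \<Longrightarrow> c \<in> Basis \<Longrightarrow> p \<in> ?C \<Longrightarrow> x \<in> cball 0 R \<Longrightarrow> norm (D2 b c p x) \<le> B"
    by (rule Cn_param_2_bounded[OF \<Psi> C compact_cball]) (rule that)
  have Y: "(\<lambda>X. Y X l) \<in> borel_measurable borel" for l
    using assms(5)[of l] assms(4) measurable_cong_sets by blast
  have nth: "(\<lambda>X. Z X $ l) \<in> borel_measurable borel" if "Z \<in> borel_measurable borel"
    for Z :: "('l, 'x) tokens \<Rightarrow> (real ^ 'v, 'l) vec" and l
    by (rule borel_measurable_continuous_on[OF _ that, of "\<lambda>z. z $ l"]) (intro continuous_intros)
  \<comment> \<open>The first constant has to dominate both the norm of \<open>W\<close>, at most 2,
    and the loss at zero logits, which is \<open>ln (real CARD('v))\<close>. The second comes from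
    \<open>softmax_lipschitz\<close>; averaging over positions absorbs the sum over them.\<close>
  interpret mean_field P ?C K \<Psi> D D2 W \<Lambda> "2 + ln (real CARD('v))" "2 * real CARD('v)" R B
  proof
    show "jointly_continuous \<Psi>" by (rule Cn_param_continuous[OF \<Psi>])
    show "(\<lambda>X. W X (Z X)) \<in> borel_measurable borel" if "Z \<in> borel_measurable borel" for Z
      unfolding W_def
      by (intro borel_measurable_scaleR borel_measurable_const borel_measurable_vec_lambda borel_measurable_diff Y
        borel_measurable_continuous_on[OF continuous_on_softmax nth[OF that]])
    show "(\<lambda>X. \<Lambda> X (Z X)) \<in> borel_measurable borel" if "Z \<in> borel_measurable borel" for Z
      unfolding \<Lambda>_def cross_entropy_def
      by (intro borel_measurable_times borel_measurable_const borel_measurable_sum borel_measurable_diff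
        borel_measurable_inner Y nth[OF that]
        borel_measurable_continuous_on[OF continuous_on_log_sum_exp nth[OF that]])
    fix X assume X: "X \<in> ?C"
    show "norm (W X z) \<le> 2 + ln (real CARD('v))" for z
    proof -
      have "norm (\<chi> l. softmax (z $ l) - Y X l) \<le> (\<Sum>l\<in>(UNIV :: 'l set). 2)"
      proof (rule order_trans[OF norm_vec_le_sum sum_mono])
        fix l
        show "norm ((\<chi> l. softmax (z $ l) - Y X l) $ l) \<le> 2"
          using norm_triangle_ineq4[of "softmax (z $ l)" "Y X l"] norm_softmax_le[of "z $ l"]
            norm_one_hot[OF assms(6)[OF X, of l]] by simp
      qed
      then have "norm (W X z) \<le> 2" by (simp add: W_def field_simps)
      moreover have "0 \<le> ln (real CARD('v))" by (simp add: Suc_leI)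
      ultimately show ?thesis by linarith
    qed
    show "norm (W X z - W X z') \<le> 2 * real CARD('v) * norm (z - z')" for z z'
    proof -
      have "norm (\<chi> l. softmax (z $ l) - softmax (z' $ l)) \<le> (\<Sum>l\<in>(UNIV :: 'l set). 2 * real CARD('v) * norm (z - z'))"
      proof (rule order_trans[OF norm_vec_le_sum sum_mono])
        fix l
        have "norm (z $ l - z' $ l) \<le> norm (z - z')"
          using Finite_Cartesian_Product.norm_nth_le[of "z - z'" l] by simp
        then have "2 * real CARD('v) * norm (z $ l - z' $ l) \<le> 2 * real CARD('v) * norm (z - z')"
          by (rule mult_left_mono) simp
        from order_trans[OF softmax_lipschitz this] show "norm ((\<chi> l. softmax (z $ l) - softmax (z' $ l)) $ l) \<le> 2 * real CARD('v) * norm (z - z')"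
          by simp
      qed
      moreover have "W X z - W X z' = (1 / real CARD('l)) *\<^sub>R (\<chi> l. softmax (z $ l) - softmax (z' $ l))"
        by (simp add: W_def vec_eq_iff right_diff_distrib)
      ultimately show ?thesis by (simp add: field_simps)
    qed
    show "W X z \<bullet> (z' - z) \<le> \<Lambda> X z' - \<Lambda> X z" for z z'
    proof -
      have "W X z \<bullet> (z' - z) = (1 / real CARD('l)) * (\<Sum>l\<in>UNIV. (softmax (z $ l) - Y X l) \<bullet> (z' $ l - z $ l))"
        by (simp add: W_def inner_vec_def[of "\<chi> l. softmax (z $ l) - Y X l"])
      also have "\<dots> \<le> (1 / real CARD('l)) * (\<Sum>l\<in>UNIV. cross_entropy (Y X l) (z' $ l) - cross_entropy (Y X l) (z $ l))"
        by (intro mult_left_mono sum_mono cross_entropy_convex) simp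
      finally show ?thesis by (simp add: \<Lambda>_def sum_subtractf right_diff_distrib)
    qed
    show "0 \<le> \<Lambda> X z" for z
      unfolding \<Lambda>_def using cross_entropy_nonneg[OF assms(6)[OF X]]
      by (intro mult_nonneg_nonneg sum_nonneg) auto
    show "\<Lambda> X 0 \<le> 2 + ln (real CARD('v))"
      by (simp add: \<Lambda>_def cross_entropy_def)
  qed (use assms(4) smooth C R DB in auto)
  \<comment> \<open>Taking a component commutes with the integral because the packed output is
    integrable, which holds for measures carried by \<open>K\<close>.\<close>
  have logits: "logits \<mu> X $ l = mean_logits Wout \<mu> l X" if "\<mu> \<in> prob_on K" for \<mu> X l
    using integral_bounded_linear[OF bounded_linear_vec_nth[of l] continuous_integrable[OF that \<Psi>_continuous[of X]]]
    by (simp add: logits_def mean_logits_def \<Psi>_nth)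
  have Phi: "Phi \<mu> = \<Phi> \<mu>" if "\<mu> \<in> prob_on K" for \<mu>
  proof
    fix \<omega>
    have "w \<mu> X \<bullet> \<Psi> X \<omega> = (1 / real CARD('l)) *
        (\<Sum>l\<in>UNIV. (softmax (mean_logits Wout \<mu> l X) - Y X l) \<bullet> head_output Wout l X \<omega>)" for X
      by (simp add: w_def W_def \<Psi>_def logits[OF that] inner_vec_def[of "\<chi> l. softmax (mean_logits Wout \<mu> l X) - Y X l"])
    then show "Phi \<mu> \<omega> = \<Phi> \<mu> \<omega>"
      unfolding Phi_def weighted_def \<Phi>_def first_variation_def by simp
  qed
  interpret mean_field_flow P ?C K \<Psi> D D2 W \<Lambda> "2 + ln (real CARD('v))" "2 * real CARD('v)" R B \<zeta> \<rho>
    by unfold_locales (use assms(7,9,10) weak_solution_cong[of K Phi \<Phi> \<zeta> \<rho>, OF Phi] in auto)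
  have ev: "eventually (\<lambda>t. \<rho> t \<in> prob_on K) at_top"
    using eventually_ge_at_top[of "0::real"] by eventually_elim (rule \<rho>_prob)
  have risk: "((\<lambda>t. energy (\<rho> t)) \<longlongrightarrow> E) at_top \<longleftrightarrow> ((\<lambda>t. risk Wout P Y (\<rho> t)) \<longlongrightarrow> E) at_top" for E
    by (rule tendsto_cong) (use ev in eventually_elim, simp add: energy_def risk_def \<Lambda>_def logits)
  have diss: "((\<lambda>t. dissipation Phi (\<rho> t)) \<longlongrightarrow> 0) at_top \<longleftrightarrow> ((\<lambda>t. dissipation \<Phi> (\<rho> t)) \<longlongrightarrow> 0) at_top"
    by (rule tendsto_cong) (use ev in eventually_elim, simp add: dissipation_def Phi)
  have "stationary_solutions K \<zeta> Phi = \<S>"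
    unfolding \<S>_def by (rule stationary_solutions_cong) (simp add: Phi \<Phi>_def)
  then show ?thesis
    using long_time_behaviour unfolding risk diss by simp
qed

end
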